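(* Finding an $\alpha\in\mathbb{R}^m$ minimizing the conditional pairwise risk $$\ell(\alpha,\mu)=\sum_{i<j}Y^\mu_{ij}\,1(\alpha_i\le\alpha_j)+\sum_{i>j}Y^\mu_{ij}\,1(\alpha_i<\alpha_j)$$ is NP-hard.
   Context: Each preference judgment $Y$ is the weighted adjacency matrix of a directed acyclic graph whose nodes are the $m$ items $\{1,\dots,m\}$ to be ranked; $Y_{ij}$ is the weight of the directed edge $i\to j$ (the penalty for failing to score item $i$ above item $j$). The vector $\alpha\in\mathbb{R}^m$ contains the predicted scores of the items. The pairwise loss is $$L(\alpha,Y)=\sum_{i<j}Y_{ij}1(\alpha_i\le\alpha_j)+\sum_{i>j}Y_{ij}1(\alpha_i<\alpha_j).$$ For a probability measure $\mu$ on such adjacency matrices, $Y^\mu_{ij}=\int Y_{ij}\,d\mu(Y)$, and the conditional risk is $\ell(\alpha,\mu)=\int L(\alpha,Y)\,d\mu(Y)$, which equals the expression displayed in the claim. NP is the class of nondeterministic polynomial time problems. *)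

theory Defs
  imports "HOL-Probability.Probability" "HOL-Computational_Algebra.Polynomial"
begin

section \<open>Turing machines\<close>

text \<open>
  Multi-tape machines over the alphabet \<open>{0..<symbols M}\<close> with two-way infinite tapes. Symbol 0 is
  the blank, 1 and 2 are the bits False and True. A tape is its contents together with the head
  position. The transition function is set-valued; an empty set means that the machine halts.
\<close>

type_synonym tape = "(int \<Rightarrow> nat) \<times> int"

type_synonym config = "nat \<times> tape list"

record tm =
  tapes :: nat
  states :: nat
  symbols :: nat
  start :: nat
  accept :: nat
  delta :: "nat \<Rightarrow> nat list \<Rightarrow> (nat \<times> nat list \<times> int list) set"

definition wf_tm :: "'a tm_scheme \<Rightarrow> bool" where
  "wf_tm M \<longleftrightarrow> 1 \<le> tapes M \<and> 3 \<le> symbols M \<and> start M < states M \<and> accept M < states M \<and>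
     (\<forall>q rs. q < states M \<and> length rs = tapes M \<and> set rs \<subseteq> {..<symbols M} \<longrightarrow>
        (\<forall>(q', ws, ds) \<in> delta M q rs.
           q' < states M \<and> length ws = tapes M \<and> set ws \<subseteq> {..<symbols M} \<and>
           length ds = tapes M \<and> set ds \<subseteq> {-1, 0, 1}))"

definition deterministic :: "'a tm_scheme \<Rightarrow> bool" where
  "deterministic M \<longleftrightarrow> (\<forall>q rs a b. a \<in> delta M q rs \<and> b \<in> delta M q rs \<longrightarrow> a = b)"

definition read_head :: "tape \<Rightarrow> nat" where
  "read_head t = fst t (snd t)"

definition write_move :: "tape \<Rightarrow> nat \<Rightarrow> int \<Rightarrow> tape" where
  "write_move t w d = ((fst t)(snd t := w), snd t + d)"

definition tape_of :: "bool list \<Rightarrow> tape" where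
  "tape_of xs =
     (\<lambda>i. if 0 \<le> i \<and> i < int (length xs) then (if xs ! nat i then 2 else 1) else 0, 0)"

text \<open>The bit string written from cell 0 up to (excluding) the first cell that holds no bit.\<close>

definition string_on :: "tape \<Rightarrow> bool list" where
  "string_on t = map (\<lambda>n. fst t (int n) = 2) [0..<LEAST n. fst t (int n) \<notin> {1, 2}]"

definition init_config :: "'a tm_scheme \<Rightarrow> bool list \<Rightarrow> config" where
  "init_config M x = (start M, tape_of x # replicate (tapes M - 1) (tape_of []))"

definition tm_step :: "'a tm_scheme \<Rightarrow> config \<Rightarrow> config \<Rightarrow> bool" where
  "tm_step M c c' \<longleftrightarrow> fst c \<noteq> accept M \<and>
     (\<exists>ws ds. (fst c', ws, ds) \<in> delta M (fst c) (map read_head (snd c)) \<and>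
        snd c' = map (\<lambda>(t, w, d). write_move t w d) (zip (snd c) (zip ws ds)))"

text \<open>
  Oracle machines: in the state \<open>query M\<close>, the string on tape number 1 is replaced, in one step, by
  the oracle's answer, and the machine continues in the state \<open>answer M\<close>.
\<close>

record oracle_tm = tm +
  query :: nat
  answer :: nat

definition wf_oracle_tm :: "oracle_tm \<Rightarrow> bool" where
  "wf_oracle_tm M \<longleftrightarrow> wf_tm M \<and> 2 \<le> tapes M \<and> query M < states M \<and> answer M < states M \<and>
     query M \<noteq> accept M"

definition oracle_step ::
    "oracle_tm \<Rightarrow> (bool list \<Rightarrow> bool list) \<Rightarrow> config \<Rightarrow> config \<Rightarrow> bool" where
  "oracle_step M g c c' \<longleftrightarrow>
     (if fst c = query M
      then c' = (answer M, (snd c)[1 := tape_of (g (string_on (snd c ! 1)))])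
      else tm_step M c c')"

text \<open>
  \<open>decides_in step init acc T L\<close>: every computation (on every nondeterministic branch) on input
  \<open>x\<close> makes at most \<open>T (length x)\<close> steps, and some branch accepts iff \<open>x \<in> L\<close>.
\<close>

definition decides_in ::
    "(config \<Rightarrow> config \<Rightarrow> bool) \<Rightarrow> (bool list \<Rightarrow> config) \<Rightarrow> nat \<Rightarrow> (nat \<Rightarrow> nat) \<Rightarrow> bool list set \<Rightarrow> bool"
  where
  "decides_in step init acc T L \<longleftrightarrow>
     (\<forall>x. (\<forall>n c. (step ^^ n) (init x) c \<longrightarrow> n \<le> T (length x)) \<and>
          (x \<in> L \<longleftrightarrow> (\<exists>c. step\<^sup>*\<^sup>* (init x) c \<and> fst c = acc)))"


section \<open>NP and NP-hardness of search problems\<close>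

definition NP :: "bool list set set" where
  "NP = {L. \<exists>(M :: tm) (p :: nat poly).
              wf_tm M \<and> decides_in (tm_step M) (init_config M) (accept M) (poly p) L}"

text \<open>
  A search problem is a relation between instances and their solutions. An oracle \<open>g\<close> solves it if
  it returns a solution of every instance that has one.
\<close>

type_synonym search_problem = "bool list \<Rightarrow> bool list \<Rightarrow> bool"

definition solves :: "(bool list \<Rightarrow> bool list) \<Rightarrow> search_problem \<Rightarrow> bool" where
  "solves g R \<longleftrightarrow> (\<forall>x. (\<exists>y. R x y) \<longrightarrow> R x (g x))"

text \<open>
  Polynomial-time Turing reducibility of a language to a search problem. The machine must work with
  every solver whose answers have polynomially bounded length (as those of any polynomial-time
  algorithm have); the running time may depend on that bound, but not on the solver.
\<close>

definition poly_turing_reducible :: "bool list set \<Rightarrow> search_problem \<Rightarrow> bool" where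
  "poly_turing_reducible L R \<longleftrightarrow>
     (\<exists>M. wf_oracle_tm M \<and> deterministic M \<and>
        (\<forall>b :: nat poly. \<exists>p :: nat poly. \<forall>g.
           solves g R \<and> (\<forall>x. length (g x) \<le> poly b (length x)) \<longrightarrow>
           decides_in (oracle_step M g) (init_config M) (accept M) (poly p) L))"

definition NP_hard :: "search_problem \<Rightarrow> bool" where
  "NP_hard R \<longleftrightarrow> (\<forall>L \<in> NP. poly_turing_reducible L R)"


section \<open>Binary encodings\<close>

text \<open>All encodings are prefix-free. Bits of numbers are listed from the least significant one.\<close>

fun bits_of :: "nat \<Rightarrow> bool list" where
  "bits_of n = (if n = 0 then [] else odd n # bits_of (n div 2))"

declare bits_of.simps [simp del]

definition enc_nat :: "nat \<Rightarrow> bool list" where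
  "enc_nat n = concat (map (\<lambda>b. [True, b]) (bits_of n)) @ [False]"

definition enc_int :: "int \<Rightarrow> bool list" where
  "enc_int z = (z < 0) # enc_nat (nat \<bar>z\<bar>)"

definition enc_rat :: "rat \<Rightarrow> bool list" where
  "enc_rat r = enc_int (fst (quotient_of r)) @ enc_int (snd (quotient_of r))"

definition enc_list :: "('a \<Rightarrow> bool list) \<Rightarrow> 'a list \<Rightarrow> bool list" where
  "enc_list e xs = concat (map (\<lambda>x. True # e x) xs) @ [False]"

lemma enc_nat_prefix_free:
  assumes "enc_nat a @ u = enc_nat b @ v"
  shows "a = b \<and> u = v"
proof -
  have split: "xs = ys \<and> u = v"
    if "concat (map (\<lambda>b. [True, b]) xs) @ False # u = concat (map (\<lambda>b. [True, b]) ys) @ False # v"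
    for xs ys
    using that
  proof (induction xs arbitrary: ys)
    case Nil
    then show ?case by (cases ys) auto
  next
    case (Cons x xs)
    then show ?case by (cases ys) auto
  qed
  have inj: "n = k" if "bits_of n = bits_of k" for n k
    using that
  proof (induction n arbitrary: k rule: less_induct)
    case (less n)
    show ?case
    proof (cases "n = 0 \<or> k = 0")
      case True
      then show ?thesis using less.prems bits_of.simps[of n] bits_of.simps[of k]
        by (auto split: if_splits)
    next
      case False
      then have *: "odd n = odd k" "bits_of (n div 2) = bits_of (k div 2)"
        using less.prems bits_of.simps[of n] bits_of.simps[of k] by auto
      have "n div 2 = k div 2"
        using False *(2) by (intro less.IH) auto
      with *(1) show ?thesis
        by (metis bit_eq_rec)
    qed
  qed
  show ?thesis
    using split[of "bits_of a" "bits_of b"] inj assms by (auto simp: enc_nat_def)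
qed

lemma enc_int_prefix_free: "enc_int a @ u = enc_int b @ v \<Longrightarrow> a = b \<and> u = v"
  using enc_nat_prefix_free[of "nat \<bar>a\<bar>" u "nat \<bar>b\<bar>" v] by (auto simp: enc_int_def)

lemma enc_rat_prefix_free:
  assumes "enc_rat a @ u = enc_rat b @ v"
  shows "a = b \<and> u = v"
proof -
  have "fst (quotient_of a) = fst (quotient_of b) \<and>
      enc_int (snd (quotient_of a)) @ u = enc_int (snd (quotient_of b)) @ v"
    using assms by (intro enc_int_prefix_free) (simp add: enc_rat_def)
  then have "quotient_of a = quotient_of b" "u = v"
    using enc_int_prefix_free by (auto simp: prod_eq_iff)
  then show ?thesis by (simp add: quotient_of_inject_eq)
qed

lemma enc_list_prefix_free:
  assumes "\<And>x y u v. e x @ u = e y @ v \<Longrightarrow> x = y \<and> u = v"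
    and "enc_list e xs @ u = enc_list e ys @ v"
  shows "xs = ys \<and> u = v"
  using assms(2)
proof (induction xs arbitrary: ys)
  case Nil
  then show ?case by (cases ys) (auto simp: enc_list_def)
next
  case (Cons x xs)
  then obtain y zs where ys: "ys = y # zs"
    by (cases ys) (auto simp: enc_list_def)
  with Cons.prems have "e x @ enc_list e xs @ u = e y @ enc_list e zs @ v"
    by (simp add: enc_list_def)
  then have "x = y" "enc_list e xs @ u = enc_list e zs @ v"
    using assms(1) by blast+
  with Cons.IH ys show ?case by blast
qed


section \<open>The conditional pairwise risk\<close>

text \<open>
  Score vectors and matrices are functions of which only the values at the items \<open>1, \<dots>, m\<close> matter.
  Edge weights are penalties and hence nonnegative; weight 0 means that there is no edge.
\<close>

definition preference_judgment :: "nat \<Rightarrow> (nat \<Rightarrow> nat \<Rightarrow> real) \<Rightarrow> bool" where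
  "preference_judgment m Y \<longleftrightarrow>
     (\<forall>i\<in>{1..m}. \<forall>j\<in>{1..m}. 0 \<le> Y i j) \<and>
     acyclic {(i, j). i \<in> {1..m} \<and> j \<in> {1..m} \<and> Y i j > 0}"

definition pairwise_loss :: "nat \<Rightarrow> (nat \<Rightarrow> real) \<Rightarrow> (nat \<Rightarrow> nat \<Rightarrow> real) \<Rightarrow> real" where
  "pairwise_loss m \<alpha> Y =
     (\<Sum>(i, j) | i \<in> {1..m} \<and> j \<in> {1..m} \<and> i < j. Y i j * of_bool (\<alpha> i \<le> \<alpha> j)) +
     (\<Sum>(i, j) | i \<in> {1..m} \<and> j \<in> {1..m} \<and> i > j. Y i j * of_bool (\<alpha> i < \<alpha> j))"

definition mean_judgment :: "(nat \<Rightarrow> nat \<Rightarrow> real) measure \<Rightarrow> nat \<Rightarrow> nat \<Rightarrow> real" where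
  "mean_judgment \<mu> i j = (LINT Y|\<mu>. Y i j)"

definition conditional_risk ::
    "nat \<Rightarrow> (nat \<Rightarrow> nat \<Rightarrow> real) measure \<Rightarrow> (nat \<Rightarrow> real) \<Rightarrow> real" where
  "conditional_risk m \<mu> \<alpha> =
     (\<Sum>(i, j) | i \<in> {1..m} \<and> j \<in> {1..m} \<and> i < j. mean_judgment \<mu> i j * of_bool (\<alpha> i \<le> \<alpha> j)) +
     (\<Sum>(i, j) | i \<in> {1..m} \<and> j \<in> {1..m} \<and> i > j. mean_judgment \<mu> i j * of_bool (\<alpha> i < \<alpha> j))"

lemma finite_item_pairs [simp]:
  "finite {(i, j). i \<in> {1..m} \<and> j \<in> {1..m} \<and> P i j}" for m :: nat
  by (rule finite_subset[of _ "{1..m} \<times> {1..m}"]) auto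

lemma conditional_risk_eq_integral:
  assumes "\<And>i j. i \<in> {1..m} \<Longrightarrow> j \<in> {1..m} \<Longrightarrow> integrable \<mu> (\<lambda>Y. Y i j)"
  shows "conditional_risk m \<mu> \<alpha> = (LINT Y|\<mu>. pairwise_loss m \<alpha> Y)"
proof -
  have int: "integrable \<mu> (\<lambda>Y. case ij of (i, j) \<Rightarrow> Y i j * c i j)"
    if "ij \<in> {(i, j). i \<in> {1..m} \<and> j \<in> {1..m} \<and> P i j}" for ij P and c :: "nat \<Rightarrow> nat \<Rightarrow> real"
    using that assms by auto
  have sum: "(LINT Y|\<mu>. (\<Sum>(i, j) | i \<in> {1..m} \<and> j \<in> {1..m} \<and> P i j. Y i j * c i j)) =
      (\<Sum>(i, j) | i \<in> {1..m} \<and> j \<in> {1..m} \<and> P i j. mean_judgment \<mu> i j * c i j)"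
    for P and c :: "nat \<Rightarrow> nat \<Rightarrow> real"
    by (subst Bochner_Integration.integral_sum, rule int, assumption)
       (auto intro!: sum.cong simp: mean_judgment_def)
  show ?thesis
    unfolding conditional_risk_def pairwise_loss_def
    by (subst Bochner_Integration.integral_add)
       (intro Bochner_Integration.integrable_sum int; assumption | simp only: sum)+
qed


section \<open>The risk minimization problem\<close>

text \<open>
  An instance lists the rational probabilities of finitely many preference judgments, given by
  rational matrices.
\<close>

type_synonym risk_instance = "(rat \<times> rat list list) list"

definition vec_of :: "rat list \<Rightarrow> nat \<Rightarrow> real" where
  "vec_of as i = of_rat (as ! (i - 1))"

definition mat_of :: "nat \<Rightarrow> rat list list \<Rightarrow> nat \<Rightarrow> nat \<Rightarrow> real" where
  "mat_of m A i j =
     (if i \<in> {1..m} \<and> j \<in> {1..m} then of_rat (A ! (i - 1) ! (j - 1)) else 0)"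

definition weighted_judgments ::
    "nat \<Rightarrow> risk_instance \<Rightarrow> ((nat \<Rightarrow> nat \<Rightarrow> real) \<times> real) list" where
  "weighted_judgments m I = map (\<lambda>(p, A). (mat_of m A, of_rat p)) I"

definition valid_instance :: "nat \<Rightarrow> risk_instance \<Rightarrow> bool" where
  "valid_instance m I \<longleftrightarrow> 1 \<le> m \<and>
     (\<forall>(p, A) \<in> set I. length A = m \<and> (\<forall>r \<in> set A. length r = m) \<and>
        preference_judgment m (mat_of m A)) \<and>
     pmf_of_list_wf (weighted_judgments m I)"

definition judgment_measure :: "nat \<Rightarrow> risk_instance \<Rightarrow> (nat \<Rightarrow> nat \<Rightarrow> real) measure" where
  "judgment_measure m I = measure_pmf (pmf_of_list (weighted_judgments m I))"

definition enc_instance :: "risk_instance \<Rightarrow> bool list" where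
  "enc_instance = enc_list (\<lambda>(p, A). enc_rat p @ enc_list (enc_list enc_rat) A)"

text \<open>The minimum is over all real score vectors; only the solution that is output is rational.\<close>

definition pairwise_risk_minimization :: search_problem where
  "pairwise_risk_minimization x y \<longleftrightarrow>
     (\<exists>m I as. valid_instance m I \<and> x = enc_instance I \<and>
        length as = m \<and> y = enc_list enc_rat as \<and>
        is_arg_min (conditional_risk m (judgment_measure m I)) (\<lambda>_. True) (vec_of as))"

lemma enc_instance_inject: "enc_instance I = enc_instance J \<longleftrightarrow> I = J"
proof
  let ?mat = "enc_list (enc_list enc_rat)"
  let ?e = "\<lambda>(p, A). enc_rat p @ ?mat A"
  assume eq: "enc_instance I = enc_instance J"
  have row: "xs = ys \<and> u = v" if "enc_list enc_rat xs @ u = enc_list enc_rat ys @ v" for xs ys u v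
    by (rule enc_list_prefix_free[OF _ that]) (rule enc_rat_prefix_free)
  have mat: "A = B \<and> u = v" if "?mat A @ u = ?mat B @ v" for A B u v
    by (rule enc_list_prefix_free[OF _ that]) (rule row)
  have pair: "x = y \<and> u = v" if eq: "?e x @ u = ?e y @ v" for x y :: "rat \<times> rat list list" and u v
  proof -
    obtain p A q B where xy: "x = (p, A)" "y = (q, B)" by (cases x, cases y)
    have "enc_rat p @ (?mat A @ u) = enc_rat q @ (?mat B @ v)"
      using eq by (simp add: xy)
    from enc_rat_prefix_free[OF this] have "p = q" "?mat A @ u = ?mat B @ v" by blast+
    with mat[OF this(2)] show ?thesis by (simp add: xy)
  qed
  have "enc_list ?e I @ [] = enc_list ?e J @ []"
    using eq by (simp only: enc_instance_def)
  then have "I = J \<and> ([] :: bool list) = []"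
    by (rule enc_list_prefix_free[rotated]) (rule pair)
  then show "I = J" ..
qed simp

text \<open>
  Every valid instance has a solution, and some solver has polynomially bounded answers, so that the
  quantification over such solvers in the definition of reducibility is not vacuous.
\<close>

lemma length_bits_of: "length (bits_of n) \<le> n"
proof (induction n rule: less_induct)
  case (less n)
  show ?case
  proof (cases "n = 0")
    case False
    then show ?thesis using less.IH[of "n div 2"] by (subst bits_of.simps) simp
  qed (use bits_of.simps[of 0] in simp)
qed

lemma exists_short_solution:
  assumes "valid_instance m I"
  shows "\<exists>y. pairwise_risk_minimization (enc_instance I) y \<and>
           length y \<le> poly [:1, 9, 2:] (length (enc_instance I))"
proof -
  let ?\<mu> = "judgment_measure m I"
  let ?P = "{1..m} \<times> {1..m}"
  have cong: "conditional_risk m ?\<mu> \<alpha> = conditional_risk m ?\<mu> \<beta>"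
    if le: "\<And>i j. i \<in> {1..m} \<Longrightarrow> j \<in> {1..m} \<Longrightarrow> \<alpha> i \<le> \<alpha> j \<longleftrightarrow> \<beta> i \<le> \<beta> j" for \<alpha> \<beta>
  proof -
    have less: "\<alpha> i < \<alpha> j \<longleftrightarrow> \<beta> i < \<beta> j" if "i \<in> {1..m}" "j \<in> {1..m}" for i j
      using le[OF that(2,1)] by linarith
    show ?thesis
      unfolding conditional_risk_def
      by (intro arg_cong2[of _ _ _ _ "(+)"] sum.cong refl; clarify; simp only: le less)
  qed
  define r where "r \<alpha> i = card {j \<in> {1..m}. \<alpha> j < \<alpha> i}" for \<alpha> :: "nat \<Rightarrow> real" and i
  have r_le: "r \<alpha> i \<le> m" for \<alpha> i
  proof -
    have "r \<alpha> i \<le> card {1..m}" unfolding r_def by (intro card_mono) auto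
    then show ?thesis by simp
  qed
  have r_mono: "r \<alpha> i \<le> r \<alpha> j \<longleftrightarrow> \<alpha> i \<le> \<alpha> j" if "i \<in> {1..m}" "j \<in> {1..m}" for \<alpha> i j
  proof (cases "\<alpha> i \<le> \<alpha> j")
    case True
    have "{k \<in> {1..m}. \<alpha> k < \<alpha> i} \<subseteq> {k \<in> {1..m}. \<alpha> k < \<alpha> j}"
      using less_le_trans[OF _ True] by blast
    then have "r \<alpha> i \<le> r \<alpha> j"
      unfolding r_def by (rule card_mono[rotated]) simp
    with True show ?thesis by simp
  next
    case False
    then have *: "\<alpha> j < \<alpha> i" by simp
    have "{k \<in> {1..m}. \<alpha> k < \<alpha> j} \<subseteq> {k \<in> {1..m}. \<alpha> k < \<alpha> i}"
      using less_trans[OF _ *] by blast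
    moreover have "j \<in> {k \<in> {1..m}. \<alpha> k < \<alpha> i}" "j \<notin> {k \<in> {1..m}. \<alpha> k < \<alpha> j}"
      using that(2) * by blast+
    ultimately have "{k \<in> {1..m}. \<alpha> k < \<alpha> j} \<subset> {k \<in> {1..m}. \<alpha> k < \<alpha> i}"
      by blast
    then have "r \<alpha> j < r \<alpha> i"
      unfolding r_def by (rule psubset_card_mono[rotated]) simp
    with False show ?thesis by linarith
  qed
  define lst where "lst \<alpha> = map (\<lambda>i. of_nat (r \<alpha> (Suc i)) :: rat) [0..<m]" for \<alpha>
  have vec: "vec_of (lst \<alpha>) i = real (r \<alpha> i)" if "i \<in> {1..m}" for \<alpha> i
    using that by (auto simp: vec_of_def lst_def)
  have risk: "conditional_risk m ?\<mu> (vec_of (lst \<alpha>)) = conditional_risk m ?\<mu> \<alpha>" for \<alpha>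
    by (rule cong) (simp only: vec r_mono of_nat_le_iff)
  have "finite (range lst)"
  proof (rule finite_subset)
    show "range lst \<subseteq> {xs. set xs \<subseteq> of_nat ` {..m} \<and> length xs = m}"
    proof clarify
      fix \<alpha>
      show "set (lst \<alpha>) \<subseteq> of_nat ` {..m} \<and> length (lst \<alpha>) = m"
        using r_le[of \<alpha>] by (simp add: lst_def image_subset_iff)
    qed
    show "finite {xs :: rat list. set xs \<subseteq> of_nat ` {..m} \<and> length xs = m}"
      by (intro finite_lists_length_eq finite_imageI finite_atMost)
  qed
  then have "\<exists>as. is_arg_min (\<lambda>as. conditional_risk m ?\<mu> (vec_of as)) (\<lambda>as. as \<in> range lst) as"
    by (rule ex_is_arg_min_if_finite) simp
  then obtain as where as: "as \<in> range lst"
    "\<And>bs. bs \<in> range lst \<Longrightarrow> conditional_risk m ?\<mu> (vec_of as) \<le> conditional_risk m ?\<mu> (vec_of bs)"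
    unfolding is_arg_min_linorder by blast
  have min: "is_arg_min (conditional_risk m ?\<mu>) (\<lambda>_. True) (vec_of as)"
    unfolding is_arg_min_linorder
  proof (intro conjI TrueI allI impI)
    fix \<beta>
    show "conditional_risk m ?\<mu> (vec_of as) \<le> conditional_risk m ?\<mu> \<beta>"
      using as(2)[of "lst \<beta>"] by (simp add: risk)
  qed
  obtain \<alpha> where \<alpha>: "as = lst \<alpha>" using as(1) by auto
  have len: "length as = m" by (simp add: \<alpha> lst_def)
  have entry: "length (enc_rat a) \<le> 2 * m + 7" if a: "a \<in> set as" for a
  proof -
    obtain k where k: "a = of_nat k" "k \<le> m"
      using a r_le[of \<alpha>] unfolding \<alpha> lst_def set_map by blast
    have "length (enc_nat n) = 2 * length (bits_of n) + 1" for n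
      by (simp add: enc_nat_def length_concat o_def sum_list_triv)
    moreover have "bits_of 1 = [True]"
      using bits_of.simps[of 1] bits_of.simps[of 0] by simp
    ultimately show ?thesis
      using k length_bits_of[of k] by (simp add: enc_rat_def enc_int_def)
  qed
  have "length (enc_list enc_rat as) = (\<Sum>a\<leftarrow>as. Suc (length (enc_rat a))) + 1"
    by (simp add: enc_list_def length_concat o_def)
  also have "\<dots> \<le> (\<Sum>a\<leftarrow>as. 2 * m + 8) + 1"
  proof (intro add_mono sum_list_mono order.refl)
    fix a assume "a \<in> set as"
    from entry[OF this] show "Suc (length (enc_rat a)) \<le> 2 * m + 8" by linarith
  qed
  also have "\<dots> = m * (2 * m + 8) + 1"
    by (simp add: len sum_list_triv)
  finally have y: "length (enc_list enc_rat as) \<le> m * (2 * m + 8) + 1" .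
  have len_list: "length xs \<le> length (enc_list e xs)" for e :: "'x \<Rightarrow> bool list" and xs
    by (induction xs) (auto simp: enc_list_def)
  have "I \<noteq> []"
    using assms by (auto simp: valid_instance_def pmf_of_list_wf_def weighted_judgments_def)
  then obtain p A J where I: "I = (p, A) # J" by (cases I) auto
  have "m = length A" using assms by (simp add: I valid_instance_def)
  also have "\<dots> \<le> length (enc_list (enc_list enc_rat) A)" by (rule len_list)
  also have "\<dots> \<le> length (enc_instance I)"
    by (simp add: I enc_instance_def enc_list_def)
  finally have m: "m \<le> length (enc_instance I)" .
  have "m * (2 * m + 8) + 1 \<le> length (enc_instance I) * (2 * length (enc_instance I) + 8) + 1"
    using m by (intro add_mono mult_mono) auto
  also have "\<dots> \<le> poly [:1, 9, 2:] (length (enc_instance I))"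
    by (simp add: algebra_simps)
  finally have "length (enc_list enc_rat as) \<le> poly [:1, 9, 2:] (length (enc_instance I))"
    using y by simp
  moreover have "pairwise_risk_minimization (enc_instance I) (enc_list enc_rat as)"
    unfolding pairwise_risk_minimization_def using assms len min by blast
  ultimately show ?thesis by blast
qed

lemma exists_bounded_solver:
  "\<exists>g (b :: nat poly). solves g pairwise_risk_minimization \<and> (\<forall>x. length (g x) \<le> poly b (length x))"
proof -
  have "\<exists>y. ((\<exists>z. pairwise_risk_minimization x z) \<longrightarrow> pairwise_risk_minimization x y) \<and>
          length y \<le> poly [:1, 9, 2:] (length x)" for x
  proof (cases "\<exists>z. pairwise_risk_minimization x z")
    case True
    then obtain m I where "valid_instance m I" "x = enc_instance I"
      by (auto simp: pairwise_risk_minimization_def)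
    then show ?thesis using exists_short_solution by blast
  next
    case False
    then show ?thesis by (intro exI[of _ "[]"]) auto
  qed
  then obtain g where "\<forall>x. ((\<exists>z. pairwise_risk_minimization x z) \<longrightarrow> pairwise_risk_minimization x (g x)) \<and>
      length (g x) \<le> poly [:1, 9, 2:] (length x)"
    using choice[of "\<lambda>x y. ((\<exists>z. pairwise_risk_minimization x z) \<longrightarrow> pairwise_risk_minimization x y) \<and>
      length y \<le> poly [:1, 9, 2:] (length x)"] by blast
  then show ?thesis unfolding solves_def by blast
qed

end

theory Submission
  imports Defs
begin

text \<open>
  The computations of a nondeterministic polynomial-time machine on an input are described by a table
  of cells (time, place), each holding one of constantly many values, such that being the table of an
  accepting computation is a condition on pairs of cells. Every cell may also hold the value \<open>None\<close>,
  which is compatible only with itself. Hence the conflict graph on the pairs of a cell and a value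
  always has an independent set that meets all cells, and the input is accepted iff there is one that
  avoids the vertex \<open>z\<close> giving \<open>None\<close> to the first cell.

  An independent set is the complement of a vertex cover, and vertex cover reduces to feedback arc
  set, which is the risk minimization problem. Give weight 1 to \<open>z\<close> and weight 2 to all other
  vertices. Then \<open>z\<close> lies in the cover given by a minimizer iff the input is accepted. As the two
  items of \<open>z\<close> come first, one comparison of the first two scores decides membership. Vertex edges and
  conflict edges are each bipartite, so that two judgments of probability 1/2 suffice.

  Polynomial time is handled by a class \<open>PF\<close> of functions on bit strings that is closed under
  composition and under recursion along a bit string with polynomially bounded results; each function
  is computed by a structured program on stacks, which is compiled to a Turing machine.
\<close>

section \<open>Structured programs on tapes\<close>

text \<open>The oracle returns an arbitrary minimizer and not its risk, so the decision must be
  forced into a comparison of scores. With n vertices, the complement of an independent set I weighs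
  2n - 1 - 2|I| + [z \<in> I]. The size of I takes precedence, and the unit weight of z only breaks
  ties: among the largest independent sets, those avoiding z are cheaper by one. The value
  \<open>None\<close> makes the largest size known in advance, namely the number of cells, whether
  or not the input is accepted; hence no threshold has to be found or compared with.

  The other obstacle is that hardness refers to concrete oracle machines, so the reduction itself
  must be compiled with explicit time bounds. The nondeterministic machine is fixed, so everything
  that depends on it alone (the list of values of a cell, which values clash) is hard-wired into the
  program, however it was obtained. Only the input, times and places enter the computation, and
  times and places are polynomially bounded and can be kept in unary.\<close>

text \<open>
  A command is also the control state of a machine that still has to run it, and \<open>nxt\<close> is the
  transition function: the next control state, and the tape, the symbol to be written (\<open>None\<close> keeps
  the old one) and the move. Only finitely many commands are reached from a given one.
\<close>

datatype cmd = Skip | Act nat "nat option" int | Seq cmd cmd | While nat cmd | If nat cmd cmd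

primrec nxt :: "cmd \<Rightarrow> (nat \<Rightarrow> nat) \<Rightarrow> cmd \<times> nat \<times> nat option \<times> int" where
  "nxt Skip r = (Skip, 0, None, 0)"
| "nxt (Act v w d) r = (Skip, v, w, d)"
| "nxt (Seq c c') r =
     (if c = Skip then (c', 0, None, 0) else (Seq (fst (nxt c r)) c', snd (nxt c r)))"
| "nxt (While v c) r = (if r v = 0 then Skip else Seq c (While v c), 0, None, 0)"
| "nxt (If v c c') r = (if r v = 2 then c else c', 0, None, 0)"

primrec vars :: "cmd \<Rightarrow> nat set" where
  "vars Skip = {}"
| "vars (Act v w d) = {v}"
| "vars (Seq c c') = vars c \<union> vars c'"
| "vars (While v c) = insert v (vars c)"
| "vars (If v c c') = insert v (vars c \<union> vars c')"

primrec ok_cmd :: "cmd \<Rightarrow> bool" where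
  "ok_cmd Skip \<longleftrightarrow> True"
| "ok_cmd (Act v w d) \<longleftrightarrow> w \<in> {None, Some 0, Some 1, Some 2} \<and> d \<in> {-1, 0, 1}"
| "ok_cmd (Seq c c') \<longleftrightarrow> ok_cmd c \<and> ok_cmd c'"
| "ok_cmd (While v c) \<longleftrightarrow> ok_cmd c"
| "ok_cmd (If v c c') \<longleftrightarrow> ok_cmd c \<and> ok_cmd c'"

lemma finite_vars [simp]: "finite (vars c)"
  by (induction c) auto

text \<open>Analogous to the partial derivatives of a regular expression: a finite set, given by
  structural recursion, that contains c and is closed under \<open>nxt\<close>. It supplies the
  states of the compiled machine.\<close>

primrec derivs :: "cmd \<Rightarrow> cmd set" where
  "derivs Skip = {Skip}"
| "derivs (Act v w d) = {Act v w d, Skip}"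
| "derivs (Seq c c') = (\<lambda>b. Seq b c') ` derivs c \<union> derivs c'"
| "derivs (While v c) = {While v c, Skip} \<union> (\<lambda>b. Seq b (While v c)) ` derivs c"
| "derivs (If v c c') = insert (If v c c') (derivs c \<union> derivs c')"

lemma finite_derivs [simp]: "finite (derivs c)"
  by (induction c) auto

lemma self_in_derivs [simp]: "c \<in> derivs c"
  by (induction c) auto

lemma Skip_in_derivs [simp]: "Skip \<in> derivs c"
  by (induction c) auto

lemma nxt_in_derivs: "b \<in> derivs c \<Longrightarrow> fst (nxt b r) \<in> derivs c"
  by (induction c arbitrary: b) (auto split: if_splits)

lemma derivs_ok: "b \<in> derivs c \<Longrightarrow> ok_cmd c \<Longrightarrow> ok_cmd b"
  by (induction c arbitrary: b) auto

lemma derivs_vars: "b \<in> derivs c \<Longrightarrow> x \<in> vars b \<Longrightarrow> x \<in> vars c"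
  by (induction c arbitrary: b) (auto; blast)+

lemma nxt_ok:
  assumes "ok_cmd c" "vars c \<subseteq> {..<k}" "0 < k"
  shows "fst (snd (nxt c r)) < k \<and>
    fst (snd (snd (nxt c r))) \<in> {None, Some 0, Some 1, Some 2} \<and>
    snd (snd (snd (nxt c r))) \<in> {-1, 0, 1}"
  using assms by (induction c) simp_all

text \<open>A machine sees the list of symbols read, a program sees the tapes. The two agree only at
  indices in range, which is enough because \<open>nxt\<close> inspects only the tapes in
  \<open>vars c\<close>.\<close>

lemma nxt_cong: "(\<And>v. v \<in> vars c \<Longrightarrow> r v = r' v) \<Longrightarrow> nxt c r = nxt c r'"
  by (induction c) auto

definition act :: "nat \<times> nat option \<times> int \<Rightarrow> tape list \<Rightarrow> tape list" where
  "act = (\<lambda>(v, w, d) ts.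
     ts[v := write_move (ts ! v) (case w of None \<Rightarrow> read_head (ts ! v) | Some u \<Rightarrow> u) d])"

text \<open>Pure control transitions are encoded as this action on tape 0. Writing back the symbol
  read changes nothing, and updating a list out of range has no effect.\<close>

lemma act_idle [simp]: "act (v, None, 0) ts = ts"
  by (cases "v < length ts")
     (auto simp: act_def write_move_def read_head_def intro!: nth_equalityI simp: nth_list_update prod_eq_iff)

lemma length_act [simp]: "length (act a ts) = length ts"
  by (auto simp: act_def split: prod.splits)

definition next_conf :: "cmd \<times> tape list \<Rightarrow> cmd \<times> tape list" where
  "next_conf = (\<lambda>(c, ts).
     let a = nxt c (\<lambda>v. read_head (ts ! v)) in (fst a, act (snd a) ts))"

definition cstep :: "cmd \<times> tape list \<Rightarrow> cmd \<times> tape list \<Rightarrow> bool" where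
  "cstep x y \<longleftrightarrow> fst x \<noteq> Skip \<and> y = next_conf x"

definition exec :: "cmd \<Rightarrow> tape list \<Rightarrow> nat \<Rightarrow> tape list \<Rightarrow> bool" where
  "exec c ts n ts' \<longleftrightarrow> (cstep ^^ n) (c, ts) (Skip, ts')"

lemma cstep_Seq: "cstep (c, ts) (c', ts') \<Longrightarrow> cstep (Seq c b, ts) (Seq c' b, ts')"
  by (auto simp: cstep_def next_conf_def Let_def)

lemma csteps_Seq:
  "(cstep ^^ n) (c, ts) (c', ts') \<Longrightarrow> (cstep ^^ n) (Seq c b, ts) (Seq c' b, ts')"
proof (induction n arbitrary: c' ts')
  case (Suc n)
  then obtain c1 ts1 where "(cstep ^^ n) (c, ts) (c1, ts1)" "cstep (c1, ts1) (c', ts')" by auto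
  with Suc.IH cstep_Seq[of c1 ts1 c' ts' b] show ?case by (auto intro!: relcomppI)
qed auto

lemma exec_step:
  assumes "cstep (c, ts) (c', ts')" "exec c' ts' n ts''"
  shows "exec c ts (Suc n) ts''"
  using assms unfolding exec_def by (metis relpowp_Suc_I2)

lemma exec_Skip [simp]: "exec Skip ts 0 ts"
  by (simp add: exec_def)

lemma exec_Act: "exec (Act v w d) ts 1 (act (v, w, d) ts)"
proof -
  have "cstep (Act v w d, ts) (Skip, act (v, w, d) ts)"
    by (simp add: cstep_def next_conf_def)
  from exec_step[OF this exec_Skip] show ?thesis by simp
qed

lemma exec_Seq:
  assumes "exec c ts n ts1" "exec c' ts1 m ts2"
  shows "exec (Seq c c') ts (n + m + 1) ts2"
proof -
  have "(cstep ^^ n) (Seq c c', ts) (Seq Skip c', ts1)"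
    using assms(1) by (auto simp: exec_def intro: csteps_Seq)
  \<comment> \<open>This is the extra step in the count: \<open>Skip\<close> is discarded and c'
    takes over.\<close>
  moreover have "exec (Seq Skip c') ts1 (Suc m) ts2"
    by (rule exec_step[OF _ assms(2)]) (simp add: cstep_def next_conf_def)
  ultimately have "(cstep ^^ (n + Suc m)) (Seq c c', ts) (Skip, ts2)"
    unfolding exec_def relpowp_add by (rule relcomppI)
  then show ?thesis by (simp add: exec_def)
qed

lemma exec_While_stop:
  assumes "read_head (ts ! v) = 0"
  shows "exec (While v c) ts 1 ts"
proof -
  have "cstep (While v c, ts) (Skip, ts)"
    using assms by (simp add: cstep_def next_conf_def)
  from exec_step[OF this exec_Skip] show ?thesis by simp
qed

text \<open>The two extra steps are the unfolding of the loop and the transition at the end of the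
  body, inside \<open>Seq\<close>.\<close>

lemma exec_While_step:
  assumes "read_head (ts ! v) \<noteq> 0" "exec c ts n ts1" "exec (While v c) ts1 m ts2"
  shows "exec (While v c) ts (n + m + 2) ts2"
proof -
  have "cstep (While v c, ts) (Seq c (While v c), ts)"
    using assms by (simp add: cstep_def next_conf_def)
  from exec_step[OF this exec_Seq[OF assms(2,3)]] show ?thesis by simp
qed

lemma exec_If:
  assumes "exec (if read_head (ts ! v) = 2 then c else c') ts n ts1"
  shows "exec (If v c c') ts (Suc n) ts1"
  by (rule exec_step[OF _ assms]) (simp add: cstep_def next_conf_def)


section \<open>Stacks\<close>

type_synonym store = "nat \<Rightarrow> bool list"

text \<open>The head is on the top of the stack, which grows to the left.\<close>

definition stack_on :: "tape \<Rightarrow> bool list \<Rightarrow> bool" where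
  "stack_on t xs \<longleftrightarrow>
     (\<forall>i. fst t (snd t + int i) = (if i < length xs then if xs ! i then 2 else 1 else 0))"

lemma stack_on_tape_of [simp]: "stack_on (tape_of xs) xs"
  by (simp add: stack_on_def tape_of_def)

lemma read_head_stack:
  assumes "stack_on t xs"
  shows "read_head t = (case xs of [] \<Rightarrow> 0 | b # _ \<Rightarrow> if b then 2 else 1)"
  using assms[unfolded stack_on_def, rule_format, of 0]
  by (auto simp: read_head_def split: list.splits)

text \<open>Moving the head is enough: \<open>stack_on\<close> says nothing about the cells to the
  left of the head, so the popped symbol, or any symbol w, may stay there.\<close>

lemma stack_on_pop:
  assumes "stack_on t xs"
  shows "stack_on (write_move t w 1) (tl xs)"
  unfolding stack_on_def
proof
  fix i
  show "fst (write_move t w 1) (snd (write_move t w 1) + int i)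
      = (if i < length (tl xs) then if tl xs ! i then 2 else 1 else 0)"
    using assms[unfolded stack_on_def, rule_format, of "Suc i"]
    by (auto simp: write_move_def nth_tl algebra_simps)
qed

lemma stack_on_push:
  assumes "stack_on t xs"
  shows "stack_on (write_move (write_move t (read_head t) (- 1)) (if b then 2 else 1) 0) (b # xs)"
  unfolding stack_on_def
proof
  fix i
  show "fst (write_move (write_move t (read_head t) (- 1)) (if b then 2 else 1) 0)
       (snd (write_move (write_move t (read_head t) (- 1)) (if b then 2 else 1) 0) + int i) =
      (if i < length (b # xs) then if (b # xs) ! i then 2 else 1 else 0)"
    using assms[unfolded stack_on_def, rule_format, of "i - 1"]
    by (cases i) (auto simp: write_move_def read_head_def algebra_simps)
qed

definition rep :: "nat set \<Rightarrow> tape list \<Rightarrow> store \<Rightarrow> bool" where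
  "rep U ts \<sigma> \<longleftrightarrow> (\<forall>v < length ts. v \<in> U \<longrightarrow> stack_on (ts ! v) (\<sigma> v))"

text \<open>U is a frame: tapes outside U may hold anything and are left alone. This serves tape 1,
  which is not a stack while the query is being written. The number n is an upper bound, whereas
  \<open>exec\<close> counts exactly.\<close>

definition runs :: "cmd \<Rightarrow> store \<Rightarrow> nat \<Rightarrow> store \<Rightarrow> bool" where
  "runs c \<sigma> n \<sigma>' \<longleftrightarrow> (\<forall>U ts. vars c \<subseteq> U \<inter> {..<length ts} \<and> rep U ts \<sigma> \<longrightarrow>
     (\<exists>m ts'. m \<le> n \<and> exec c ts m ts' \<and> length ts' = length ts \<and> rep U ts' \<sigma>' \<and>
        (\<forall>v < length ts. v \<notin> U \<longrightarrow> ts' ! v = ts ! v)))"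

lemma runsE:
  assumes "runs c \<sigma> n \<sigma>'" "vars c \<subseteq> U" "vars c \<subseteq> {..<length ts}" "rep U ts \<sigma>"
  obtains m ts' where "m \<le> n" "exec c ts m ts'" "length ts' = length ts" "rep U ts' \<sigma>'"
    "\<And>v. v < length ts \<Longrightarrow> v \<notin> U \<Longrightarrow> ts' ! v = ts ! v"
  using assms unfolding runs_def by blast

lemma runs_mono: "runs c \<sigma> n \<sigma>' \<Longrightarrow> n \<le> n' \<Longrightarrow> runs c \<sigma> n' \<sigma>'"
  unfolding runs_def by (meson order.trans)

lemma runs_Skip: "runs Skip \<sigma> 0 \<sigma>"
  unfolding runs_def using exec_Skip by blast

lemma runs_Seq:
  assumes "runs c \<sigma> n \<sigma>1" "runs c' \<sigma>1 m \<sigma>2"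
  shows "runs (Seq c c') \<sigma> (n + m + 1) \<sigma>2"
  unfolding runs_def
proof (intro allI impI, elim conjE)
  fix U ts assume *: "vars (Seq c c') \<subseteq> U \<inter> {..<length ts}" "rep U ts \<sigma>"
  obtain i ts1 where 1: "i \<le> n" "exec c ts i ts1" "length ts1 = length ts" "rep U ts1 \<sigma>1"
    "\<And>v. v < length ts \<Longrightarrow> v \<notin> U \<Longrightarrow> ts1 ! v = ts ! v"
    using runsE[OF assms(1), of U ts] * by auto
  obtain j ts2 where 2: "j \<le> m" "exec c' ts1 j ts2" "length ts2 = length ts1" "rep U ts2 \<sigma>2"
    "\<And>v. v < length ts1 \<Longrightarrow> v \<notin> U \<Longrightarrow> ts2 ! v = ts1 ! v"
    using runsE[OF assms(2), of U ts1] * 1 by auto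
  show "\<exists>k ts'. k \<le> n + m + 1 \<and> exec (Seq c c') ts k ts' \<and> length ts' = length ts \<and>
      rep U ts' \<sigma>2 \<and> (\<forall>v<length ts. v \<notin> U \<longrightarrow> ts' ! v = ts ! v)"
    by (rule exI[of _ "i + j + 1"], rule exI[of _ ts2])
       (use 1 2 exec_Seq[OF 1(2) 2(2)] in auto)
qed

lemma rep_read_head:
  assumes "rep U ts \<sigma>" "v \<in> U" "v < length ts"
  shows "read_head (ts ! v) = (case \<sigma> v of [] \<Rightarrow> 0 | b # _ \<Rightarrow> if b then 2 else 1)"
  using assms by (auto simp: rep_def intro: read_head_stack)

lemma runs_While_stop:
  assumes "\<sigma> v = []"
  shows "runs (While v c) \<sigma> 1 \<sigma>"
  unfolding runs_def
proof (intro allI impI, elim conjE)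
  fix U ts assume *: "vars (While v c) \<subseteq> U \<inter> {..<length ts}" "rep U ts \<sigma>"
  then have "read_head (ts ! v) = 0"
    using rep_read_head[of U ts \<sigma> v] assms by auto
  from exec_While_stop[OF this] * show "\<exists>k ts'. k \<le> 1 \<and> exec (While v c) ts k ts' \<and>
      length ts' = length ts \<and> rep U ts' \<sigma> \<and> (\<forall>v<length ts. v \<notin> U \<longrightarrow> ts' ! v = ts ! v)"
    by blast
qed

lemma runs_While_step:
  assumes "\<sigma> v \<noteq> []" "runs c \<sigma> n \<sigma>1" "runs (While v c) \<sigma>1 m \<sigma>2"
  shows "runs (While v c) \<sigma> (n + m + 2) \<sigma>2"
  unfolding runs_def
proof (intro allI impI, elim conjE)
  fix U ts assume *: "vars (While v c) \<subseteq> U \<inter> {..<length ts}" "rep U ts \<sigma>"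
  obtain i ts1 where 1: "i \<le> n" "exec c ts i ts1" "length ts1 = length ts" "rep U ts1 \<sigma>1"
    "\<And>v. v < length ts \<Longrightarrow> v \<notin> U \<Longrightarrow> ts1 ! v = ts ! v"
    using runsE[OF assms(2), of U ts] * by auto
  obtain j ts2 where 2: "j \<le> m" "exec (While v c) ts1 j ts2" "length ts2 = length ts1"
    "rep U ts2 \<sigma>2" "\<And>v. v < length ts1 \<Longrightarrow> v \<notin> U \<Longrightarrow> ts2 ! v = ts1 ! v"
    using runsE[OF assms(3), of U ts1] * 1 by auto
  have "read_head (ts ! v) \<noteq> 0"
    using rep_read_head[of U ts \<sigma> v] assms * by (auto split: list.splits)
  from exec_While_step[OF this 1(2) 2(2)] 1 2
  show "\<exists>k ts'. k \<le> n + m + 2 \<and> exec (While v c) ts k ts' \<and> length ts' = length ts \<and>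
      rep U ts' \<sigma>2 \<and> (\<forall>v<length ts. v \<notin> U \<longrightarrow> ts' ! v = ts ! v)"
    by (intro exI[of _ "i + j + 2"] exI[of _ ts2]) auto
qed

lemma runs_If:
  assumes "runs (if \<sigma> v \<noteq> [] \<and> hd (\<sigma> v) then c else c') \<sigma> n \<sigma>1"
  shows "runs (If v c c') \<sigma> (Suc n) \<sigma>1"
  unfolding runs_def
proof (intro allI impI, elim conjE)
  fix U ts assume *: "vars (If v c c') \<subseteq> U \<inter> {..<length ts}" "rep U ts \<sigma>"
  have eq: "(if read_head (ts ! v) = 2 then c else c') =
      (if \<sigma> v \<noteq> [] \<and> hd (\<sigma> v) then c else c')"
    using rep_read_head[of U ts \<sigma> v] * by (auto split: list.splits)
  have "vars (if \<sigma> v \<noteq> [] \<and> hd (\<sigma> v) then c else c') \<subseteq> U"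
    "vars (if \<sigma> v \<noteq> [] \<and> hd (\<sigma> v) then c else c') \<subseteq> {..<length ts}"
    using * by simp_all
  then obtain i ts1 where 1: "i \<le> n" "exec (if \<sigma> v \<noteq> [] \<and> hd (\<sigma> v) then c else c') ts i ts1"
    "length ts1 = length ts" "rep U ts1 \<sigma>1" "\<And>v. v < length ts \<Longrightarrow> v \<notin> U \<Longrightarrow> ts1 ! v = ts ! v"
    using runsE[OF assms _ _ *(2)] by metis
  from exec_If[of ts v c c' i ts1] 1 eq
  show "\<exists>k ts'. k \<le> Suc n \<and> exec (If v c c') ts k ts' \<and> length ts' = length ts \<and>
      rep U ts' \<sigma>1 \<and> (\<forall>v<length ts. v \<notin> U \<longrightarrow> ts' ! v = ts ! v)"
    by (intro exI[of _ "Suc i"] exI[of _ ts1]) auto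
qed

section \<open>Elementary stack programs\<close>

definition push :: "nat \<Rightarrow> bool \<Rightarrow> cmd" where
  "push v b = Seq (Act v None (-1)) (Act v (Some (if b then 2 else 1)) 0)"

definition pop :: "nat \<Rightarrow> cmd" where
  "pop v = Act v None 1"

lemma vars_push_pop [simp]: "vars (push v b) = {v}" "vars (pop v) = {v}"
  by (auto simp: push_def pop_def)

lemma ok_push_pop [simp]: "ok_cmd (push v b)" "ok_cmd (pop v)"
  by (auto simp: push_def pop_def)

lemma runs_push: "runs (push v b) \<sigma> 3 (\<sigma>(v := b # \<sigma> v))"
  unfolding runs_def
proof (intro allI impI, elim conjE)
  fix U ts assume *: "vars (push v b) \<subseteq> U \<inter> {..<length ts}" "rep U ts \<sigma>"
  let ?ts = "act (v, Some (if b then 2 else 1), 0) (act (v, None, -1) ts)"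
  have "exec (push v b) ts 3 ?ts"
    using exec_Seq[OF exec_Act[of v None "-1" ts] exec_Act[of v "Some (if b then 2 else 1)" 0]]
    by (simp add: push_def numeral_3_eq_3 del: One_nat_def)
  moreover have "rep U ?ts (\<sigma>(v := b # \<sigma> v))"
    using * stack_on_push[of "ts ! v" "\<sigma> v" b] by (auto simp: rep_def act_def nth_list_update)
  moreover have "\<forall>u<length ts. u \<notin> U \<longrightarrow> ?ts ! u = ts ! u"
    using * by (auto simp: act_def nth_list_update)
  ultimately show "\<exists>m ts'. m \<le> 3 \<and> exec (push v b) ts m ts' \<and> length ts' = length ts \<and>
      rep U ts' (\<sigma>(v := b # \<sigma> v)) \<and> (\<forall>v<length ts. v \<notin> U \<longrightarrow> ts' ! v = ts ! v)"
    by (intro exI[of _ 3] exI[of _ ?ts]) auto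
qed

lemma runs_pop: "runs (pop v) \<sigma> 1 (\<sigma>(v := tl (\<sigma> v)))"
  unfolding runs_def
proof (intro allI impI, elim conjE)
  fix U ts assume *: "vars (pop v) \<subseteq> U \<inter> {..<length ts}" "rep U ts \<sigma>"
  let ?ts = "act (v, None, 1) ts"
  have "exec (pop v) ts 1 ?ts"
    using exec_Act by (simp add: pop_def)
  moreover have "rep U ?ts (\<sigma>(v := tl (\<sigma> v)))"
    using * stack_on_pop[of "ts ! v" "\<sigma> v"] by (auto simp: rep_def act_def nth_list_update)
  moreover have "\<forall>u<length ts. u \<notin> U \<longrightarrow> ?ts ! u = ts ! u"
    using * by (auto simp: act_def nth_list_update)
  ultimately show "\<exists>m ts'. m \<le> 1 \<and> exec (pop v) ts m ts' \<and> length ts' = length ts \<and>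
      rep U ts' (\<sigma>(v := tl (\<sigma> v))) \<and> (\<forall>v<length ts. v \<notin> U \<longrightarrow> ts' ! v = ts ! v)"
    by (intro exI[of _ 1] exI[of _ ?ts]) auto
qed

definition loop :: "nat \<Rightarrow> cmd \<Rightarrow> cmd \<Rightarrow> cmd" where
  "loop v c c' = While v (If v (Seq (pop v) c) (Seq (pop v) c'))"

lemma vars_loop [simp]: "vars (loop v c c') = insert v (vars c \<union> vars c')"
  by (auto simp: loop_def)

lemma ok_loop [simp]: "ok_cmd (loop v c c') \<longleftrightarrow> ok_cmd c \<and> ok_cmd c'"
  by (auto simp: loop_def)

text \<open>\<open>S ys zs\<close> is the store after the bits \<open>ys\<close> have been consumed and while \<open>zs\<close> are left.\<close>

lemma runs_loop:
  assumes "\<And>ys zs. ys @ zs = xs \<Longrightarrow> S ys zs v = zs"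
    and "\<And>ys b zs. ys @ b # zs = xs \<Longrightarrow>
      runs (if b then c else c') ((S ys (b # zs))(v := zs)) n (S (ys @ [b]) zs)"
  shows "runs (loop v c c') (S [] xs) ((n + 5) * length xs + 1) (S xs [])"
proof -
  have "runs (loop v c c') (S ys zs) ((n + 5) * length zs + 1) (S xs [])" if "ys @ zs = xs" for ys zs
    using that
  proof (induction zs arbitrary: ys)
    case Nil
    then show ?case using runs_While_stop assms(1)[OF Nil] by (simp add: loop_def)
  next
    case (Cons b zs)
    let ?c = "If v (Seq (pop v) c) (Seq (pop v) c')"
    have v: "S ys (b # zs) v = b # zs" using assms(1)[OF Cons.prems] .
    have "runs (pop v) (S ys (b # zs)) 1 ((S ys (b # zs))(v := zs))"
      using runs_pop[of v "S ys (b # zs)"] v by simp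
    from runs_Seq[OF this assms(2)[OF Cons.prems]]
    have "runs (if S ys (b # zs) v \<noteq> [] \<and> hd (S ys (b # zs) v) then Seq (pop v) c else Seq (pop v) c')
        (S ys (b # zs)) (n + 2) (S (ys @ [b]) zs)"
      by (auto simp: v numeral_2_eq_2)
    then have "runs ?c (S ys (b # zs)) (Suc (n + 2)) (S (ys @ [b]) zs)"
      by (rule runs_If)
    moreover have "runs (While v ?c) (S (ys @ [b]) zs) ((n + 5) * length zs + 1) (S xs [])"
      using Cons.IH[of "ys @ [b]"] Cons.prems by (simp add: loop_def)
    \<comment> \<open>Per bit, besides the body: one step for the pop, one each for
      \<open>Seq\<close> and \<open>If\<close>, and two for the loop. This is the 5 in the
      bound.\<close>
    ultimately have "runs (loop v c c') (S ys (b # zs)) (Suc (n + 2) + ((n + 5) * length zs + 1) + 2) (S xs [])"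
      unfolding loop_def by (intro runs_While_step[of "S ys (b # zs)" v]) (simp_all add: v)
    then show ?case by (rule runs_mono) simp
  qed
  then show ?thesis by simp
qed

definition clear :: "nat \<Rightarrow> cmd" where
  "clear v = loop v Skip Skip"

lemma vars_clear [simp]: "vars (clear v) = {v}" "ok_cmd (clear v)"
  by (auto simp: clear_def)

lemma runs_clear: "runs (clear v) \<sigma> (5 * length (\<sigma> v) + 1) (\<sigma>(v := []))"
proof -
  have "runs (loop v Skip Skip) ((\<lambda>ys zs. \<sigma>(v := zs)) [] (\<sigma> v)) ((0 + 5) * length (\<sigma> v) + 1)
      ((\<lambda>ys zs. \<sigma>(v := zs)) (\<sigma> v) [])"
    by (rule runs_loop[where S = "\<lambda>ys zs. \<sigma>(v := zs)"]) (simp_all add: runs_Skip)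
  then show ?thesis by (simp add: clear_def)
qed

definition rev_move :: "nat \<Rightarrow> nat \<Rightarrow> cmd" where
  "rev_move v w = loop v (push w True) (push w False)"

lemma vars_rev_move [simp]: "vars (rev_move v w) = {v, w}" "ok_cmd (rev_move v w)"
  by (auto simp: rev_move_def)

lemma runs_rev_move:
  assumes "v \<noteq> w"
  shows "runs (rev_move v w) \<sigma> (8 * length (\<sigma> v) + 1) (\<sigma>(v := [], w := rev (\<sigma> v) @ \<sigma> w))"
proof -
  let ?S = "\<lambda>ys zs. \<sigma>(v := zs, w := rev ys @ \<sigma> w)"
  have "runs (loop v (push w True) (push w False)) (?S [] (\<sigma> v)) ((3 + 5) * length (\<sigma> v) + 1)
      (?S (\<sigma> v) [])"
  proof (rule runs_loop[where S = ?S])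
    fix ys zs b
    show "?S ys zs v = zs" using assms by simp
    have "(?S ys (b # zs))(v := zs, w := b # ((?S ys (b # zs))(v := zs)) w) = ?S (ys @ [b]) zs"
      using assms by (auto simp: fun_eq_iff)
    moreover have "(if b then push w True else push w False) = push w b" by simp
    ultimately show "runs (if b then push w True else push w False) ((?S ys (b # zs))(v := zs)) 3
        (?S (ys @ [b]) zs)"
      using runs_push[of w b "(?S ys (b # zs))(v := zs)"] by (simp only:)
  qed
  then show ?thesis by (simp add: rev_move_def)
qed

text \<open>Each \<open>rev_move\<close> reverses, so passing through the scratch stack u restores
  the order.\<close>

definition move :: "nat \<Rightarrow> nat \<Rightarrow> nat \<Rightarrow> cmd" where
  "move v w u = Seq (rev_move v u) (rev_move u w)"

lemma vars_move [simp]: "vars (move v w u) = {v, w, u}" "ok_cmd (move v w u)"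
  by (auto simp: move_def)

lemma runs_move:
  assumes "v \<noteq> u" "w \<noteq> u" "v \<noteq> w" "\<sigma> u = []" "\<sigma> w = []"
  shows "runs (move v w u) \<sigma> (16 * length (\<sigma> v) + 3) (\<sigma>(v := [], w := \<sigma> v))"
proof -
  let ?\<sigma> = "\<sigma>(v := [], u := rev (\<sigma> v) @ \<sigma> u)"
  have "runs (move v w u) \<sigma> ((8 * length (\<sigma> v) + 1) + (8 * length (?\<sigma> u) + 1) + 1)
      (?\<sigma>(u := [], w := rev (?\<sigma> u) @ ?\<sigma> w))"
    unfolding move_def by (rule runs_Seq[OF runs_rev_move runs_rev_move]) (use assms in auto)
  moreover have "?\<sigma>(u := [], w := rev (?\<sigma> u) @ ?\<sigma> w) = \<sigma>(v := [], w := \<sigma> v)"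
    using assms by (auto simp: fun_eq_iff)
  ultimately have "runs (move v w u) \<sigma> ((8 * length (\<sigma> v) + 1) + (8 * length (?\<sigma> u) + 1) + 1)
      (\<sigma>(v := [], w := \<sigma> v))" by (simp only:)
  then show ?thesis by (rule runs_mono) (use assms in simp)
qed

definition copy :: "nat \<Rightarrow> nat \<Rightarrow> nat \<Rightarrow> cmd" where
  "copy v w u = Seq (rev_move v u) (loop u (Seq (push v True) (push w True)) (Seq (push v False) (push w False)))"

lemma vars_copy [simp]: "vars (copy v w u) = {v, w, u}" "ok_cmd (copy v w u)"
  by (auto simp: copy_def)

lemma runs_copy:
  assumes "v \<noteq> u" "w \<noteq> u" "v \<noteq> w" "\<sigma> u = []" "\<sigma> w = []"
  shows "runs (copy v w u) \<sigma> (20 * length (\<sigma> v) + 3) (\<sigma>(w := \<sigma> v))"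
proof -
  let ?L = "loop u (Seq (push v True) (push w True)) (Seq (push v False) (push w False))"
  let ?S = "\<lambda>ys zs. \<sigma>(u := zs, v := rev ys, w := rev ys)"
  have "runs ?L (?S [] (rev (\<sigma> v))) ((7 + 5) * length (rev (\<sigma> v)) + 1) (?S (rev (\<sigma> v)) [])"
  proof (rule runs_loop[where S = ?S])
    fix ys zs b
    show "?S ys zs u = zs" using assms by simp
    let ?\<sigma> = "(?S ys (b # zs))(u := zs)"
    let ?\<sigma>' = "?\<sigma>(v := b # ?\<sigma> v)"
    have "?\<sigma>'(w := b # ?\<sigma>' w) = ?S (ys @ [b]) zs"
      using assms by (auto simp: fun_eq_iff)
    moreover have "runs (Seq (push v b) (push w b)) ?\<sigma> (3 + 3 + 1) (?\<sigma>'(w := b # ?\<sigma>' w))"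
      by (rule runs_Seq[OF runs_push runs_push])
    moreover have "(if b then Seq (push v True) (push w True) else Seq (push v False) (push w False))
        = Seq (push v b) (push w b)" by simp
    ultimately show "runs (if b then Seq (push v True) (push w True) else Seq (push v False) (push w False))
        ?\<sigma> 7 (?S (ys @ [b]) zs)" by (simp only:) simp
  qed
  moreover have "runs (rev_move v u) \<sigma> (8 * length (\<sigma> v) + 1) (?S [] (rev (\<sigma> v)))"
  proof -
    have "\<sigma>(v := [], u := rev (\<sigma> v) @ \<sigma> u) = ?S [] (rev (\<sigma> v))"
      using assms by (auto simp: fun_eq_iff)
    then show ?thesis using runs_rev_move[OF assms(1), of \<sigma>] by (simp only:)
  qed
  ultimately have "runs (copy v w u) \<sigma>
      ((8 * length (\<sigma> v) + 1) + ((7 + 5) * length (rev (\<sigma> v)) + 1) + 1) (?S (rev (\<sigma> v)) [])"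
    unfolding copy_def by (intro runs_Seq)
  moreover have "?S (rev (\<sigma> v)) [] = \<sigma>(w := \<sigma> v)"
    using assms by (auto simp: fun_eq_iff)
  ultimately have "runs (copy v w u) \<sigma>
      ((8 * length (\<sigma> v) + 1) + ((7 + 5) * length (rev (\<sigma> v)) + 1) + 1) (\<sigma>(w := \<sigma> v))"
    by (simp only:)
  then show ?thesis by (rule runs_mono) simp
qed

section \<open>Polynomial-time functions\<close>

lemma poly_mono_nat: "x \<le> y \<Longrightarrow> poly q x \<le> poly q y" for q :: "nat poly"
  by (induction q) (auto intro: add_mono mult_mono)

definition sz :: "bool list list \<Rightarrow> nat" where
  "sz a = sum_list (map length a)"

lemma sz_simps [simp]: "sz [] = 0" "sz (x # a) = length x + sz a" "sz (a @ b) = sz a + sz b"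
  by (auto simp: sz_def)

lemma length_nth_le_sz: "i < length a \<Longrightarrow> length (a ! i) \<le> sz a"
  using elem_le_sum_list[of i "map length a"] by (simp add: sz_def)

definition clean :: "nat \<Rightarrow> store \<Rightarrow> bool" where
  "clean m \<sigma> \<longleftrightarrow> (\<forall>v\<ge>m. \<sigma> v = [])"

lemma cleanD: "clean m \<sigma> \<Longrightarrow> m \<le> v \<Longrightarrow> \<sigma> v = []"
  by (simp add: clean_def)

lemma clean_upd: "clean m \<sigma> \<Longrightarrow> clean (Suc m) (\<sigma>(m := x))"
  by (simp add: clean_def)

text \<open>
  The arguments sit at arbitrary places \<open>ls\<close> and the result goes to \<open>m\<close>; everything beyond \<open>m\<close> is
  scratch space. Stack 1 is never touched, since its tape serves as the query tape.
\<close>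

definition computes ::
    "cmd \<Rightarrow> nat list \<Rightarrow> nat \<Rightarrow> nat poly \<Rightarrow> (bool list list \<Rightarrow> bool list) \<Rightarrow> bool" where
  "computes c ls m q f \<longleftrightarrow> ok_cmd c \<and> 1 \<notin> vars c \<and>
     (\<forall>\<sigma>. clean m \<sigma> \<longrightarrow> runs c \<sigma> (poly q (sz (map \<sigma> ls))) (\<sigma>(m := f (map \<sigma> ls))))"

definition places :: "nat \<Rightarrow> nat list \<Rightarrow> nat \<Rightarrow> bool" where
  "places k ls m \<longleftrightarrow> length ls = k \<and> (\<forall>l \<in> set ls. l < m \<and> l \<noteq> 1) \<and> 2 \<le> m"

text \<open>The polynomial is chosen before the places: the program may depend on where its
  arguments lie, its bound may not. The places in \<open>ls\<close> may repeat, which makes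
  duplicating an argument free.\<close>

definition PF :: "nat \<Rightarrow> (bool list list \<Rightarrow> bool list) \<Rightarrow> bool" where
  "PF k f \<longleftrightarrow> (\<exists>q. (\<forall>a. length a = k \<longrightarrow> length (f a) \<le> poly q (sz a)) \<and>
     (\<forall>ls m. places k ls m \<longrightarrow> (\<exists>c. computes c ls m q f)))"

lemma PFI:
  assumes "\<And>a. length a = k \<Longrightarrow> length (f a) \<le> poly q (sz a)"
    and "\<And>ls m. places k ls m \<Longrightarrow> \<exists>c. ok_cmd c \<and> 1 \<notin> vars c \<and>
      (\<forall>\<sigma>. clean m \<sigma> \<longrightarrow> runs c \<sigma> (poly q' (sz (map \<sigma> ls))) (\<sigma>(m := f (map \<sigma> ls))))"
  shows "PF k f"
  unfolding PF_def
proof (intro exI[of _ "q + q'"] conjI allI impI)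
  fix a :: "bool list list" assume "length a = k"
  with assms(1) show "length (f a) \<le> poly (q + q') (sz a)" by (simp add: trans_le_add1)
next
  fix ls m assume "places k ls m"
  from assms(2)[OF this] obtain c where c: "ok_cmd c" "1 \<notin> vars c"
    "\<And>\<sigma>. clean m \<sigma> \<Longrightarrow> runs c \<sigma> (poly q' (sz (map \<sigma> ls))) (\<sigma>(m := f (map \<sigma> ls)))"
    by blast
  have "runs c \<sigma> (poly (q + q') (sz (map \<sigma> ls))) (\<sigma>(m := f (map \<sigma> ls)))" if "clean m \<sigma>" for \<sigma>
    using c(3)[OF that] by (rule runs_mono) simp
  with c show "\<exists>c. computes c ls m (q + q') f" unfolding computes_def by blast
qed

lemma computesD:
  assumes "computes c ls m q f"
  shows "ok_cmd c" "1 \<notin> vars c"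
    "\<And>\<sigma>. clean m \<sigma> \<Longrightarrow> runs c \<sigma> (poly q (sz (map \<sigma> ls))) (\<sigma>(m := f (map \<sigma> ls)))"
  using assms unfolding computes_def by blast+

lemma PF_cong:
  assumes "PF k f" "\<And>a. length a = k \<Longrightarrow> f a = g a"
  shows "PF k g"
proof -
  obtain q where q: "\<And>a. length a = k \<Longrightarrow> length (f a) \<le> poly q (sz a)"
    "\<And>ls m. places k ls m \<Longrightarrow> \<exists>c. computes c ls m q f"
    using assms(1) unfolding PF_def by blast
  show ?thesis
  proof (rule PFI)
    fix ls m assume p: "places k ls m"
    then have "f (map \<sigma> ls) = g (map \<sigma> ls)" for \<sigma> :: store
      using assms(2)[of "map \<sigma> ls"] by (simp add: places_def)
    with q(2)[OF p] show "\<exists>c. ok_cmd c \<and> 1 \<notin> vars c \<and>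
        (\<forall>\<sigma>. clean m \<sigma> \<longrightarrow> runs c \<sigma> (poly q (sz (map \<sigma> ls))) (\<sigma>(m := g (map \<sigma> ls))))"
      by (simp add: computes_def)
  next
    fix a :: "bool list list" assume a: "length a = k"
    show "length (g a) \<le> poly q (sz a)" using q(1)[OF a] assms(2)[OF a] by simp
  qed
qed

section \<open>Closure properties of the class PF\<close>

lemma PF_nth:
  assumes "i < k"
  shows "PF k (\<lambda>a. a ! i)"
proof (rule PFI)
  fix a :: "bool list list" assume "length a = k"
  with assms length_nth_le_sz[of i a] show "length (a ! i) \<le> poly [:0, 1:] (sz a)" by simp
next
  fix ls m assume p: "places k ls m"
  have l: "ls ! i \<in> set ls" using assms p by (simp add: places_def)
  with p have l': "ls ! i < m" "ls ! i \<noteq> 1" "2 \<le> m" by (auto simp: places_def)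
  have "runs (copy (ls ! i) m (Suc m)) \<sigma> (poly [:3, 20:] (sz (map \<sigma> ls))) (\<sigma>(m := map \<sigma> ls ! i))"
    if c: "clean m \<sigma>" for \<sigma>
  proof -
    have "runs (copy (ls ! i) m (Suc m)) \<sigma> (20 * length (\<sigma> (ls ! i)) + 3) (\<sigma>(m := \<sigma> (ls ! i)))"
      by (rule runs_copy) (use l' cleanD[OF c] in auto)
    moreover have "length (\<sigma> (ls ! i)) \<le> sz (map \<sigma> ls)"
      using length_nth_le_sz[of i "map \<sigma> ls"] assms p by (simp add: places_def)
    ultimately show ?thesis
      using assms p by (auto simp: places_def algebra_simps intro: runs_mono)
  qed
  then show "\<exists>c. ok_cmd c \<and> 1 \<notin> vars c \<and>
      (\<forall>\<sigma>. clean m \<sigma> \<longrightarrow> runs c \<sigma> (poly [:3, 20:] (sz (map \<sigma> ls))) (\<sigma>(m := map \<sigma> ls ! i)))"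
    by (intro exI[of _ "copy (ls ! i) m (Suc m)"]) (use l' in auto)
qed

lemma PF_Nil: "PF k (\<lambda>_. [])"
proof (rule PFI)
  fix ls m
  have "runs Skip \<sigma> (poly 0 (sz (map \<sigma> ls))) (\<sigma>(m := []))" if "clean m \<sigma>" for \<sigma>
    using runs_Skip[of \<sigma>] cleanD[OF that, of m] by (simp add: fun_upd_idem)
  then show "\<exists>c. ok_cmd c \<and> 1 \<notin> vars c \<and>
      (\<forall>\<sigma>. clean m \<sigma> \<longrightarrow> runs c \<sigma> (poly 0 (sz (map \<sigma> ls))) (\<sigma>(m := [])))"
    by (intro exI[of _ Skip]) auto
qed auto

lemma PF_Cons:
  assumes "PF k f"
  shows "PF k (\<lambda>a. b # f a)"
proof -
  obtain q where q: "\<And>a. length a = k \<Longrightarrow> length (f a) \<le> poly q (sz a)"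
    "\<And>ls m. places k ls m \<Longrightarrow> \<exists>c. computes c ls m q f"
    using assms unfolding PF_def by blast
  show ?thesis
  proof (rule PFI)
    fix a :: "bool list list" assume "length a = k"
    with q(1) show "length (b # f a) \<le> poly (q + 1) (sz a)" by simp
  next
    fix ls m assume p: "places k ls m"
    obtain c where c: "computes c ls m q f" using q(2)[OF p] by blast
    have "runs (Seq c (push m b)) \<sigma> (poly (q + [:4:]) (sz (map \<sigma> ls))) (\<sigma>(m := b # f (map \<sigma> ls)))"
      if "clean m \<sigma>" for \<sigma>
      using runs_Seq[OF computesD(3)[OF c that] runs_push[of m b]] by (simp add: ac_simps)
    then show "\<exists>c. ok_cmd c \<and> 1 \<notin> vars c \<and> (\<forall>\<sigma>. clean m \<sigma> \<longrightarrow>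
        runs c \<sigma> (poly (q + [:4:]) (sz (map \<sigma> ls))) (\<sigma>(m := b # f (map \<sigma> ls))))"
      using computesD[OF c] p by (intro exI[of _ "Seq c (push m b)"]) (auto simp: places_def)
  qed
qed

lemma PF_const: "PF k (\<lambda>_. w)"
  by (induction w) (auto intro: PF_Nil PF_Cons)

lemma PF_tl:
  assumes "PF k f"
  shows "PF k (\<lambda>a. tl (f a))"
proof -
  obtain q where q: "\<And>a. length a = k \<Longrightarrow> length (f a) \<le> poly q (sz a)"
    "\<And>ls m. places k ls m \<Longrightarrow> \<exists>c. computes c ls m q f"
    using assms unfolding PF_def by blast
  show ?thesis
  proof (rule PFI)
    fix a :: "bool list list" assume "length a = k"
    from q(1)[OF this] show "length (tl (f a)) \<le> poly q (sz a)" by simp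
  next
    fix ls m assume p: "places k ls m"
    obtain c where c: "computes c ls m q f" using q(2)[OF p] by blast
    have "runs (Seq c (pop m)) \<sigma> (poly (q + [:2:]) (sz (map \<sigma> ls))) (\<sigma>(m := tl (f (map \<sigma> ls))))"
      if "clean m \<sigma>" for \<sigma>
      using runs_Seq[OF computesD(3)[OF c that] runs_pop[of m]] by (simp add: numeral_2_eq_2)
    then show "\<exists>c. ok_cmd c \<and> 1 \<notin> vars c \<and> (\<forall>\<sigma>. clean m \<sigma> \<longrightarrow>
        runs c \<sigma> (poly (q + [:2:]) (sz (map \<sigma> ls))) (\<sigma>(m := tl (f (map \<sigma> ls)))))"
      using computesD[OF c] p by (intro exI[of _ "Seq c (pop m)"]) (auto simp: places_def)
  qed
qed

lemma map_upd_places: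
  assumes "places k ls m" "m \<le> v"
  shows "map (\<sigma>(v := x)) ls = map \<sigma> ls"
  using assms by (auto simp: places_def)

text \<open>The source of all compositions. The value of f is left at place m and serves g as an
  additional last argument; the result of g appears one place higher and is moved down once m has
  been cleared.\<close>

lemma PF_let:
  assumes "PF k f" "PF (Suc k) g"
  shows "PF k (\<lambda>a. g (a @ [f a]))"
proof -
  obtain qf where qf: "\<And>a. length a = k \<Longrightarrow> length (f a) \<le> poly qf (sz a)"
    "\<And>ls m. places k ls m \<Longrightarrow> \<exists>c. computes c ls m qf f"
    using assms(1) unfolding PF_def by blast
  obtain qg where qg: "\<And>a. length a = Suc k \<Longrightarrow> length (g a) \<le> poly qg (sz a)"
    "\<And>ls m. places (Suc k) ls m \<Longrightarrow> \<exists>c. computes c ls m qg g"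
    using assms(2) unfolding PF_def by blast
  let ?qg = "pcompose qg ([:0, 1:] + qf)"
  have g_le: "poly qg (sz (a @ [f a])) \<le> poly ?qg (sz a)" if "length a = k" for a
    using qf(1)[OF that] by (simp add: poly_pcompose poly_mono_nat)
  show ?thesis
  proof (rule PFI)
    fix a :: "bool list list" assume a: "length a = k"
    have "length (g (a @ [f a])) \<le> poly qg (sz (a @ [f a]))" using qg(1)[of "a @ [f a]"] a by simp
    with g_le[OF a] show "length (g (a @ [f a])) \<le> poly ?qg (sz a)" by linarith
  next
    fix ls m assume p: "places k ls m"
    obtain cf where cf: "computes cf ls m qf f" using qf(2)[OF p] by blast
    have p': "places (Suc k) (ls @ [m]) (Suc m)" using p by (auto simp: places_def)
    obtain cg where cg: "computes cg (ls @ [m]) (Suc m) qg g" using qg(2)[OF p'] by blast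
    let ?c = "Seq (Seq (Seq cf cg) (clear m)) (move (Suc m) m (Suc (Suc m)))"
    let ?q = "smult 6 qf + smult 17 ?qg + [:7:]"
    have "runs ?c \<sigma> (poly ?q (sz (map \<sigma> ls))) (\<sigma>(m := g (map \<sigma> ls @ [f (map \<sigma> ls)])))"
      if cl: "clean m \<sigma>" for \<sigma>
    proof -
      let ?a = "map \<sigma> ls"
      let ?r = "g (?a @ [f ?a])"
      let ?\<sigma>1 = "\<sigma>(m := f ?a)"
      let ?\<sigma>2 = "?\<sigma>1(Suc m := ?r)"
      let ?\<sigma>3 = "?\<sigma>2(m := [])"
      have a: "length ?a = k" using p by (simp add: places_def)
      have *: "map ?\<sigma>1 (ls @ [m]) = ?a @ [f ?a]"
        using map_upd_places[OF p order.refl, of \<sigma>] by simp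
      have "runs cf \<sigma> (poly qf (sz ?a)) ?\<sigma>1"
        by (rule computesD(3)[OF cf cl])
      moreover have "runs cg ?\<sigma>1 (poly qg (sz (?a @ [f ?a]))) ?\<sigma>2"
        using computesD(3)[OF cg clean_upd[OF cl, of "f ?a"]] unfolding * .
      moreover have "runs (clear m) ?\<sigma>2 (5 * length (?\<sigma>2 m) + 1) ?\<sigma>3"
        by (rule runs_clear)
      moreover have "runs (move (Suc m) m (Suc (Suc m))) ?\<sigma>3 (16 * length (?\<sigma>3 (Suc m)) + 3)
          (?\<sigma>3(Suc m := [], m := ?\<sigma>3 (Suc m)))"
        by (rule runs_move) (use cleanD[OF cl] in auto)
      ultimately have "runs ?c \<sigma> (((poly qf (sz ?a) + poly qg (sz (?a @ [f ?a])) + 1) +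
          (5 * length (?\<sigma>2 m) + 1) + 1) + (16 * length (?\<sigma>3 (Suc m)) + 3) + 1)
          (?\<sigma>3(Suc m := [], m := ?\<sigma>3 (Suc m)))"
        by (intro runs_Seq)
      moreover have "?\<sigma>3(Suc m := [], m := ?\<sigma>3 (Suc m)) = \<sigma>(m := ?r)"
        using cleanD[OF cl] by (auto simp: fun_eq_iff)
      moreover have "length (?\<sigma>2 m) \<le> poly qf (sz ?a)" using qf(1)[OF a] by simp
      moreover have "length ?r \<le> poly qg (sz (?a @ [f ?a]))"
        using qg(1)[of "?a @ [f ?a]"] a by simp
      moreover note g_le[OF a]
      ultimately show ?thesis by (auto intro: runs_mono)
    qed
    then show "\<exists>c. ok_cmd c \<and> 1 \<notin> vars c \<and> (\<forall>\<sigma>. clean m \<sigma> \<longrightarrow>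
        runs c \<sigma> (poly ?q (sz (map \<sigma> ls))) (\<sigma>(m := g (map \<sigma> ls @ [f (map \<sigma> ls)]))))"
      using computesD[OF cf] computesD[OF cg] p by (intro exI[of _ ?c]) (auto simp: places_def)
  qed
qed

text \<open>No instruction is added: the program for h is taken at the selected places. A place may
  be selected up to j times, hence the bound is composed with multiplication by j.\<close>

lemma PF_select:
  assumes "PF j h" "\<And>i. i < j \<Longrightarrow> s i < k"
  shows "PF k (\<lambda>a. h (map (\<lambda>i. a ! s i) [0..<j]))"
proof -
  obtain q where q: "\<And>a. length a = j \<Longrightarrow> length (h a) \<le> poly q (sz a)"
    "\<And>ls m. places j ls m \<Longrightarrow> \<exists>c. computes c ls m q h"
    using assms(1) unfolding PF_def by blast
  let ?q = "pcompose q [:0, j:]"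
  have le: "poly q (sz (map (\<lambda>i. a ! s i) [0..<j])) \<le> poly ?q (sz a)" if "length a = k" for a
  proof -
    have "sz (map (\<lambda>i. a ! s i) [0..<j]) = (\<Sum>i<j. length (a ! s i))"
      by (simp add: sz_def interv_sum_list_conv_sum_set_nat atLeast0LessThan)
    also have "\<dots> \<le> (\<Sum>i<j. sz a)"
      using assms(2) that by (intro sum_mono length_nth_le_sz) auto
    finally show ?thesis by (simp add: poly_pcompose poly_mono_nat algebra_simps)
  qed
  show ?thesis
  proof (rule PFI)
    fix a :: "bool list list" assume "length a = k"
    from le[OF this] q(1)[of "map (\<lambda>i. a ! s i) [0..<j]"]
    show "length (h (map (\<lambda>i. a ! s i) [0..<j])) \<le> poly ?q (sz a)" by simp
  next
    fix ls m assume p: "places k ls m"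
    let ?ls = "map (\<lambda>i. ls ! s i) [0..<j]"
    have "places j ?ls m" using p assms(2) by (auto simp: places_def)
    with q(2) obtain c where c: "computes c ?ls m q h" by blast
    have eq: "map \<sigma> ?ls = map (\<lambda>i. map \<sigma> ls ! s i) [0..<j]" for \<sigma> :: store
      using p assms(2) by (auto simp: places_def)
    have "runs c \<sigma> (poly ?q (sz (map \<sigma> ls))) (\<sigma>(m := h (map (\<lambda>i. map \<sigma> ls ! s i) [0..<j])))"
      if "clean m \<sigma>" for \<sigma>
      using computesD(3)[OF c that] unfolding eq
      by (rule runs_mono) (rule le, use p in \<open>simp add: places_def\<close>)
    with c show "\<exists>c. ok_cmd c \<and> 1 \<notin> vars c \<and> (\<forall>\<sigma>. clean m \<sigma> \<longrightarrow> runs c \<sigma>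
        (poly ?q (sz (map \<sigma> ls))) (\<sigma>(m := h (map (\<lambda>i. map \<sigma> ls ! s i) [0..<j]))))"
      unfolding computes_def by blast
  qed
qed

lemma PF_if:
  assumes "PF k b" "PF k f" "PF k g"
  shows "PF k (\<lambda>a. if b a \<noteq> [] \<and> hd (b a) then f a else g a)"
proof -
  obtain qb where qb: "\<And>a. length a = k \<Longrightarrow> length (b a) \<le> poly qb (sz a)"
    "\<And>ls m. places k ls m \<Longrightarrow> \<exists>c. computes c ls m qb b"
    using assms(1) unfolding PF_def by blast
  obtain qf where qf: "\<And>a. length a = k \<Longrightarrow> length (f a) \<le> poly qf (sz a)"
    "\<And>ls m. places k ls m \<Longrightarrow> \<exists>c. computes c ls m qf f"
    using assms(2) unfolding PF_def by blast
  obtain qg where qg: "\<And>a. length a = k \<Longrightarrow> length (g a) \<le> poly qg (sz a)"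
    "\<And>ls m. places k ls m \<Longrightarrow> \<exists>c. computes c ls m qg g"
    using assms(3) unfolding PF_def by blast
  show ?thesis
  proof (rule PFI)
    fix a :: "bool list list" assume a: "length a = k"
    from qf(1)[OF a] qg(1)[OF a]
    show "length (if b a \<noteq> [] \<and> hd (b a) then f a else g a) \<le> poly (qf + qg) (sz a)" by simp
  next
    fix ls m assume p: "places k ls m"
    obtain cb where cb: "computes cb ls m qb b" using qb(2)[OF p] by blast
    obtain cf where cf: "computes cf ls m qf f" using qf(2)[OF p] by blast
    obtain cg where cg: "computes cg ls m qg g" using qg(2)[OF p] by blast
    \<comment> \<open>The branches clear the test result first, because their programs presuppose
      that place m is empty.\<close>
    let ?c = "Seq cb (If m (Seq (clear m) cf) (Seq (clear m) cg))"
    let ?q = "smult 6 qb + qf + qg + [:4:]"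
    have "runs ?c \<sigma> (poly ?q (sz (map \<sigma> ls)))
        (\<sigma>(m := (if b (map \<sigma> ls) \<noteq> [] \<and> hd (b (map \<sigma> ls)) then f (map \<sigma> ls) else g (map \<sigma> ls))))"
      if cl: "clean m \<sigma>" for \<sigma>
    proof -
      let ?a = "map \<sigma> ls"
      let ?t = "b ?a \<noteq> [] \<and> hd (b ?a)"
      let ?\<sigma>1 = "\<sigma>(m := b ?a)"
      have \<sigma>: "?\<sigma>1(m := []) = \<sigma>" using cleanD[OF cl] by (auto simp: fun_eq_iff)
      have 1: "runs cb \<sigma> (poly qb (sz ?a)) ?\<sigma>1"
        by (rule computesD(3)[OF cb cl])
      have 2: "runs (clear m) ?\<sigma>1 (5 * length (?\<sigma>1 m) + 1) \<sigma>"
        using runs_clear[of m ?\<sigma>1] unfolding \<sigma> .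
      have "runs (if ?t then cf else cg) \<sigma> (poly (qf + qg) (sz ?a)) (\<sigma>(m := if ?t then f ?a else g ?a))"
        using computesD(3)[OF cf cl] computesD(3)[OF cg cl] by (auto elim: runs_mono)
      from runs_Seq[OF 2 this]
      have "runs (if ?\<sigma>1 m \<noteq> [] \<and> hd (?\<sigma>1 m) then Seq (clear m) cf else Seq (clear m) cg) ?\<sigma>1
          ((5 * length (b ?a) + 1) + poly (qf + qg) (sz ?a) + 1) (\<sigma>(m := if ?t then f ?a else g ?a))"
        by (cases ?t) auto
      from runs_Seq[OF 1 runs_If[OF this]]
      show ?thesis
        by (rule runs_mono) (use qb(1)[of ?a] p in \<open>simp add: places_def\<close>)
    qed
    then show "\<exists>c. ok_cmd c \<and> 1 \<notin> vars c \<and> (\<forall>\<sigma>. clean m \<sigma> \<longrightarrow> runs c \<sigma> (poly ?q (sz (map \<sigma> ls)))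
        (\<sigma>(m := (if b (map \<sigma> ls) \<noteq> [] \<and> hd (b (map \<sigma> ls)) then f (map \<sigma> ls) else g (map \<sigma> ls)))))"
      using computesD[OF cb] computesD[OF cf] computesD[OF cg] p
      by (intro exI[of _ ?c]) (auto simp: places_def)
  qed
qed

text \<open>The second argument of h is the part already read, in reverse. On a unary string it is
  the loop counter.\<close>

primrec pfold :: "(bool \<Rightarrow> bool list \<Rightarrow> bool list \<Rightarrow> bool list) \<Rightarrow>
    bool list \<Rightarrow> bool list \<Rightarrow> bool list \<Rightarrow> bool list" where
  "pfold h pre [] acc = acc"
| "pfold h pre (b # xs) acc = pfold h (b # pre) xs (h b pre acc)"

lemma pfold_append: "pfold h pre (xs @ ys) acc = pfold h (rev xs @ pre) ys (pfold h pre xs acc)"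
  by (induction xs arbitrary: pre acc) auto

text \<open>Cobham's bounded recursion on notation. The bound is required for the accumulator after
  every prefix and not only at the end, since it controls the time of each round; without it
  repeated doubling could produce exponential length.\<close>

lemma PF_pfold:
  assumes "PF k f" "PF k g" "PF (k + 2) h1" "PF (k + 2) h0"
    and H: "\<And>a b pre acc. length a = k \<Longrightarrow> H a b pre acc = (if b then h1 else h0) (a @ [pre, acc])"
    and bound: "\<And>a ys zs. length a = k \<Longrightarrow> ys @ zs = f a \<Longrightarrow>
      length (pfold (H a) [] ys (g a)) \<le> poly qA (sz a)"
  shows "PF k (\<lambda>a. pfold (H a) [] (f a) (g a))"
proof -
  obtain qf where qf: "\<And>a. length a = k \<Longrightarrow> length (f a) \<le> poly qf (sz a)"
    "\<And>ls m. places k ls m \<Longrightarrow> \<exists>c. computes c ls m qf f"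
    using assms(1) unfolding PF_def by blast
  obtain qg where qg: "\<And>a. length a = k \<Longrightarrow> length (g a) \<le> poly qg (sz a)"
    "\<And>ls m. places k ls m \<Longrightarrow> \<exists>c. computes c ls m qg g"
    using assms(2) unfolding PF_def by blast
  obtain q1 where q1: "\<And>a. length a = k + 2 \<Longrightarrow> length (h1 a) \<le> poly q1 (sz a)"
    "\<And>ls m. places (k + 2) ls m \<Longrightarrow> \<exists>c. computes c ls m q1 h1"
    using assms(3) unfolding PF_def by blast
  obtain q0 where q0: "\<And>a. length a = k + 2 \<Longrightarrow> length (h0 a) \<le> poly q0 (sz a)"
    "\<And>ls m. places (k + 2) ls m \<Longrightarrow> \<exists>c. computes c ls m q0 h0"
    using assms(4) unfolding PF_def by blast
  let ?qh = "pcompose (q1 + q0) ([:0, 1:] + qf + qA)"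
  let ?N = "?qh + smult 21 qA + [:10:]"
  let ?q = "qf + qg + (?N + [:5:]) * qf + smult 5 qf + smult 16 qA + [:9:]"
  show ?thesis
  proof (rule PFI)
    fix a :: "bool list list" assume "length a = k"
    from bound[OF this, of "f a" "[]"] show "length (pfold (H a) [] (f a) (g a)) \<le> poly qA (sz a)"
      by simp
  next
    fix ls m assume p: "places k ls m"
    \<comment> \<open>Layout: m holds the bits still to be read, m1 the accumulator, m2 the bits
      already read, m3 the new accumulator, and m4 is scratch space for moving it.\<close>
    define m1 where "m1 = Suc m"
    define m2 where "m2 = Suc (Suc m)"
    define m3 where "m3 = Suc (Suc (Suc m))"
    define m4 where "m4 = Suc (Suc (Suc (Suc m)))"
    note ms = m1_def m2_def m3_def m4_def
    have m: "2 \<le> m" using p by (simp add: places_def)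
    obtain cf where cf: "computes cf ls m qf f" using qf(2)[OF p] by blast
    have "places k ls m1" using p by (auto simp: places_def ms)
    then obtain cg where cg: "computes cg ls m1 qg g" using qg(2) by blast
    have pl: "places (k + 2) (ls @ [m2, m1]) m3" using p by (auto simp: places_def ms)
    obtain c1 where c1: "computes c1 (ls @ [m2, m1]) m3 q1 h1" using q1(2)[OF pl] by blast
    obtain c0 where c0: "computes c0 (ls @ [m2, m1]) m3 q0 h0" using q0(2)[OF pl] by blast
    define body where "body b =
      Seq (Seq (Seq (if b then c1 else c0) (clear m1)) (move m3 m1 m4)) (push m2 b)" for b
    let ?c = "Seq (Seq (Seq (Seq cf cg) (loop m (body True) (body False))) (clear m2)) (move m1 m m3)"
    have "runs ?c \<sigma> (poly ?q (sz (map \<sigma> ls)))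
        (\<sigma>(m := pfold (H (map \<sigma> ls)) [] (f (map \<sigma> ls)) (g (map \<sigma> ls))))"
      if cl: "clean m \<sigma>" for \<sigma>
    proof -
      define a where "a = map \<sigma> ls"
      have a: "length a = k" using p by (simp add: a_def places_def)
      define F where "F = poly qf (sz a)"
      define A where "A = poly qA (sz a)"
      define acc where "acc ys = pfold (H a) [] ys (g a)" for ys
      define S where "S ys zs = \<sigma>(m := zs, m1 := acc ys, m2 := rev ys)" for ys zs
      have fa: "length (f a) \<le> F" using qf(1)[OF a] by (simp add: F_def)
      have S_ls: "map (S ys zs) ls = a" for ys zs
        using p by (auto simp: S_def a_def places_def ms)
      have acc_le: "length (acc ys) \<le> A" if "ys @ zs = f a" for ys zs
        using bound[OF a that] by (simp add: acc_def A_def)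
      have body: "runs (body b) (S ys zs) (poly ?N (sz a)) (S (ys @ [b]) zs)"
        if f: "ys @ b # zs = f a" for ys b zs
      proof -
        let ?a = "a @ [rev ys, acc ys]"
        let ?r = "acc (ys @ [b])"
        let ?\<sigma>0 = "S ys zs"
        let ?\<sigma>1 = "?\<sigma>0(m3 := ?r)"
        let ?\<sigma>2 = "?\<sigma>1(m1 := [])"
        let ?\<sigma>3 = "?\<sigma>2(m3 := [], m1 := ?\<sigma>2 m3)"
        let ?\<sigma>4 = "?\<sigma>3(m2 := b # ?\<sigma>3 m2)"
        have cl3: "clean m3 ?\<sigma>0" using cl by (auto simp: clean_def S_def ms)
        have arg: "map ?\<sigma>0 (ls @ [m2, m1]) = ?a"
          using S_ls[of ys zs] by (simp add: S_def ms)
        have r: "?r = (if b then h1 else h0) ?a"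
          by (simp add: acc_def pfold_append H[OF a])
        have "length (rev ys) \<le> F" using arg_cong[OF f, of length] fa by simp
        moreover have accy: "length (acc ys) \<le> A" using acc_le[OF f] .
        ultimately have "sz ?a \<le> sz a + F + A" by simp
        then have qh: "poly (q1 + q0) (sz ?a) \<le> poly ?qh (sz a)"
          by (simp add: poly_pcompose F_def A_def add_mono poly_mono_nat)
        have rA: "length ?r \<le> A" using acc_le[of "ys @ [b]" zs] f by simp
        have "runs (if b then c1 else c0) ?\<sigma>0 (poly (q1 + q0) (sz ?a)) ?\<sigma>1"
          using computesD(3)[OF c1 cl3] computesD(3)[OF c0 cl3] unfolding arg r
          by (auto elim: runs_mono)
        moreover have "runs (clear m1) ?\<sigma>1 (5 * length (?\<sigma>1 m1) + 1) ?\<sigma>2"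
          by (rule runs_clear)
        moreover have "runs (move m3 m1 m4) ?\<sigma>2 (16 * length (?\<sigma>2 m3) + 3) ?\<sigma>3"
          by (rule runs_move) (use cleanD[OF cl3] in \<open>auto simp: ms\<close>)
        moreover have "runs (push m2 b) ?\<sigma>3 3 ?\<sigma>4"
          by (rule runs_push)
        ultimately have "runs (body b) ?\<sigma>0 (((poly (q1 + q0) (sz ?a) + (5 * length (?\<sigma>1 m1) + 1) + 1)
            + (16 * length (?\<sigma>2 m3) + 3) + 1) + 3 + 1) ?\<sigma>4"
          unfolding body_def by (intro runs_Seq)
        moreover have "?\<sigma>4 = S (ys @ [b]) zs"
          using cleanD[OF cl] by (auto simp: S_def ms fun_eq_iff)
        moreover have "?\<sigma>1 m1 = acc ys" "?\<sigma>2 m3 = ?r" by (auto simp: S_def ms)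
        ultimately have "runs (body b) ?\<sigma>0 (((poly (q1 + q0) (sz ?a) + (5 * length (acc ys) + 1) + 1)
            + (16 * length ?r + 3) + 1) + 3 + 1) (S (ys @ [b]) zs)"
          by (simp only:)
        then show ?thesis
          by (rule runs_mono) (use qh accy rA in \<open>simp add: A_def\<close>)
      qed
      let ?\<sigma>1 = "\<sigma>(m := f a)"
      let ?\<sigma>2 = "?\<sigma>1(m1 := g a)"
      let ?\<sigma>3 = "S (f a) []"
      let ?\<sigma>4 = "?\<sigma>3(m2 := [])"
      let ?\<sigma>5 = "?\<sigma>4(m1 := [], m := ?\<sigma>4 m1)"
      have S0: "?\<sigma>2 = S [] (f a)"
        using cleanD[OF cl] by (auto simp: S_def ms acc_def fun_eq_iff)
      have a1: "map ?\<sigma>1 ls = a" using p by (auto simp: a_def places_def)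
      have "runs cf \<sigma> F ?\<sigma>1"
        using computesD(3)[OF cf cl] by (simp add: a_def F_def)
      moreover have "runs cg ?\<sigma>1 (poly qg (sz a)) ?\<sigma>2"
        using computesD(3)[OF cg, of ?\<sigma>1] clean_upd[OF cl, of "f a"] unfolding a1 by (simp add: ms)
      moreover have "runs (loop m (body True) (body False)) (S [] (f a))
          ((poly ?N (sz a) + 5) * length (f a) + 1) ?\<sigma>3"
      proof (rule runs_loop)
        fix ys zs show "S ys zs m = zs" by (simp add: S_def ms)
      next
        fix ys b zs assume f: "ys @ b # zs = f a"
        have "(S ys (b # zs))(m := zs) = S ys zs" by (auto simp: S_def ms fun_eq_iff)
        with body[OF f] show "runs (if b then body True else body False) ((S ys (b # zs))(m := zs))
            (poly ?N (sz a)) (S (ys @ [b]) zs)" by (cases b) auto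
      qed
      moreover have "runs (clear m2) ?\<sigma>3 (5 * length (?\<sigma>3 m2) + 1) ?\<sigma>4"
        by (rule runs_clear)
      moreover have "runs (move m1 m m3) ?\<sigma>4 (16 * length (?\<sigma>4 m1) + 3) ?\<sigma>5"
        by (rule runs_move) (use cleanD[OF cl] in \<open>auto simp: ms S_def\<close>)
      ultimately have "runs ?c \<sigma> ((((F + poly qg (sz a) + 1) + ((poly ?N (sz a) + 5) * length (f a) + 1) + 1)
          + (5 * length (?\<sigma>3 m2) + 1) + 1) + (16 * length (?\<sigma>4 m1) + 3) + 1) ?\<sigma>5"
        unfolding S0 by (intro runs_Seq)
      moreover have "?\<sigma>3 m2 = rev (f a)" "?\<sigma>4 m1 = acc (f a)" by (auto simp: S_def ms)
      moreover have "?\<sigma>5 = \<sigma>(m := acc (f a))"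
        using cleanD[OF cl] by (auto simp: S_def ms fun_eq_iff)
      ultimately have "runs ?c \<sigma> ((((F + poly qg (sz a) + 1) + ((poly ?N (sz a) + 5) * length (f a) + 1) + 1)
          + (5 * length (rev (f a)) + 1) + 1) + (16 * length (acc (f a)) + 3) + 1) (\<sigma>(m := acc (f a)))"
        by (simp only:)
      then have "runs ?c \<sigma> (poly ?q (sz a)) (\<sigma>(m := acc (f a)))"
      proof (rule runs_mono)
        have "(poly ?N (sz a) + 5) * length (f a) \<le> (poly ?N (sz a) + 5) * F"
          using fa by (rule mult_left_mono) simp
        moreover have "poly ?q (sz a) = F + poly qg (sz a) + (poly ?N (sz a) + 5) * F + 5 * F + 16 * A + 9"
          by (simp add: F_def A_def)
        moreover have "length (acc (f a)) \<le> A" using acc_le[of "f a" "[]"] by simp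
        moreover have "length (rev (f a)) \<le> F" using fa by simp
        ultimately show "(((F + poly qg (sz a) + 1) + ((poly ?N (sz a) + 5) * length (f a) + 1) + 1)
          + (5 * length (rev (f a)) + 1) + 1) + (16 * length (acc (f a)) + 3) + 1 \<le> poly ?q (sz a)"
          by linarith
      qed
      then show ?thesis by (simp only: acc_def a_def)
    qed
    then show "\<exists>c. ok_cmd c \<and> 1 \<notin> vars c \<and> (\<forall>\<sigma>. clean m \<sigma> \<longrightarrow> runs c \<sigma> (poly ?q (sz (map \<sigma> ls)))
        (\<sigma>(m := pfold (H (map \<sigma> ls)) [] (f (map \<sigma> ls)) (g (map \<sigma> ls)))))"
      using computesD[OF cf] computesD[OF cg] computesD[OF c1] computesD[OF c0] m
      by (intro exI[of _ ?c]) (auto simp: body_def ms)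
  qed
qed

text \<open>Makes a function of the outer arguments available in the body of a recursion, where
  further arguments have been appended.\<close>

lemma PF_weaken:
  assumes "PF k f" "k \<le> n"
  shows "PF n (\<lambda>a. f (take k a))"
proof -
  have "PF n (\<lambda>a. f (map (\<lambda>i. a ! i) [0..<k]))"
    using PF_select[OF assms(1), of "\<lambda>i. i" n] assms(2) by simp
  then show ?thesis
  proof (rule PF_cong)
    fix a :: "bool list list" assume "length a = n"
    with assms(2) have "map (\<lambda>i. a ! i) [0..<k] = take k a" by (intro nth_equalityI) auto
    then show "f (map (\<lambda>i. a ! i) [0..<k]) = f (take k a)" by simp
  qed
qed

lemma PF_app1:
  assumes "PF 1 (\<lambda>a. h (a ! 0))" "PF k F"
  shows "PF k (\<lambda>a. h (F a))"
proof -
  have "PF (Suc k) (\<lambda>a. h (a ! k))"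
    using PF_select[OF assms(1), of "\<lambda>_. k" "Suc k"] by simp
  from PF_let[OF assms(2) this] show ?thesis by (rule PF_cong) (auto simp: nth_append)
qed

lemma PF_app2:
  assumes "PF 2 (\<lambda>a. h (a ! 0) (a ! 1))" "PF k F" "PF k G"
  shows "PF k (\<lambda>a. h (F a) (G a))"
proof -
  have "PF (Suc (Suc k)) (\<lambda>a. h (a ! k) (a ! Suc k))"
    using PF_select[OF assms(1), of "\<lambda>i. i + k" "Suc (Suc k)"] by (simp add: numeral_2_eq_2)
  from PF_let[OF PF_weaken[OF assms(3), of "Suc k"] this]
  have "PF (Suc k) (\<lambda>a. h ((a @ [G (take k a)]) ! k) ((a @ [G (take k a)]) ! Suc k))" by simp
  then have "PF (Suc k) (\<lambda>a. h (a ! k) (G (take k a)))"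
    by (rule PF_cong) (auto simp: nth_append)
  from PF_let[OF assms(2) this] show ?thesis by (rule PF_cong) (auto simp: nth_append)
qed

lemma pfold_Cons: "pfold (\<lambda>b pre acc. b # acc) pre xs acc = rev xs @ acc"
  by (induction xs arbitrary: pre acc) auto

lemma PF_rev_append: "PF 2 (\<lambda>a. rev (a ! 0) @ a ! 1)"
proof -
  have "PF 2 (\<lambda>a. pfold ((\<lambda>a b pre acc. b # acc) a) [] (a ! 0) (a ! 1))"
  proof (rule PF_pfold[where ?h1.0 = "\<lambda>a. True # a ! 3" and ?h0.0 = "\<lambda>a. False # a ! 3" and qA = "[:0, 1:]"])
    show "PF (2 + 2) (\<lambda>a. True # a ! 3)" "PF (2 + 2) (\<lambda>a. False # a ! 3)"
      by (intro PF_Cons PF_nth; simp)+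
    fix a :: "bool list list" assume a: "length a = 2"
    then obtain x y where xy: "a = [x, y]" by (auto simp: length_Suc_conv numeral_2_eq_2)
    show "b # acc = (if b then \<lambda>a. True # a ! 3 else (\<lambda>a. False # a ! 3)) (a @ [pre, acc])" for b pre acc
      using a by (auto simp: nth_append)
    show "length (pfold (\<lambda>b pre acc. b # acc) [] ys (a ! 1)) \<le> poly [:0, 1:] (sz a)"
      if "ys @ zs = a ! 0" for ys zs
      using that xy by (auto simp: pfold_Cons)
  qed (intro PF_nth; simp)+
  then show ?thesis by (simp add: pfold_Cons)
qed

lemma PF_rev: "PF k f \<Longrightarrow> PF k (\<lambda>a. rev (f a))"
  using PF_app2[OF PF_rev_append, of k f "\<lambda>_. []"] PF_Nil by simp

lemma PF_append: "PF k f \<Longrightarrow> PF k g \<Longrightarrow> PF k (\<lambda>a. f a @ g a)"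
  using PF_app2[OF PF_rev_append, of k "\<lambda>a. rev (f a)" g] PF_rev by simp

lemma pfold_const_step:
  "pfold (\<lambda>b pre acc. g acc) pre xs acc = (g ^^ length xs) acc"
  by (induction xs arbitrary: pre acc) (auto simp: funpow_swap1)

text \<open>Growth by a constant c per round is harmless, since the number of rounds is the length
  of a string and thus polynomial.\<close>

lemma PF_iterate:
  assumes "PF 1 (\<lambda>a. g (a ! 0))" "\<And>x. length (g x) \<le> length x + c" "PF k f" "PF k x"
  shows "PF k (\<lambda>a. (g ^^ length (f a)) (x a))"
proof -
  have len: "length ((g ^^ n) x) \<le> length x + n * c" for n x
  proof (induction n)
    case (Suc n)
    then show ?case using assms(2)[of "(g ^^ n) x"] by simp
  qed simp
  have "PF 2 (\<lambda>a. pfold ((\<lambda>a b pre acc. g acc) a) [] (a ! 0) (a ! 1))"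
  proof (rule PF_pfold[where ?h1.0 = "\<lambda>a. g (a ! 3)" and ?h0.0 = "\<lambda>a. g (a ! 3)" and qA = "[:0, 1 + c:]"])
    show "PF (2 + 2) (\<lambda>a. g (a ! 3))" "PF (2 + 2) (\<lambda>a. g (a ! 3))"
      by (intro PF_app1[OF assms(1)] PF_nth; simp)+
    fix a :: "bool list list" assume a: "length a = 2"
    then obtain x y where xy: "a = [x, y]" by (auto simp: length_Suc_conv numeral_2_eq_2)
    show "g acc = (if b then \<lambda>a. g (a ! 3) else (\<lambda>a. g (a ! 3))) (a @ [pre, acc])" for b :: bool and pre acc
      using a by (auto simp: nth_append)
    show "length (pfold (\<lambda>b pre acc. g acc) [] ys (a ! 1)) \<le> poly [:0, 1 + c:] (sz a)"
      if "ys @ zs = a ! 0" for ys zs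
      using that[symmetric] xy len[of "length ys" y] by (auto simp: pfold_const_step algebra_simps)
  qed (intro PF_nth; simp)+
  then have "PF 2 (\<lambda>a. (g ^^ length (a ! 0)) (a ! 1))" by (simp add: pfold_const_step)
  from PF_app2[OF this assms(3,4)] show ?thesis .
qed

text \<open>Numbers such as times, places and loop counters are passed as lengths of strings; this
  is the canonical string of a given length. Arithmetic and comparison then reduce to pushing,
  dropping and testing for emptiness.\<close>

definition unary :: "nat \<Rightarrow> bool list" where
  "unary n = replicate n True"

lemma length_unary [simp]: "length (unary n) = n"
  by (simp add: unary_def)

lemma unary_iterate: "((\<lambda>x. True # x) ^^ n) [] = unary n"
  by (induction n) (auto simp: unary_def)

lemma PF_unary: "PF k f \<Longrightarrow> PF k (\<lambda>a. unary (length (f a)))"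
  using PF_iterate[of "\<lambda>x. True # x" 1 k f "\<lambda>_. []"]
  by (simp add: unary_iterate PF_Nil PF_Cons PF_nth)

lemma drop_iterate: "(tl ^^ n) xs = drop n xs"
  by (induction n) (auto simp: drop_Suc tl_drop)

lemma PF_drop: "PF k f \<Longrightarrow> PF k g \<Longrightarrow> PF k (\<lambda>a. drop (length (f a)) (g a))"
  using PF_iterate[of tl 0 k f g] by (simp add: drop_iterate PF_tl PF_nth)

text \<open>A unary string equals its reversal, so the prefix read before round i is exactly
  \<open>unary i\<close> and acts as the loop index.\<close>

lemma pfold_unary:
  "pfold (\<lambda>b pre acc. acc @ g pre) [] (unary n) [] = concat (map (\<lambda>i. g (unary i)) [0..<n])"
proof (induction n)
  case (Suc n)
  have "unary (Suc n) = unary n @ [True]" by (simp add: unary_def replicate_append_same)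
  with Suc show ?case by (simp add: pfold_append) (simp add: unary_def)
qed (simp add: unary_def)

text \<open>A for-loop that writes output. Nested four deep, over the times and places of two
  vertices, it produces the matrices of the reduction. The bound is the number of rounds times the
  bound of G at the largest counter.\<close>

lemma PF_concat_upt:
  assumes "PF k f" "PF (Suc k) G"
  shows "PF k (\<lambda>a. concat (map (\<lambda>i. G (a @ [unary i])) [0..<length (f a)]))"
proof -
  obtain qf where qf: "\<And>a. length a = k \<Longrightarrow> length (f a) \<le> poly qf (sz a)"
    using assms(1) unfolding PF_def by blast
  obtain qG where qG: "\<And>a. length a = Suc k \<Longrightarrow> length (G a) \<le> poly qG (sz a)"
    using assms(2) unfolding PF_def by blast
  let ?H = "\<lambda>a b pre acc. acc @ G (a @ [pre])"
  let ?h = "\<lambda>a. a ! Suc k @ G (take (Suc k) a)"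
  let ?q = "qf * pcompose qG ([:0, 1:] + qf)"
  have "PF k (\<lambda>a. pfold (?H a) [] (unary (length (f a))) ((\<lambda>_. []) a))"
  proof (rule PF_pfold[where ?h1.0 = ?h and ?h0.0 = ?h and qA = ?q])
    show "PF k (\<lambda>a. unary (length (f a)))" using assms(1) by (rule PF_unary)
    show "PF (k + 2) ?h" "PF (k + 2) ?h"
      by (intro PF_append PF_nth PF_weaken[OF assms(2)]; simp)+
    fix a :: "bool list list" assume a: "length a = k"
    show "?H a b pre acc = (if b then ?h else ?h) (a @ [pre, acc])" for b :: bool and pre acc
      using a by (auto simp: nth_append)
    show "length (pfold (?H a) [] ys []) \<le> poly ?q (sz a)"
      if "ys @ zs = unary (length (f a))" for ys zs
    proof -
      have "set ys \<subseteq> set (unary (length (f a)))" "length ys \<le> length (f a)"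
        using arg_cong[OF that, of length] arg_cong[OF that, of set] by auto
      \<comment> \<open>Prefixes of a unary string are unary, so \<open>pfold_unary\<close> also
        describes the intermediate accumulators.\<close>
      then have ys: "ys = unary (length ys)"
        unfolding unary_def by (intro replicate_eqI) (auto split: if_splits)
      have le: "length (G (a @ [unary i])) \<le> poly (pcompose qG ([:0, 1:] + qf)) (sz a)"
        if "i < length ys" for i
      proof -
        have "length (G (a @ [unary i])) \<le> poly qG (sz a + i)"
          using qG[of "a @ [unary i]"] a by simp
        also have "\<dots> \<le> poly qG (sz a + poly qf (sz a))"
          using qf[OF a] that \<open>length ys \<le> length (f a)\<close> by (intro poly_mono_nat) simp
        finally show ?thesis by (simp add: poly_pcompose)
      qed
      have "length (pfold (?H a) [] ys []) = (\<Sum>i\<leftarrow>[0..<length ys]. length (G (a @ [unary i])))"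
        by (subst ys) (simp add: pfold_unary length_concat o_def)
      also have "\<dots> \<le> (\<Sum>i\<leftarrow>[0..<length ys]. poly (pcompose qG ([:0, 1:] + qf)) (sz a))"
        by (intro sum_list_mono le) simp
      also have "\<dots> \<le> poly ?q (sz a)"
        using \<open>length ys \<le> length (f a)\<close> qf[OF a] by (simp add: sum_list_triv mult_mono)
      finally show ?thesis .
    qed
  qed (rule PF_Nil)
  then show ?thesis by (simp add: pfold_unary)
qed

text \<open>The list is part of the program, so the dependence of F on d is arbitrary. It will be
  the list of values of a cell.\<close>

lemma PF_concat_list:
  assumes "\<And>d. d \<in> set ds \<Longrightarrow> PF k (F d)"
  shows "PF k (\<lambda>a. concat (map (\<lambda>d. F d a) ds))"
  using assms by (induction ds) (auto intro: PF_Nil PF_append)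

section \<open>Polynomial-time predicates\<close>

definition PB :: "nat \<Rightarrow> (bool list list \<Rightarrow> bool) \<Rightarrow> bool" where
  "PB k P \<longleftrightarrow> PF k (\<lambda>a. [P a])"

lemma PB_cong: "PB k P \<Longrightarrow> (\<And>a. length a = k \<Longrightarrow> P a = Q a) \<Longrightarrow> PB k Q"
  unfolding PB_def by (erule PF_cong) simp

lemma PF_If: "PB k P \<Longrightarrow> PF k f \<Longrightarrow> PF k g \<Longrightarrow> PF k (\<lambda>a. if P a then f a else g a)"
  unfolding PB_def using PF_if[of k "\<lambda>a. [P a]" f g] by simp

lemma PB_const: "PB k (\<lambda>_. b)"
  unfolding PB_def by (rule PF_const)

lemma PB_If: "PB k P \<Longrightarrow> PB k Q \<Longrightarrow> PB k R \<Longrightarrow> PB k (\<lambda>a. if P a then Q a else R a)"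
  unfolding PB_def using PF_If[of k P "\<lambda>a. [Q a]" "\<lambda>a. [R a]"]
  by (auto simp: PB_def elim: PF_cong)

lemma PB_not: "PB k P \<Longrightarrow> PB k (\<lambda>a. \<not> P a)"
  by (rule PB_cong[OF PB_If[OF _ PB_const PB_const]]) auto

lemma PB_conj: "PB k P \<Longrightarrow> PB k Q \<Longrightarrow> PB k (\<lambda>a. P a \<and> Q a)"
  by (rule PB_cong[OF PB_If[OF _ _ PB_const[of k False], of P Q]]) auto

lemma PB_disj: "PB k P \<Longrightarrow> PB k Q \<Longrightarrow> PB k (\<lambda>a. P a \<or> Q a)"
  by (rule PB_cong[OF PB_If[OF _ PB_const[of k True], of P Q]]) auto

lemma PB_hd: "PF k f \<Longrightarrow> PB k (\<lambda>a. f a \<noteq> [] \<and> hd (f a))"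
  unfolding PB_def using PF_if[of k f "\<lambda>_. [True]" "\<lambda>_. [False]"] PF_const
  by (auto elim: PF_cong)

lemma PB_Nil:
  assumes "PF k f"
  shows "PB k (\<lambda>a. f a = [])"
proof -
  \<comment> \<open>One round already destroys the initial bit, so the iteration detects whether
    there is a round at all.\<close>
  have "((\<lambda>_. [False]) ^^ n) [True] = [n = 0]" for n by (cases n) auto
  then have "PF k (\<lambda>a. [length (f a) = 0])"
    using PF_iterate[of "\<lambda>_. [False]" 1 k f "\<lambda>_. [True]"] assms PF_const by simp
  then show ?thesis by (simp add: PB_def)
qed

lemma PB_length_le: "PF k f \<Longrightarrow> PF k g \<Longrightarrow> PB k (\<lambda>a. length (f a) \<le> length (g a))"
  using PB_Nil[OF PF_drop, of k g f] by simp

lemma PB_length_eq: "PF k f \<Longrightarrow> PF k g \<Longrightarrow> PB k (\<lambda>a. length (f a) = length (g a))"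
  unfolding eq_iff by (intro PB_conj PB_length_le)

lemma PF_unary_mult:
  assumes "PF k f" "PF k g"
  shows "PF k (\<lambda>a. unary (length (f a) * length (g a)))"
proof -
  have "PF k (\<lambda>a. concat (map (\<lambda>i. (\<lambda>a. unary (length (g (take k a)))) (a @ [unary i])) [0..<length (f a)]))"
    by (intro PF_concat_upt assms PF_unary PF_weaken) simp
  from PF_unary[OF this] show ?thesis
    by (rule PF_cong) (simp add: length_concat o_def sum_list_triv)
qed

text \<open>Horner's scheme, with concatenation as addition.\<close>

lemma PF_unary_poly:
  assumes "PF k f"
  shows "PF k (\<lambda>a. unary (poly p (length (f a))))"
proof (induction p)
  case 0
  then show ?case using PF_Nil by (simp add: unary_def)
next
  case (pCons c p)
  from PF_append[OF PF_const[of k "unary c"] PF_unary_mult[OF assms pCons.IH]]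
  show ?case by (simp add: unary_def replicate_add)
qed

section \<open>Comparing two rational numbers\<close>

definition bit_at :: "bool list \<Rightarrow> nat \<Rightarrow> bool" where
  "bit_at xs i \<longleftrightarrow> i < length xs \<and> xs ! i"

text \<open>The value of the lowest n bits of an infinite sequence. Together with
  \<open>bit_at\<close>, which pads with zeros, it treats operands of different lengths position by
  position.\<close>

primrec low :: "(nat \<Rightarrow> bool) \<Rightarrow> nat \<Rightarrow> nat" where
  "low f 0 = 0"
| "low f (Suc n) = low f n + of_bool (f n) * 2 ^ n"

definition val :: "bool list \<Rightarrow> nat" where
  "val xs = low (bit_at xs) (length xs)"

lemma low_cong: "(\<And>i. i < n \<Longrightarrow> f i = g i) \<Longrightarrow> low f n = low g n"
  by (induction n) auto

lemma low_less: "low f n < 2 ^ n"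
  by (induction n) (auto simp: of_bool_def)

lemma low_beyond: "length xs \<le> n \<Longrightarrow> low (bit_at xs) n = val xs"
  by (induction n) (auto simp: val_def bit_at_def le_Suc_eq)

lemma val_map: "val (map f [0..<n]) = low f n"
  unfolding val_def by (auto simp: bit_at_def intro: low_cong)

lemma low_shift: "low f (Suc n) = of_bool (f 0) + 2 * low (\<lambda>i. f (Suc i)) n"
  by (induction n) (auto simp: algebra_simps)

lemma val_Nil [simp]: "val [] = 0"
  by (simp add: val_def)

lemma val_Cons [simp]: "val (b # xs) = of_bool b + 2 * val xs"
proof -
  have "val (b # xs) = of_bool b + 2 * low (\<lambda>i. bit_at (b # xs) (Suc i)) (length xs)"
    unfolding val_def list.size add_0_right add_Suc_right low_shift by (simp add: bit_at_def)
  also have "(\<lambda>i. bit_at (b # xs) (Suc i)) = bit_at xs" by (auto simp: bit_at_def)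
  finally show ?thesis by (simp add: val_def)
qed

lemma val_bits_of [simp]: "val (bits_of n) = n"
proof (induction n rule: less_induct)
  case (less n)
  show ?case
  proof (cases "n = 0")
    case True
    then show ?thesis by (simp add: bits_of.simps)
  next
    case False
    then have "bits_of n = odd n # bits_of (n div 2)" by (simp add: bits_of.simps[of n])
    with less.IH[of "n div 2"] False show ?thesis by (cases "even n") simp_all
  qed
qed

primrec carry :: "bool list \<Rightarrow> bool list \<Rightarrow> nat \<Rightarrow> bool" where
  "carry xs ys 0 \<longleftrightarrow> False"
| "carry xs ys (Suc i) \<longleftrightarrow>
     (if bit_at xs i then bit_at ys i \<or> carry xs ys i else bit_at ys i \<and> carry xs ys i)"

definition add_bits :: "bool list \<Rightarrow> bool list \<Rightarrow> bool list" where
  "add_bits xs ys = map (\<lambda>i. bit_at xs i \<noteq> (bit_at ys i \<noteq> carry xs ys i))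
     [0..<Suc (length xs + length ys)]"

lemma val_add_bits: "val (add_bits xs ys) = val xs + val ys"
proof -
  let ?s = "\<lambda>i. bit_at xs i \<noteq> (bit_at ys i \<noteq> carry xs ys i)"
  let ?n = "Suc (length xs + length ys)"
  \<comment> \<open>The invariant of ripple-carry addition: the sum bits so far, with the carry at
    position n, represent the sum of the truncated operands.\<close>
  have inv: "low ?s n + of_bool (carry xs ys n) * 2 ^ n = low (bit_at xs) n + low (bit_at ys) n" for n
    by (induction n) (auto simp: of_bool_def split: if_splits)
  have "low (bit_at xs) ?n = val xs" "low (bit_at ys) ?n = val ys" by (rule low_beyond; simp)+
  \<comment> \<open>Both operands lie below 2 to the sum of their lengths, so one more position
    absorbs the sum and no carry remains.\<close>
  moreover have "val xs < 2 ^ (length xs + length ys)" "val ys < 2 ^ (length xs + length ys)"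
    unfolding val_def by (rule less_le_trans[OF low_less]; simp)+
  ultimately have "\<not> carry xs ys ?n"
    using inv[of ?n] by (cases "carry xs ys ?n") (simp_all del: low.simps carry.simps)
  then show ?thesis
    using inv[of ?n] unfolding add_bits_def val_map
    by (simp add: \<open>low (bit_at xs) ?n = val xs\<close> \<open>low (bit_at ys) ?n = val ys\<close> del: low.simps carry.simps)
qed

primrec le_low :: "bool list \<Rightarrow> bool list \<Rightarrow> nat \<Rightarrow> bool" where
  "le_low xs ys 0 \<longleftrightarrow> True"
| "le_low xs ys (Suc i) \<longleftrightarrow> (if bit_at xs i then bit_at ys i \<and> le_low xs ys i else bit_at ys i \<or> le_low xs ys i)"

text \<open>The recursion goes upwards, so the bit treated last is the most significant one: it
  decides if the operands differ there, as lower bits contribute less than \<open>2 ^ n\<close>;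
  otherwise the earlier comparison stands.\<close>

lemma le_low_iff: "le_low xs ys n \<longleftrightarrow> low (bit_at xs) n \<le> low (bit_at ys) n"
proof (induction n)
  case (Suc n)
  then show ?case
    using low_less[of "bit_at xs" n] low_less[of "bit_at ys" n] by (auto simp: of_bool_def)
qed simp

definition le_bits :: "bool list \<Rightarrow> bool list \<Rightarrow> bool" where
  "le_bits xs ys = le_low xs ys (length (xs @ ys))"

lemma le_bits_iff: "le_bits xs ys \<longleftrightarrow> val xs \<le> val ys"
  by (simp add: le_bits_def le_low_iff low_beyond)

lemma PB_bit_at: "PF k f \<Longrightarrow> PF k g \<Longrightarrow> PB k (\<lambda>a. bit_at (f a) (length (g a)))"
  by (rule PB_cong[OF PB_hd[OF PF_drop[of k g f]]]) (auto simp: bit_at_def hd_drop_conv_nth)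

lemma unary_snoc: "unary n @ [True] = unary (Suc n)"
  by (simp add: unary_def replicate_append_same)

text \<open>Primitive recursion with truth values. The accumulator is a single bit, so the length
  bound demanded by \<open>PF_pfold\<close> is the constant 1.\<close>

lemma PB_nat_rec:
  assumes rec: "\<And>a n. P a (Suc n) \<longleftrightarrow> S a n (P a n)" and base: "\<And>a. P a 0 \<longleftrightarrow> b0"
    and S: "PB (k + 2) (\<lambda>a. S (take k a) (length (a ! k)) (a ! Suc k \<noteq> [] \<and> hd (a ! Suc k)))"
    and f: "PF k f"
  shows "PB k (\<lambda>a. P a (length (f a)))"
proof -
  let ?H = "\<lambda>a b pre acc. [S a (length pre) (acc \<noteq> [] \<and> hd acc)]"
  let ?h = "\<lambda>a. [S (take k a) (length (a ! k)) (a ! Suc k \<noteq> [] \<and> hd (a ! Suc k))]"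
  have fold: "pfold (?H a) [] (unary n) [b0] = [P a n]" for a n
  proof (induction n)
    case (Suc n)
    then show ?case unfolding unary_snoc[symmetric] pfold_append by (simp add: rec)
  qed (simp add: unary_def base)
  have "PF k (\<lambda>a. pfold (?H a) [] (unary (length (f a))) ((\<lambda>_. [b0]) a))"
  proof (rule PF_pfold[where ?h1.0 = ?h and ?h0.0 = ?h and qA = 1])
    show "PF k (\<lambda>a. unary (length (f a)))" using f by (rule PF_unary)
    show "PF (k + 2) ?h" "PF (k + 2) ?h" using S by (simp_all add: PB_def)
    fix a :: "bool list list" assume "length a = k"
    then show "?H a b pre acc = (if b then ?h else ?h) (a @ [pre, acc])" for b :: bool and pre acc
      by (auto simp: nth_append)
    show "length (pfold (?H a) [] ys [b0]) \<le> poly 1 (sz a)" for ys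
      by (cases ys rule: rev_cases) (auto simp: pfold_append)
  qed (rule PF_const)
  then show ?thesis by (simp add: fold PB_def)
qed

lemma PB_carry:
  assumes "PF k f" "PF k g" "PF k h"
  shows "PB k (\<lambda>a. carry (f a) (g a) (length (h a)))"
proof (rule PB_nat_rec[where P = "\<lambda>a. carry (f a) (g a)" and ?b0.0 = False])
  show "PB (k + 2) (\<lambda>a. (\<lambda>a i c. if bit_at (f a) i then bit_at (g a) i \<or> c else bit_at (g a) i \<and> c)
      (take k a) (length (a ! k)) (a ! Suc k \<noteq> [] \<and> hd (a ! Suc k)))"
    by (intro PB_If PB_disj PB_conj PB_hd PB_bit_at PF_nth PF_weaken[OF assms(1)] PF_weaken[OF assms(2)] assms) simp_all
qed (use assms in simp_all)

lemma PB_le_low: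
  assumes "PF k f" "PF k g" "PF k h"
  shows "PB k (\<lambda>a. le_low (f a) (g a) (length (h a)))"
proof (rule PB_nat_rec[where P = "\<lambda>a. le_low (f a) (g a)" and ?b0.0 = True])
  show "PB (k + 2) (\<lambda>a. (\<lambda>a i c. if bit_at (f a) i then bit_at (g a) i \<and> c else bit_at (g a) i \<or> c)
      (take k a) (length (a ! k)) (a ! Suc k \<noteq> [] \<and> hd (a ! Suc k)))"
    by (intro PB_If PB_disj PB_conj PB_hd PB_bit_at PF_nth PF_weaken[OF assms(1)] PF_weaken[OF assms(2)] assms) simp_all
qed (use assms in simp_all)

lemma PB_le_bits: "PF k f \<Longrightarrow> PF k g \<Longrightarrow> PB k (\<lambda>a. le_bits (f a) (g a))"
  unfolding le_bits_def by (intro PB_le_low PF_append)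

lemma PF_add_bits:
  assumes "PF k f" "PF k g"
  shows "PF k (\<lambda>a. add_bits (f a) (g a))"
proof -
  let ?G = "\<lambda>a. [bit_at (f (take k a)) (length (a ! k)) \<noteq>
    (bit_at (g (take k a)) (length (a ! k)) \<noteq> carry (f (take k a)) (g (take k a)) (length (a ! k)))]"
  have "PB (Suc k) (\<lambda>a. if bit_at (f (take k a)) (length (a ! k))
      then \<not> (if bit_at (g (take k a)) (length (a ! k))
        then \<not> carry (f (take k a)) (g (take k a)) (length (a ! k))
        else carry (f (take k a)) (g (take k a)) (length (a ! k)))
      else (if bit_at (g (take k a)) (length (a ! k))
        then \<not> carry (f (take k a)) (g (take k a)) (length (a ! k))
        else carry (f (take k a)) (g (take k a)) (length (a ! k))))"
    by (intro PB_If PB_not PB_bit_at PB_carry PF_nth PF_weaken[OF assms(1)] PF_weaken[OF assms(2)] assms) simp_all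
  then have G: "PF (Suc k) ?G"
    unfolding PB_def by (rule PF_cong) auto
  have "PF k (\<lambda>a. concat (map (\<lambda>i. ?G (a @ [unary i])) [0..<length (True # f a @ g a)]))"
    by (intro PF_concat_upt G PF_Cons PF_append assms)
  then show ?thesis
    by (rule PF_cong) (simp add: add_bits_def concat_map_singleton nth_append del: upt_Suc)
qed

text \<open>Schoolbook multiplication from the most significant bit on; prefixing
  \<open>False\<close> doubles the accumulator. The addition pads generously, but a round lengthens
  the accumulator by at most the length of ys plus 2, which keeps it polynomial.\<close>

definition mult_bits :: "bool list \<Rightarrow> bool list \<Rightarrow> bool list" where
  "mult_bits xs ys =
     pfold (\<lambda>b pre acc. add_bits (False # acc) (if b then ys else [])) [] (rev xs) []"

lemma val_mult_bits: "val (mult_bits xs ys) = val xs * val ys"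
proof (induction xs)
  case (Cons b xs)
  then show ?case by (simp add: mult_bits_def pfold_append val_add_bits algebra_simps)
qed (simp add: mult_bits_def)

lemma length_add_bits [simp]: "length (add_bits xs ys) = Suc (length xs + length ys)"
  by (simp add: add_bits_def del: upt_Suc)

lemma PF_mult_bits:
  assumes "PF k f" "PF k g"
  shows "PF k (\<lambda>a. mult_bits (f a) (g a))"
proof -
  let ?H = "\<lambda>a b pre acc. add_bits (False # acc) (if b then g a else [])"
  obtain qf where qf: "\<And>a. length a = k \<Longrightarrow> length (f a) \<le> poly qf (sz a)"
    using assms(1) unfolding PF_def by blast
  obtain qg where qg: "\<And>a. length a = k \<Longrightarrow> length (g a) \<le> poly qg (sz a)"
    using assms(2) unfolding PF_def by blast
  have len: "length (pfold (?H a) pre ys acc) \<le> length acc + length ys * (length (g a) + 2)" for a pre ys acc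
  proof (induction ys arbitrary: pre acc)
    case (Cons b ys)
    from Cons.IH[of "b # pre" "?H a b pre acc"] show ?case by (cases b) simp_all
  qed simp
  have "PF k (\<lambda>a. pfold (?H a) [] (rev (f a)) ((\<lambda>_. []) a))"
  proof (rule PF_pfold[where ?h1.0 = "\<lambda>a. add_bits (False # a ! Suc k) (g (take k a))"
        and ?h0.0 = "\<lambda>a. add_bits (False # a ! Suc k) []" and qA = "qf * (qg + [:2:])"])
    show "PF (k + 2) (\<lambda>a. add_bits (False # a ! Suc k) (g (take k a)))"
      "PF (k + 2) (\<lambda>a. add_bits (False # a ! Suc k) [])"
      by (intro PF_add_bits PF_Cons PF_Nil PF_nth PF_weaken[OF assms(1)] PF_weaken[OF assms(2)] assms; simp)+
    fix a :: "bool list list" assume a: "length a = k"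
    then show "?H a b pre acc = (if b then \<lambda>a. add_bits (False # a ! Suc k) (g (take k a))
        else (\<lambda>a. add_bits (False # a ! Suc k) [])) (a @ [pre, acc])" for b pre acc
      by (auto simp: nth_append)
    show "length (pfold (?H a) [] ys []) \<le> poly (qf * (qg + [:2:])) (sz a)"
      if "ys @ zs = rev (f a)" for ys zs
    proof -
      have "length ys \<le> length (f a)" using arg_cong[OF that, of length] by simp
      then have "length ys * (length (g a) + 2) \<le> poly qf (sz a) * (poly qg (sz a) + 2)"
        using qf[OF a] qg[OF a] by (intro mult_mono add_mono) auto
      with len[of a "[]" ys "[]"] show ?thesis by simp
    qed
  qed (intro PF_rev PF_Nil assms)+
  then show ?thesis by (simp add: mult_bits_def)
qed

section \<open>Decoding numbers\<close>

definition skip_pair :: "bool list \<Rightarrow> bool list" where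
  "skip_pair r = (if r \<noteq> [] \<and> hd r then tl (tl r) else r)"

definition nat_bits :: "bool list \<Rightarrow> bool list" where
  "nat_bits y = concat (map (\<lambda>i. let r = (skip_pair ^^ i) y in
     if r \<noteq> [] \<and> hd r then [tl r \<noteq> [] \<and> hd (tl r)] else []) [0..<length y])"

definition after_nat :: "bool list \<Rightarrow> bool list" where
  "after_nat y = tl ((skip_pair ^^ length y) y)"

text \<open>The terminating \<open>False\<close> is a fixed point of \<open>skip_pair\<close>. Hence
  the number of pairs need not be known: iterating as often as the string is long ends at the
  terminator.\<close>

lemma skip_pairs:
  "(skip_pair ^^ i) (concat (map (\<lambda>b. [True, b]) bs) @ False # u)
    = concat (map (\<lambda>b. [True, b]) (drop i bs)) @ False # u"
proof (induction i)
  case (Suc i)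
  then show ?case
    by (cases "drop i bs") (auto simp: skip_pair_def drop_Suc tl_drop[symmetric])
qed simp

lemma length_enc_pairs: "length (concat (map (\<lambda>b. [True, b]) bs)) = 2 * length bs"
  by (induction bs) auto

lemma after_nat_enc [simp]: "after_nat (enc_nat n @ u) = u"
  unfolding after_nat_def enc_nat_def append_assoc append.simps skip_pairs
  by (simp add: length_enc_pairs)

lemma nat_bits_enc [simp]: "nat_bits (enc_nat n @ u) = bits_of n"
proof -
  let ?b = "bits_of n"
  let ?y = "concat (map (\<lambda>b. [True, b]) ?b) @ False # u"
  let ?g = "\<lambda>i. let r = (skip_pair ^^ i) ?y in
     if r \<noteq> [] \<and> hd r then [tl r \<noteq> [] \<and> hd (tl r)] else []"
  have "concat (map ?g [0..<m]) = take m ?b" for m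
  proof (induction m)
    case (Suc m)
    show ?case
    proof (cases "m < length ?b")
      case True
      then have "drop m ?b = ?b ! m # drop (Suc m) ?b" by (simp add: Cons_nth_drop_Suc)
      with Suc True show ?thesis by (simp add: skip_pairs take_Suc_conv_app_nth)
    qed (use Suc in \<open>simp add: skip_pairs\<close>)
  qed simp
  from this[of "length ?y"] show ?thesis
    by (simp add: nat_bits_def enc_nat_def length_enc_pairs del: upt_Suc)
qed

lemma PF_skip_pairs:
  assumes "PF k f" "PF k g"
  shows "PF k (\<lambda>a. (skip_pair ^^ length (f a)) (g a))"
proof (rule PF_iterate[where c = 0])
  show "PF 1 (\<lambda>a. skip_pair (a ! 0))"
    unfolding skip_pair_def by (intro PF_if PF_tl PF_nth) simp_all
  show "length (skip_pair x) \<le> length x + 0" for x by (auto simp: skip_pair_def)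
qed (use assms in auto)

lemma PF_after_nat: "PF k f \<Longrightarrow> PF k (\<lambda>a. after_nat (f a))"
  unfolding after_nat_def by (intro PF_tl PF_skip_pairs)

lemma PF_nat_bits:
  assumes "PF k f"
  shows "PF k (\<lambda>a. nat_bits (f a))"
proof -
  let ?r = "\<lambda>a. (skip_pair ^^ length (a ! k)) (f (take k a))"
  have "PF (Suc k) (\<lambda>a. if ?r a \<noteq> [] \<and> hd (?r a) then [tl (?r a) \<noteq> [] \<and> hd (tl (?r a))] else [])"
    by (intro PF_if PF_Nil PB_hd[unfolded PB_def] PF_tl PF_skip_pairs PF_nth PF_weaken[OF assms]) simp_all
  from PF_concat_upt[OF assms this]
  show ?thesis by (rule PF_cong) (auto simp: nat_bits_def Let_def nth_append cong: if_cong)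
qed

text \<open>The suffixes y1, y2 start at the sign bits of numerator and denominator of the first
  score, and y4, y5 at those of the second; the additional \<open>tl\<close> in y4 skips the list
  marker. The comparison is by cross-multiplication, and since denominators are positive only the
  signs of the numerators matter.\<close>

definition le_rats :: "bool list \<Rightarrow> bool" where
  "le_rats y =
     (let y1 = tl y; y2 = after_nat (tl y1); y4 = tl (after_nat (tl y2)); y5 = after_nat (tl y4);
        s1 = (y1 \<noteq> [] \<and> hd y1); s2 = (y4 \<noteq> [] \<and> hd y4);
        p = mult_bits (nat_bits (tl y1)) (nat_bits (tl y5));
        q = mult_bits (nat_bits (tl y4)) (nat_bits (tl y2))
      in if s1 then (if s2 then le_bits q p else True) else (if s2 then False else le_bits p q))"

lemma le_rats_enc: "le_rats (True # enc_rat a @ True # enc_rat b @ u) \<longleftrightarrow> a \<le> b"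
proof -
  obtain n d where a: "quotient_of a = (n, d)" by fastforce
  obtain m e where b: "quotient_of b = (m, e)" by fastforce
  have de: "d > 0" "e > 0" using quotient_of_denom_pos a b by auto
  have ab: "a = of_int n / of_int d" "b = of_int m / of_int e"
    using quotient_of_div a b by auto
  define n' m' d' e' where nat: "n' = nat \<bar>n\<bar>" "m' = nat \<bar>m\<bar>" "d' = nat \<bar>d\<bar>" "e' = nat \<bar>e\<bar>"
  have "a \<le> b \<longleftrightarrow> n * e \<le> m * d"
    using de unfolding ab by (simp add: divide_le_eq le_divide_eq field_simps flip: of_int_mult)
  also have "\<dots> \<longleftrightarrow> (if n < 0 then (if m < 0 then m' * d' \<le> n' * e' else True)
      else (if m < 0 then False else n' * e' \<le> m' * d'))"
  proof -
    have int: "d = int d'" "e = int e'" "n = (if n < 0 then - int n' else int n')"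
      "m = (if m < 0 then - int m' else int m')"
      using de by (auto simp: nat)
    \<comment> \<open>With different signs of n and m these settle the comparison; with equal signs
      the absolute values are compared, in reverse order if both are negative.\<close>
    have neg: "n * e < 0 \<longleftrightarrow> n < 0" "m * d < 0 \<longleftrightarrow> m < 0"
      using de by (simp_all add: mult_less_0_iff)
    show ?thesis
    proof (cases "n < 0"; cases "m < 0")
      assume nm: "n < 0" "m < 0"
      then have *: "n * e = - int (n' * e')" "m * d = - int (m' * d')" using int by simp_all
      show ?thesis unfolding * using nm by (simp only: if_True neg_le_iff_le of_nat_le_iff)
    next
      assume nm: "\<not> n < 0" "\<not> m < 0"
      then have *: "n * e = int (n' * e')" "m * d = int (m' * d')" using int by simp_all
      show ?thesis unfolding * using nm by (simp only: if_False of_nat_le_iff)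
    next
      assume nm: "n < 0" "\<not> m < 0"
      then have "n * e \<le> m * d" using neg by linarith
      with nm show ?thesis by (simp only: if_True if_False)
    next
      assume nm: "\<not> n < 0" "m < 0"
      then have "\<not> n * e \<le> m * d" using neg by linarith
      with nm show ?thesis by (simp only: if_True if_False)
    qed
  qed
  also have "\<dots> \<longleftrightarrow> le_rats (True # enc_rat a @ True # enc_rat b @ u)"
    by (simp add: le_rats_def enc_rat_def enc_int_def a b Let_def le_bits_iff val_mult_bits nat)
  finally show ?thesis ..
qed

lemma PB_le_rats:
  assumes "PF k f"
  shows "PB k (\<lambda>a. le_rats (f a))"
  unfolding le_rats_def Let_def
  by (intro PB_If PB_hd PB_le_bits PF_mult_bits PF_nat_bits PF_after_nat PF_tl assms PB_const)

section \<open>Oracle machines with a single query\<close>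

text \<open>The oracle reads its query from cell 0 to the right, whereas a stack grows to the left.
  So the query is written while moving right, and tape 1 is no stack meanwhile.\<close>

definition emit :: cmd where
  "emit = loop 2 (Act 1 (Some 2) 1) (Act 1 (Some 1) 1)"

definition written :: "bool list \<Rightarrow> tape" where
  "written xs = (fst (tape_of xs), int (length xs))"

lemma written_snoc: "write_move (written xs) (if b then 2 else 1) 1 = written (xs @ [b])"
  by (auto simp: written_def write_move_def tape_of_def fun_eq_iff nth_append)

lemma string_on_written: "string_on (written xs) = xs"
proof -
  have "(LEAST n. fst (written xs) (int n) \<notin> {1, 2}) = length xs"
    by (rule Least_equality) (auto simp: written_def tape_of_def not_less[symmetric] split: if_splits)
  then show ?thesis
    by (auto simp: string_on_def written_def tape_of_def intro!: nth_equalityI)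
qed

text \<open>A separate induction, because tape 1 lies outside the frame and \<open>runs_loop\<close>
  speaks about stacks only. Each bit takes 4 steps for the body and 2 for the loop.\<close>

lemma exec_emit:
  assumes "rep (- {1}) ts \<sigma>" "2 < length ts" "ts ! 1 = written ys"
  shows "\<exists>m ts'. m \<le> 6 * length (\<sigma> 2) + 1 \<and> exec emit ts m ts' \<and> length ts' = length ts \<and>
    rep (- {1}) ts' (\<sigma>(2 := [])) \<and> ts' ! 1 = written (ys @ \<sigma> 2)"
  using assms
proof (induction "\<sigma> 2" arbitrary: ts ys \<sigma>)
  case Nil
  have "read_head (ts ! 2) = 0"
    using rep_read_head[OF Nil(2), of 2] Nil by simp
  from exec_While_stop[OF this] show ?case
    using Nil fun_upd_idem[of \<sigma> 2 "[]"] by (intro exI[of _ 1] exI[of _ ts]) (auto simp: emit_def loop_def)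
next
  case (Cons b zs)
  let ?w = "if b then 2 else 1"
  let ?ts1 = "act (2, None, 1) ts"
  let ?ts2 = "act (1, Some ?w, 1) ?ts1"
  let ?\<sigma> = "\<sigma>(2 := zs)"
  have hd: "read_head (ts ! 2) = ?w"
    using rep_read_head[OF Cons(3), of 2] Cons(2)[symmetric] Cons(4) by simp
  have "exec (Seq (pop 2) (Act 1 (Some ?w) 1)) ts (1 + 1 + 1) ?ts2"
    unfolding pop_def by (rule exec_Seq[OF exec_Act exec_Act])
  then have "exec (if read_head (ts ! 2) = 2 then Seq (pop 2) (Act 1 (Some 2) 1)
      else Seq (pop 2) (Act 1 (Some 1) 1)) ts 3 ?ts2"
    unfolding hd by (cases b) (simp_all add: numeral_3_eq_3)
  from exec_If[OF this] have body: "exec (If 2 (Seq (pop 2) (Act 1 (Some 2) 1))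
      (Seq (pop 2) (Act 1 (Some 1) 1))) ts 4 ?ts2" by simp
  have nth: "?ts2 ! v = (if v = 1 then written (ys @ [b]) else if v = 2 then write_move (ts ! 2) (read_head (ts ! 2)) 1 else ts ! v)"
    if "v < length ts" for v
    using that Cons(4,5) by (auto simp: act_def nth_list_update written_snoc)
  have "rep (- {1}) ?ts2 ?\<sigma>"
    unfolding rep_def
  proof (intro allI impI)
    fix v assume v: "v < length ?ts2" "v \<in> - {1}"
    have "stack_on (ts ! v) (\<sigma> v)" using Cons(3) v by (simp add: rep_def)
    then show "stack_on (?ts2 ! v) (?\<sigma> v)"
      using nth[of v] v stack_on_pop[of "ts ! 2" "\<sigma> 2"] Cons(2)[symmetric] by auto
  qed
  moreover have "?ts2 ! 1 = written (ys @ [b])" using nth[of 1] Cons(4) by simp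
  ultimately obtain m ts' where IH: "m \<le> 6 * length zs + 1" "exec emit ?ts2 m ts'"
    "length ts' = length ?ts2" "rep (- {1}) ts' (?\<sigma>(2 := []))" "ts' ! 1 = written ((ys @ [b]) @ zs)"
    using Cons(1)[of ?\<sigma> ?ts2 "ys @ [b]"] Cons(4) by auto
  have "exec emit ts (4 + m + 2) ts'"
    using exec_While_step[OF _ body] IH(2) hd unfolding emit_def loop_def by simp
  then show ?case
    using IH Cons(2)[symmetric] by (intro exI[of _ "4 + m + 2"] exI[of _ ts']) auto
qed

lemma vars_emit [simp]: "vars emit = {1, 2}" "ok_cmd emit"
  by (auto simp: emit_def)

section \<open>Acceptance by deterministic machines\<close>

lemma relpowp_det:
  assumes "\<And>x y z. R x y \<Longrightarrow> R x z \<Longrightarrow> y = z" "(R ^^ n) s c" "(R ^^ (n + k)) s e"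
  shows "(R ^^ k) c e"
  using assms(2,3)
proof (induction n arbitrary: s)
  case (Suc n)
  obtain s1 where s1: "R s s1" "(R ^^ n) s1 c" using Suc.prems(1) by (rule relpowp_Suc_E2)
  have "(R ^^ Suc (n + k)) s e" using Suc.prems(2) by simp
  then obtain s2 where s2: "R s s2" "(R ^^ (n + k)) s2 e" by (rule relpowp_Suc_E2)
  have "s1 = s2" using assms(1) s1(1) s2(1) by blast
  with Suc.IH s1 s2 show ?case by blast
qed simp

text \<open>For a deterministic machine a single halting run settles everything: every other run is
  an initial part of it. As accepting configurations have no successor, one can occur only at its
  end.\<close>

lemma decides_det:
  assumes det: "\<And>x y z. R x y \<Longrightarrow> R x z \<Longrightarrow> y = z" and acc: "\<And>x y. fst x = acc \<Longrightarrow> \<not> R x y"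
    and run: "\<And>x. \<exists>n e. n \<le> T (length x) \<and> (R ^^ n) (init x) e \<and> (\<forall>y. \<not> R e y) \<and> (fst e = acc \<longleftrightarrow> x \<in> L)"
  shows "decides_in R init acc T L"
  unfolding decides_in_def
proof (intro allI conjI impI)
  fix x
  obtain N e where e: "N \<le> T (length x)" "(R ^^ N) (init x) e" "\<And>y. \<not> R e y"
    "fst e = acc \<longleftrightarrow> x \<in> L"
    using run[of x] by blast
  have le: "n \<le> N" if "(R ^^ n) (init x) c" for n c
  proof (rule ccontr)
    assume "\<not> n \<le> N"
    then obtain k where "n = N + Suc k" by (metis less_imp_Suc_add not_le add_Suc_right)
    then have "(R ^^ Suc k) e c"
      using relpowp_det[of R N "init x" e "Suc k" c] det e(2) that by blast
    then obtain y where "R e y" by (rule relpowp_Suc_E2)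
    with e(3) show False by blast
  qed
  show "n \<le> T (length x)" if "(R ^^ n) (init x) c" for n c
    using le[OF that] e(1) by simp
  show "x \<in> L \<longleftrightarrow> (\<exists>c. R\<^sup>*\<^sup>* (init x) c \<and> fst c = acc)"
  proof
    assume "x \<in> L"
    with e show "\<exists>c. R\<^sup>*\<^sup>* (init x) c \<and> fst c = acc" using relpowp_imp_rtranclp by metis
  next
    assume "\<exists>c. R\<^sup>*\<^sup>* (init x) c \<and> fst c = acc"
    then obtain c n where c: "(R ^^ n) (init x) c" "fst c = acc"
      using rtranclp_imp_relpowp by metis
    obtain k where "N = n + k" using le[OF c(1)] le_Suc_ex by blast
    then have ce: "(R ^^ k) c e"
      using relpowp_det[of R n "init x" c k e] det c(1) e(2) by blast
    have "c = e"
    proof (cases k)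
      case (Suc j)
      then obtain c' where "R c c'" using ce relpowp_Suc_E2 by metis
      with acc[OF c(2)] show ?thesis by blast
    qed (use ce in simp)
    with c(2) e(4) show "x \<in> L" by simp
  qed
qed

text \<open>The Boolean tells whether the query has been answered. \<open>None\<close> is the
  accepting state, and \<open>Some (False, Skip)\<close> will be the query state.\<close>

definition phase_states :: "cmd \<Rightarrow> cmd \<Rightarrow> (bool \<times> cmd) option set" where
  "phase_states c1 c2 = insert None (Some ` (Pair False ` derivs c1 \<union> Pair True ` derivs c2))"

lemma finite_phase_states: "finite (phase_states c1 c2)"
  by (simp add: phase_states_def)

lemma phase_states_iff [simp]:
  "None \<in> phase_states c1 c2"
  "Some (ph, c) \<in> phase_states c1 c2 \<longleftrightarrow> c \<in> derivs (if ph then c2 else c1)"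
  by (auto simp: phase_states_def)

section \<open>Compiling two programs around one query\<close>

locale two_phase =
  fixes c1 c2 :: cmd and K :: nat and h :: "(bool \<times> cmd) option \<Rightarrow> nat"
  assumes ok: "ok_cmd c1" "ok_cmd c2"
    and vars: "vars c1 \<subseteq> {..<K}" "vars c2 \<subseteq> {..<K}" and K: "3 < K"
    and h: "bij_betw h (phase_states c1 c2) {..<card (phase_states c1 c2)}"
begin

abbreviation S :: "(bool \<times> cmd) option set" where
  "S \<equiv> phase_states c1 c2"

text \<open>Tapes other than v write back what they read and do not move. When the second program
  has ended, the symbol on tape 3 is the verdict. The end of the first program is the query state,
  where \<open>oracle_step\<close> bypasses \<open>delta\<close>.\<close>

definition control_step :: "bool \<Rightarrow> cmd \<Rightarrow> nat list \<Rightarrow> (nat \<times> nat list \<times> int list) set" where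
  "control_step ph c rs =
     (if c \<noteq> Skip then
        (case nxt c (\<lambda>i. rs ! i) of (c', v, w, d) \<Rightarrow>
          {(h (Some (ph, c')), rs[v := (case w of None \<Rightarrow> rs ! v | Some u \<Rightarrow> u)], (replicate K 0)[v := d])})
      else if ph \<and> rs ! 3 = 2 then {(h None, rs, replicate K 0)} else {})"

definition M :: oracle_tm where
  "M = \<lparr>tapes = K, states = card S, symbols = 3, start = h (Some (False, c1)), accept = h None,
     delta = (\<lambda>n rs. case inv_into S h n of None \<Rightarrow> {} | Some (ph, c) \<Rightarrow> control_step ph c rs),
     query = h (Some (False, Skip)), answer = h (Some (True, c2))\<rparr>"

lemma M_simps [simp]:
  "tapes M = K" "states M = card S" "symbols M = 3" "start M = h (Some (False, c1))"
  "accept M = h None" "query M = h (Some (False, Skip))" "answer M = h (Some (True, c2))"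
  by (simp_all add: M_def)

lemma h_less: "s \<in> S \<Longrightarrow> h s < card S"
  using h bij_betwE by blast

lemma h_inj: "s \<in> S \<Longrightarrow> t \<in> S \<Longrightarrow> h s = h t \<longleftrightarrow> s = t"
  using h unfolding bij_betw_def by (metis inj_on_eq_iff)

lemma delta_M: "Some (ph, c) \<in> S \<Longrightarrow> delta M (h (Some (ph, c))) rs = control_step ph c rs"
  using h by (simp add: M_def bij_betw_def inv_into_f_f)

lemma delta_None: "delta M (h None) rs = {}"
  using h by (simp add: M_def bij_betw_def inv_into_f_f)

lemma S_ok: "Some (ph, c) \<in> S \<Longrightarrow> ok_cmd c \<and> vars c \<subseteq> {..<K}"
proof -
  assume "Some (ph, c) \<in> S"
  then obtain c0 where c0: "c \<in> derivs c0" "c0 = c1 \<or> c0 = c2" by (auto split: if_splits)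
  then have "ok_cmd c0" "vars c0 \<subseteq> {..<K}" using ok vars by auto
  with derivs_ok[OF c0(1)] derivs_vars[OF c0(1)] show ?thesis by blast
qed

lemma S_nxt: "Some (ph, c) \<in> S \<Longrightarrow> Some (ph, fst (nxt c r)) \<in> S"
  by (auto simp: nxt_in_derivs)

lemma control_step_ok:
  assumes "Some (ph, c) \<in> S" "length rs = K" "set rs \<subseteq> {..<3}" "(q', ws, ds) \<in> control_step ph c rs"
  shows "q' < card S \<and> length ws = K \<and> set ws \<subseteq> {..<3} \<and> length ds = K \<and> set ds \<subseteq> {-1, 0, 1}"
proof (cases "c = Skip")
  case True
  then show ?thesis using assms h_less[of None] by (auto simp: control_step_def split: if_splits)
next
  case False
  obtain c' v w d where n: "nxt c (\<lambda>i. rs ! i) = (c', v, w, d)" by (metis prod_cases4)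
  have *: "v < K" "w \<in> {None, Some 0, Some 1, Some 2}" "d \<in> {-1, 0, 1}"
    using nxt_ok[of c K "\<lambda>i. rs ! i"] S_ok[OF assms(1)] K n by auto
  have S': "Some (ph, c') \<in> S" using S_nxt[OF assms(1), of "\<lambda>i. rs ! i"] n by simp
  have u: "(case w of None \<Rightarrow> rs ! v | Some u \<Rightarrow> u) < 3"
    using *(1,2) assms(2,3) nth_mem[of v rs] by (auto simp del: nth_mem)
  have q: "q' = h (Some (ph, c'))" "ws = rs[v := (case w of None \<Rightarrow> rs ! v | Some u \<Rightarrow> u)]"
    "ds = (replicate K 0)[v := d]"
    using assms(4) n False by (auto simp: control_step_def)
  have "set ws \<subseteq> {..<3}"
    using set_update_subset_insert[of rs v] u assms(3) unfolding q by fastforce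
  moreover have "set ds \<subseteq> {-1, 0, 1}"
    using set_update_subset_insert[of "replicate K (0::int)" v d] *(3) unfolding q by (auto split: if_splits)
  ultimately show ?thesis using h_less[OF S'] q assms(2) by simp
qed

lemma wf: "wf_oracle_tm M"
proof -
  have *: "case x of (q', ws, ds) \<Rightarrow> q' < card S \<and> length ws = K \<and> set ws \<subseteq> {..<3} \<and>
      length ds = K \<and> set ds \<subseteq> {-1, 0, 1}"
    if q: "q < card S" "length rs = K" "set rs \<subseteq> {..<3}" "x \<in> delta M q rs" for q rs x
  proof -
    obtain s where s: "s \<in> S" "q = h s" using h q(1) unfolding bij_betw_def by blast
    show ?thesis
    proof (cases s)
      case None
      then show ?thesis using q s by (simp add: delta_None)
    next
      case (Some pc)
      obtain ph c where pc: "pc = (ph, c)" by (cases pc)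
      have "x \<in> control_step ph c rs" using q s Some pc delta_M by simp
      moreover obtain q' ws ds where "x = (q', ws, ds)" by (cases x)
      ultimately show ?thesis
        using control_step_ok[of ph c rs q' ws ds] s(1) Some pc q(2,3) by simp
    qed
  qed
  have "wf_tm M"
    unfolding wf_tm_def M_simps
    by (intro conjI allI impI ballI; (elim conjE)?; (rule *; assumption)?)
      (use K h_less[of None] h_less[of "Some (False, c1)"] in simp_all)
  then show ?thesis
    unfolding wf_oracle_tm_def M_simps
    using K h_less[of "Some (False, Skip)"] h_less[of "Some (True, c2)"] h_inj[of "Some (False, Skip)" None]
    by auto
qed

lemma control_step_det: "x \<in> control_step ph c rs \<Longrightarrow> y \<in> control_step ph c rs \<Longrightarrow> x = y"
  by (cases "nxt c (\<lambda>i. rs ! i)") (simp add: control_step_def split: if_splits)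

lemma det: "deterministic M"
  unfolding deterministic_def
proof (intro allI impI, elim conjE)
  fix q rs x y assume "x \<in> delta M q rs" "y \<in> delta M q rs"
  then show "x = y"
    by (cases "inv_into S h q") (auto simp: M_def intro: control_step_det)
qed

lemma oracle_step_det:
  assumes "oracle_step M g x y" "oracle_step M g x z"
  shows "y = z"
proof (cases "fst x = query M")
  case True
  with assms show ?thesis by (simp add: oracle_step_def)
next
  case False
  let ?app = "\<lambda>ws ds. map (\<lambda>(t, w, d). write_move t w d) (zip (snd x) (zip ws ds))"
  obtain ws ds where y: "(fst y, ws, ds) \<in> delta M (fst x) (map read_head (snd x))" "snd y = ?app ws ds"
    using assms(1) False unfolding oracle_step_def tm_step_def by auto
  obtain ws' ds' where z: "(fst z, ws', ds') \<in> delta M (fst x) (map read_head (snd x))" "snd z = ?app ws' ds'"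
    using assms(2) False unfolding oracle_step_def tm_step_def by auto
  have "(fst y, ws, ds) = (fst z, ws', ds')"
    using det y(1) z(1) unfolding deterministic_def by blast
  with y(2) z(2) show ?thesis by (simp add: prod_eq_iff)
qed

lemma no_step_accept: "fst x = h None \<Longrightarrow> \<not> oracle_step M g x y"
  using h_inj[of "Some (False, Skip)" None] by (auto simp: oracle_step_def tm_step_def)

lemma act_zip:
  assumes "length ts = K" "v < K"
  shows "map (\<lambda>(t, w, d). write_move t w d) (zip ts (zip
      ((map read_head ts)[v := (case w of None \<Rightarrow> map read_head ts ! v | Some u \<Rightarrow> u)])
      ((replicate K 0)[v := d]))) = act (v, w, d) ts"
  using assms
  by (intro nth_equalityI)
     (auto simp: act_def nth_list_update write_move_def read_head_def prod_eq_iff split: option.splits)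

lemma oracle_step_cstep:
  assumes "Some (ph, c) \<in> S" "length ts = K" "cstep (c, ts) (c', ts')"
  shows "oracle_step M g (h (Some (ph, c)), ts) (h (Some (ph, c')), ts')"
proof -
  have c: "c \<noteq> Skip" using assms(3) by (simp add: cstep_def)
  let ?r = "\<lambda>i. read_head (ts ! i)"
  obtain v w d where n: "nxt c ?r = (c', v, w, d)" and ts': "ts' = act (v, w, d) ts"
    using assms(3) by (cases "nxt c ?r") (auto simp: cstep_def next_conf_def Let_def)
  have v: "v < K"
    using nxt_ok[of c K ?r] S_ok[OF assms(1)] K n by auto
  have "map read_head ts ! i = read_head (ts ! i)" if "i \<in> vars c" for i
    using S_ok[OF assms(1)] assms(2) that by (auto intro!: nth_map)
  from nxt_cong[OF this] n have n': "nxt c (\<lambda>i. map read_head ts ! i) = (c', v, w, d)"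
    by simp
  \<comment> \<open>The only state of a program that coincides with the query state is
    \<open>Skip\<close> in the first phase, and the accepting state belongs to no program.\<close>
  have "h (Some (ph, c)) \<noteq> query M" "h (Some (ph, c)) \<noteq> accept M"
    using h_inj[OF assms(1), of None] h_inj[OF assms(1), of "Some (False, Skip)"] c by auto
  moreover have "(h (Some (ph, c')), (map read_head ts)[v := (case w of None \<Rightarrow> map read_head ts ! v | Some u \<Rightarrow> u)],
      (replicate K 0)[v := d]) \<in> delta M (h (Some (ph, c))) (map read_head ts)"
    unfolding delta_M[OF assms(1)] control_step_def using c n' by simp
  ultimately show ?thesis
    unfolding oracle_step_def tm_step_def fst_conv snd_conv ts' act_zip[OF assms(2) v, of w d, symmetric]
    by (simp only: if_False) blast
qed

lemma oracle_steps_exec: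
  assumes "Some (ph, c) \<in> S" "length ts = K" "(cstep ^^ n) (c, ts) (c', ts')"
  shows "(oracle_step M g ^^ n) (h (Some (ph, c)), ts) (h (Some (ph, c')), ts')"
  using assms
proof (induction n arbitrary: c ts)
  case (Suc n)
  obtain c1 ts1 where 1: "cstep (c, ts) (c1, ts1)" "(cstep ^^ n) (c1, ts1) (c', ts')"
    using Suc.prems(3) by (metis relpowp_Suc_E2 surj_pair)
  have "Some (ph, c1) \<in> S" "length ts1 = K"
    using 1(1) S_nxt[OF Suc.prems(1)] Suc.prems(2) by (auto simp: cstep_def next_conf_def Let_def)
  from Suc.IH[OF this 1(2)] oracle_step_cstep[OF Suc.prems(1,2) 1(1)]
  show ?case by (rule relpowp_Suc_I2[rotated])
qed simp

lemma oracle_step_query: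
  "oracle_step M g (h (Some (False, Skip)), ts) (h (Some (True, c2)), ts[1 := tape_of (g (string_on (ts ! 1)))])"
  by (simp add: oracle_step_def)

text \<open>The two extra steps are the query and the possible final step into the accepting state;
  a negative verdict leaves the machine stuck.\<close>

lemma run_two_phases:
  assumes "exec c1 (snd (init_config M x)) n1 ts1" "length ts1 = K"
    and "exec c2 (ts1[1 := tape_of (g (string_on (ts1 ! 1)))]) n2 ts2" "length ts2 = K"
  shows "\<exists>n e. n \<le> n1 + n2 + 2 \<and> (oracle_step M g ^^ n) (init_config M x) e \<and>
    (\<forall>y. \<not> oracle_step M g e y) \<and> (fst e = accept M \<longleftrightarrow> read_head (ts2 ! 3) = 2)"
proof -
  let ?R = "oracle_step M g"
  let ?ts = "ts1[1 := tape_of (g (string_on (ts1 ! 1)))]"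
  have S: "Some (False, c1) \<in> S" "Some (True, c2) \<in> S" "Some (True, Skip) \<in> S" "None \<in> S"
    "Some (False, Skip) \<in> S" by simp_all
  have "(?R ^^ n1) (init_config M x) (h (Some (False, Skip)), ts1)"
    using oracle_steps_exec[OF S(1)] assms(1) K by (simp add: exec_def init_config_def)
  then have "(?R ^^ Suc n1) (init_config M x) (h (Some (True, c2)), ?ts)"
    using oracle_step_query by (rule relpowp_Suc_I)
  moreover have "(?R ^^ n2) (h (Some (True, c2)), ?ts) (h (Some (True, Skip)), ts2)"
    using oracle_steps_exec[OF S(2)] assms(2,3) by (simp add: exec_def)
  ultimately have run: "(?R ^^ (Suc n1 + n2)) (init_config M x) (h (Some (True, Skip)), ts2)"
    unfolding relpowp_add by (rule relcomppI)
  let ?e = "(h (Some (True, Skip)), ts2)"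
  have ne: "h (Some (True, Skip)) \<noteq> h (Some (False, Skip))" "h (Some (True, Skip)) \<noteq> h None"
    using h_inj[OF S(3) S(5)] h_inj[OF S(3) S(4)] by auto
  have delta: "delta M (h (Some (True, Skip))) rs = (if rs ! 3 = 2 then {(h None, rs, replicate K 0)} else {})" for rs
    unfolding delta_M[OF S(3)] by (simp add: control_step_def)
  show ?thesis
  proof (cases "read_head (ts2 ! 3) = 2")
    case True
    have "?R ?e (h None, map (\<lambda>(t, w, d). write_move t w d) (zip ts2 (zip (map read_head ts2) (replicate K 0))))"
      using ne True K assms(4) by (simp add: oracle_step_def tm_step_def delta)
    with run have "(?R ^^ Suc (Suc n1 + n2)) (init_config M x)
        (h None, map (\<lambda>(t, w, d). write_move t w d) (zip ts2 (zip (map read_head ts2) (replicate K 0))))"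
      by (rule relpowp_Suc_I)
    then show ?thesis using True no_step_accept
      by (intro exI[of _ "Suc (Suc n1 + n2)"] exI[of _ "(h None, map (\<lambda>(t, w, d). write_move t w d)
          (zip ts2 (zip (map read_head ts2) (replicate K 0))))"]) simp
  next
    case False
    then have "\<not> ?R ?e y" for y
      using ne K assms(4) by (simp add: oracle_step_def tm_step_def delta)
    with run False ne show ?thesis by (intro exI[of _ "Suc n1 + n2"] exI[of _ ?e]) simp
  qed
qed

end

text \<open>From here on the reduction is given by a function f that produces the query and a test P
  of the answer, and machines are out of sight. The test is required to be correct for every
  solver.\<close>

lemma poly_turing_reducibleI:
  assumes "PF 1 (\<lambda>a. f (a ! 0))" "PB 1 (\<lambda>a. P (a ! 0))"
    and L: "\<And>g x. solves g R \<Longrightarrow> P (g (f x)) \<longleftrightarrow> x \<in> L"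
  shows "poly_turing_reducible L R"
proof -
  obtain qf where qf: "\<And>a. length a = 1 \<Longrightarrow> length (f (a ! 0)) \<le> poly qf (sz a)"
    "\<And>ls m. places 1 ls m \<Longrightarrow> \<exists>c. computes c ls m qf (\<lambda>a. f (a ! 0))"
    using assms(1) unfolding PF_def by blast
  \<comment> \<open>The answer reaches stack 2 by a single \<open>rev_move\<close>, hence reversed;
    the program for the test undoes this.\<close>
  have P: "PF 1 (\<lambda>a. [P (rev (a ! 0))])"
    using PF_app1[OF assms(2)[unfolded PB_def] PF_rev[OF PF_nth[of 0 1]]] by simp
  obtain qP where qP: "\<And>ls m. places 1 ls m \<Longrightarrow> \<exists>c. computes c ls m qP (\<lambda>a. [P (rev (a ! 0))])"
    using P unfolding PF_def by blast
  obtain cf where cf: "computes cf [0] 2 qf (\<lambda>a. f (a ! 0))"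
    using qf(2)[of "[0]" 2] by (auto simp: places_def)
  obtain cP where cP: "computes cP [2] 3 qP (\<lambda>a. [P (rev (a ! 0))])"
    using qP[of "[2]" 3] by (auto simp: places_def)
  define c1 where "c1 = Seq cf emit"
  define c2 where "c2 = Seq (rev_move 1 2) cP"
  define K where "K = Suc (Max (vars c1 \<union> vars c2 \<union> {3}))"
  have below_K: "vars c1 \<union> vars c2 \<union> {3} \<subseteq> {..<K}"
    unfolding K_def lessThan_Suc_atMost by (auto intro!: Max_ge)
  obtain h where h: "bij_betw h (phase_states c1 c2) {0..<card (phase_states c1 c2)}"
    using ex_bij_betw_finite_nat[OF finite_phase_states[of c1 c2]] by auto
  interpret two_phase c1 c2 K h
    using below_K h computesD[OF cf] computesD[OF cP]
    by unfold_locales (auto simp: c1_def c2_def atLeast0LessThan)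
  \<comment> \<open>The bound involves the solver only through the polynomial b that limits its
    answers, as the definition of reducibility demands.\<close>
  define T where "T b = qf + smult 6 qf + [:3:] + (smult 8 (pcompose b qf) + pcompose qP (pcompose b qf) + [:4:])"
    for b :: "nat poly"
  have "\<exists>n e. n \<le> poly (T b) (length x) \<and> (oracle_step M g ^^ n) (init_config M x) e \<and>
      (\<forall>y. \<not> oracle_step M g e y) \<and> (fst e = accept M \<longleftrightarrow> x \<in> L)"
    if g: "solves g R" "\<And>x. length (g x) \<le> poly b (length x)" for g b x
  proof -
    define ts0 where "ts0 = snd (init_config M x)"
    define \<sigma>0 :: store where "\<sigma>0 = (\<lambda>_. [])(0 := x)"
    define y where "y = g (f x)"
    have nth0: "ts0 ! v = tape_of (\<sigma>0 v)" if "v < K" for v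
      using that by (auto simp: ts0_def init_config_def \<sigma>0_def nth_Cons split: nat.splits)
    have ts0: "length ts0 = K"
      using K by (simp add: ts0_def init_config_def)
    have "ts0 ! 1 = tape_of []" using nth0[of 1] K by (simp add: \<sigma>0_def)
    then have ts0_1: "ts0 ! 1 = written []" by (simp add: written_def tape_of_def)
    have rep0: "rep (- {1}) ts0 \<sigma>0"
      using nth0 ts0 by (simp add: rep_def)
    have vars: "vars cf \<subseteq> - {1}" "vars cf \<subseteq> {..<length ts0}"
      using computesD(2)[OF cf] below_K ts0 by (auto simp: c1_def)
    have "runs cf \<sigma>0 (poly qf (length x)) (\<sigma>0(2 := f x))"
      using computesD(3)[OF cf, of \<sigma>0] by (simp add: clean_def \<sigma>0_def)
    from runsE[OF this vars rep0] obtain m1 ts1 where 1: "m1 \<le> poly qf (length x)"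
      "exec cf ts0 m1 ts1" "length ts1 = K" "rep (- {1}) ts1 (\<sigma>0(2 := f x))" "ts1 ! 1 = ts0 ! 1"
      using K ts0 by auto
    obtain m2 ts2 where 2: "m2 \<le> 6 * length (f x) + 1" "exec emit ts1 m2 ts2" "length ts2 = K"
      "rep (- {1}) ts2 \<sigma>0" "ts2 ! 1 = written (f x)"
      using exec_emit[OF 1(4), of "[]"] 1 K ts0_1 by (auto simp: \<sigma>0_def fun_upd_idem)
    have e1: "exec c1 ts0 (m1 + m2 + 1) ts2"
      unfolding c1_def by (rule exec_Seq[OF 1(2) 2(2)])
    define ts3 where "ts3 = ts2[1 := tape_of y]"
    have y: "y = g (string_on (ts2 ! 1))" unfolding 2(5) string_on_written y_def ..
    \<comment> \<open>The oracle leaves its answer with the head on cell 0, so tape 1 is a stack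
      again and the frame can include all tapes.\<close>
    have rep3: "rep UNIV ts3 (\<sigma>0(1 := y))"
      using 2(4) by (auto simp: rep_def ts3_def nth_list_update)
    let ?\<sigma> = "\<sigma>0(1 := y, 1 := [], 2 := rev ((\<sigma>0(1 := y)) 1) @ (\<sigma>0(1 := y)) 2)"
    have "runs (rev_move 1 2) (\<sigma>0(1 := y)) (8 * length ((\<sigma>0(1 := y)) 1) + 1) ?\<sigma>"
      by (rule runs_rev_move) simp
    moreover have "runs cP ?\<sigma> (poly qP (length y)) (?\<sigma>(3 := [P y]))"
      using computesD(3)[OF cP, of ?\<sigma>] by (simp add: clean_def \<sigma>0_def)
    ultimately have "runs c2 (\<sigma>0(1 := y)) ((8 * length ((\<sigma>0(1 := y)) 1) + 1) + poly qP (length y) + 1) (?\<sigma>(3 := [P y]))"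
      unfolding c2_def by (rule runs_Seq)
    moreover have "vars c2 \<subseteq> {..<length ts3}" using below_K 2(3) by (simp add: ts3_def)
    ultimately obtain m3 ts4 where "m3 \<le> (8 * length ((\<sigma>0(1 := y)) 1) + 1) + poly qP (length y) + 1"
      and 4: "exec c2 ts3 m3 ts4" "length ts4 = length ts3" "rep UNIV ts4 (?\<sigma>(3 := [P y]))"
      using runsE[OF _ subset_UNIV _ rep3] by blast
    then have m3: "m3 \<le> (8 * length y + 1) + poly qP (length y) + 1" by simp
    have len4: "length ts4 = K" using 4(2) 2(3) by (simp add: ts3_def)
    have "read_head (ts4 ! 3) = 2 \<longleftrightarrow> P y"
      using rep_read_head[OF 4(3), of 3] len4 K by simp
    also have "\<dots> \<longleftrightarrow> x \<in> L" unfolding y_def by (rule L[OF g(1)])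
    finally have acc: "read_head (ts4 ! 3) = 2 \<longleftrightarrow> x \<in> L" .
    have fx: "length (f x) \<le> poly qf (length x)" using qf(1)[of "[x]"] by simp
    then have ly: "length y \<le> poly (pcompose b qf) (length x)"
      using g(2)[of "f x"] poly_mono_nat[OF fx, of b] by (simp add: y_def poly_pcompose)
    have "(m1 + m2 + 1) + m3 + 2 \<le> poly (T b) (length x)"
      using 1(1) 2(1) m3 fx ly poly_mono_nat[OF ly, of qP] by (simp add: T_def poly_pcompose)
    with run_two_phases[of x "m1 + m2 + 1" ts2 g m3 ts4] e1 2(3) 4(1) len4 acc
    show ?thesis unfolding ts3_def y ts0_def by (meson order.trans)
  qed
  then have "decides_in (oracle_step M g) (init_config M) (accept M) (poly (T b)) L"
    if "solves g R" "\<And>x. length (g x) \<le> poly b (length x)" for g b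
    using that by (intro decides_det oracle_step_det) (auto simp: no_step_accept)
  with wf det show ?thesis
    unfolding poly_turing_reducible_def by blast
qed

section \<open>Instances with two judgments\<close>

text \<open>For distinct items, the edges not violated are those of a strict linear order:
  decreasing score, with ties in favour of the larger index.\<close>

definition viol :: "(nat \<Rightarrow> real) \<Rightarrow> nat \<Rightarrow> nat \<Rightarrow> bool" where
  "viol \<alpha> i j \<longleftrightarrow> i < j \<and> \<alpha> i \<le> \<alpha> j \<or> j < i \<and> \<alpha> i < \<alpha> j"

text \<open>A cycle of edges none of which is violated would be a cycle in a strict order. Only
  consecutive items are assumed distinct, so the case i = k, j = l is covered; it arises from
  vertices in conflict with themselves.\<close>

lemma viol_4_cycle:
  assumes "i \<noteq> j" "j \<noteq> k" "k \<noteq> l" "l \<noteq> i"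
  shows "viol \<alpha> i j \<or> viol \<alpha> j k \<or> viol \<alpha> k l \<or> viol \<alpha> l i"
proof (rule ccontr)
  assume neg: "\<not> ?thesis"
  have *: "\<alpha> b < \<alpha> a \<or> \<alpha> b = \<alpha> a \<and> b < a" if "\<not> viol \<alpha> a b" "a \<noteq> b" for a b
    using that by (auto simp: viol_def neq_iff)
  from *[of i j] *[of j k] *[of k l] *[of l i] neg assms show False by fastforce
qed

lemma conditional_risk_viol:
  "conditional_risk m \<mu> \<alpha> =
     (\<Sum>i\<in>{1..m}. \<Sum>j\<in>{1..m}. mean_judgment \<mu> i j * of_bool (viol \<alpha> i j))"
proof -
  let ?I = "{1..m} \<times> {1..m}"
  have *: "(\<Sum>(i, j) | i \<in> {1..m} \<and> j \<in> {1..m} \<and> P i j. f i j)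
      = (\<Sum>(i, j)\<in>?I. if P i j then f i j else (0::real))" for P f
    by (rule sum.mono_neutral_cong_left) (auto split: if_splits)
  have "conditional_risk m \<mu> \<alpha> = (\<Sum>(i, j)\<in>?I. mean_judgment \<mu> i j * of_bool (viol \<alpha> i j))"
    unfolding conditional_risk_def * sum.distrib[symmetric]
    by (rule sum.cong) (auto simp: viol_def)
  then show ?thesis unfolding sum.cartesian_product .
qed

definition two_judgments :: "('a \<Rightarrow> 'a \<Rightarrow> nat) \<Rightarrow> ('a \<Rightarrow> 'a \<Rightarrow> nat) \<Rightarrow> 'a list \<Rightarrow> risk_instance" where
  "two_judgments f g xs =
     [(1 / 2, map (\<lambda>u. map (\<lambda>v. of_nat (f u v)) xs) xs),
      (1 / 2, map (\<lambda>u. map (\<lambda>v. of_nat (g u v)) xs) xs)]"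

lemma mat_of_map:
  assumes "i \<in> {1..length xs}" "j \<in> {1..length xs}"
  shows "mat_of (length xs) (map (\<lambda>u. map (\<lambda>v. of_nat (f u v)) xs) xs) i j
    = real (f (xs ! (i - 1)) (xs ! (j - 1)))"
  using assms by (auto simp: mat_of_def)

lemma acyclic_no_path: "r O r = {} \<Longrightarrow> acyclic r"
  unfolding acyclic_def
proof (intro allI notI)
  fix x assume r: "r O r = {}" and x: "(x, x) \<in> r\<^sup>+"
  obtain y where "(x, y) \<in> r" using tranclD[OF x] by blast
  moreover obtain z where "(z, x) \<in> r" using tranclD2[OF x] by blast
  ultimately show False using r by blast
qed

text \<open>All edges lead from P to its complement, so no edge continues another one and there is
  no cycle.\<close>

lemma judgment_of_bipartite:
  assumes "\<And>u v. f u v > 0 \<Longrightarrow> P u \<and> \<not> P v"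
  shows "preference_judgment (length xs)
    (mat_of (length xs) (map (\<lambda>u. map (\<lambda>v. of_nat (f u v)) xs) xs))"
  unfolding preference_judgment_def
proof (intro conjI ballI acyclic_no_path)
  let ?m = "mat_of (length xs) (map (\<lambda>u. map (\<lambda>v. of_nat (f u v)) xs) xs)"
  fix i j assume "i \<in> {1..length xs}" "j \<in> {1..length xs}"
  then show "0 \<le> ?m i j" by (simp only: mat_of_map of_nat_0_le_iff)
next
  let ?m = "mat_of (length xs) (map (\<lambda>u. map (\<lambda>v. of_nat (f u v)) xs) xs)"
  have *: "P (xs ! (i - 1)) \<and> \<not> P (xs ! (j - 1))"
    if "i \<in> {1..length xs}" "j \<in> {1..length xs}" "?m i j > 0" for i j
    using assms that(3) unfolding mat_of_map[OF that(1,2)] of_nat_0_less_iff .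
  show "{(i, j). i \<in> {1..length xs} \<and> j \<in> {1..length xs} \<and> ?m i j > 0} O
      {(i, j). i \<in> {1..length xs} \<and> j \<in> {1..length xs} \<and> ?m i j > 0} = {}"
    using * by blast
qed

lemma wf_two_judgments: "pmf_of_list_wf (weighted_judgments m (two_judgments f g xs))"
  by (rule pmf_of_list_wfI) (auto simp: weighted_judgments_def two_judgments_def of_rat_divide)

lemma valid_two_judgments:
  assumes "xs \<noteq> []" "\<And>u v. f u v > 0 \<Longrightarrow> P u \<and> \<not> P v" "\<And>u v. g u v > 0 \<Longrightarrow> \<not> P u \<and> P v"
  shows "valid_instance (length xs) (two_judgments f g xs)"
proof -
  have "preference_judgment (length xs)
    (mat_of (length xs) (map (\<lambda>u. map (\<lambda>v. of_nat (f u v)) xs) xs))"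
    using assms(2) by (rule judgment_of_bipartite)
  moreover have "preference_judgment (length xs)
    (mat_of (length xs) (map (\<lambda>u. map (\<lambda>v. of_nat (g u v)) xs) xs))"
    by (rule judgment_of_bipartite[where P = "\<lambda>u. \<not> P u"]) (use assms(3) in auto)
  ultimately show ?thesis
    using assms(1) wf_two_judgments[of "length xs" f g xs]
    by (auto simp: valid_instance_def two_judgments_def Suc_le_eq)
qed

text \<open>A value may occur several times in the list, so its probability is the sum over its
  occurrences; exchanging the sums gives one term per entry.\<close>

lemma expectation_pmf_of_list:
  fixes f :: "'a \<Rightarrow> real"
  assumes "pmf_of_list_wf xs"
  shows "(LINT y|measure_pmf (pmf_of_list xs). f y) = (\<Sum>(y, p)\<leftarrow>xs. p * f y)"
proof -
  have sum: "(\<Sum>a\<in>A. f a * sum_list (map snd (filter (\<lambda>z. fst z = a) ys))) = (\<Sum>(y, p)\<leftarrow>ys. p * f y)"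
    if "finite A" "fst ` set ys \<subseteq> A" for A ys
    using that(2)
  proof (induction ys)
    case (Cons y ys)
    have "f a * sum_list (map snd (filter (\<lambda>z. fst z = a) (y # ys))) =
        (if fst y = a then snd y * f a else 0) + f a * sum_list (map snd (filter (\<lambda>z. fst z = a) ys))" for a
      by (simp add: algebra_simps)
    with Cons that(1) show ?case by (simp add: sum.distrib split: prod.splits)
  qed simp
  have "(LINT y|measure_pmf (pmf_of_list xs). f y)
      = (\<Sum>a\<in>fst ` set xs. f a * pmf (pmf_of_list xs) a)"
    by (rule integral_measure_pmf_real) (use set_pmf_of_list[OF assms] in auto)
  also have "\<dots> = (\<Sum>(y, p)\<leftarrow>xs. p * f y)"
    unfolding pmf_pmf_of_list[OF assms] by (rule sum) auto
  finally show ?thesis .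
qed

lemma risk_two_judgments:
  "conditional_risk (length xs) (judgment_measure (length xs) (two_judgments f g xs)) \<alpha> =
     real (\<Sum>i\<in>{1..length xs}. \<Sum>j\<in>{1..length xs}.
       of_bool (viol \<alpha> i j) * (f (xs ! (i - 1)) (xs ! (j - 1)) + g (xs ! (i - 1)) (xs ! (j - 1)))) / 2"
proof -
  have mean: "mean_judgment (judgment_measure (length xs) (two_judgments f g xs)) i j
      = real (f (xs ! (i - 1)) (xs ! (j - 1)) + g (xs ! (i - 1)) (xs ! (j - 1))) / 2"
    if "i \<in> {1..length xs}" "j \<in> {1..length xs}" for i j
    unfolding mean_judgment_def judgment_measure_def
    by (subst expectation_pmf_of_list[OF wf_two_judgments])
       (simp add: weighted_judgments_def two_judgments_def mat_of_map[OF that] of_rat_divide add_divide_distrib)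
  show ?thesis
    unfolding conditional_risk_viol sum_divide_distrib of_nat_sum
    by (intro sum.cong refl) (simp add: mean)
qed


section \<open>Independent sets\<close>

text \<open>
  As in the reduction of vertex cover to feedback arc set, a vertex is split into two items, and it
  belongs to the cover if the edge from \<open>(v, False)\<close> to \<open>(v, True)\<close> is violated.
\<close>

definition vertex_items :: "'v list \<Rightarrow> ('v \<times> bool) list" where
  "vertex_items vs = concat (map (\<lambda>v. [(v, False), (v, True)]) vs)"

definition vertex_weight :: "'v \<Rightarrow> 'v \<Rightarrow> nat" where
  "vertex_weight z v = (if v = z then 1 else 2)"

definition vertex_edge :: "'v \<Rightarrow> 'v \<times> bool \<Rightarrow> 'v \<times> bool \<Rightarrow> nat" where
  "vertex_edge z a b = (if fst a = fst b \<and> \<not> snd a \<and> snd b then vertex_weight z (fst a) else 0)"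

text \<open>For a symmetric conflict of u and v these edges close the vertex edges to the cycle
  \<open>(u, False)\<close>, \<open>(u, True)\<close>, \<open>(v, False)\<close>,
  \<open>(v, True)\<close>, so one of the four must be violated. Weight 2 is the largest vertex
  weight.\<close>

definition conflict_edge :: "('v \<Rightarrow> 'v \<Rightarrow> bool) \<Rightarrow> 'v \<times> bool \<Rightarrow> 'v \<times> bool \<Rightarrow> nat" where
  "conflict_edge C a b = (if C (fst a) (fst b) \<and> snd a \<and> \<not> snd b then 2 else 0)"

definition conflict_instance :: "'v list \<Rightarrow> ('v \<Rightarrow> 'v \<Rightarrow> bool) \<Rightarrow> 'v \<Rightarrow> risk_instance" where
  "conflict_instance vs C z = two_judgments (vertex_edge z) (conflict_edge C) (vertex_items vs)"

locale conflict_graph =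
  fixes vs :: "'v list" and C :: "'v \<Rightarrow> 'v \<Rightarrow> bool" and z :: 'v
  assumes distinct: "distinct vs" and z: "z \<in> set vs" and sym: "C u v \<Longrightarrow> C v u"
begin

abbreviation "weight \<equiv> vertex_weight z"
abbreviation "items \<equiv> vertex_items vs"
abbreviation "inst \<equiv> conflict_instance vs C z"

definition m :: nat where "m = length items"

definition idx :: "'v \<times> bool \<Rightarrow> nat" where
  "idx a = Suc (THE i. i < length items \<and> items ! i = a)"

lemma set_items: "set items = set vs \<times> UNIV"
  by (auto simp: vertex_items_def)

lemma distinct_items: "distinct items"
proof -
  have "distinct (concat (map (\<lambda>v. [(v, False), (v, True)]) ws))" if "distinct ws" for ws :: "'v list"
    using that by (induction ws) auto
  then show ?thesis using distinct by (simp add: vertex_items_def)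
qed

lemma idx:
  assumes "a \<in> set items"
  shows "idx a \<in> {1..m}" "items ! (idx a - 1) = a"
proof -
  have "\<exists>!i. i < length items \<and> items ! i = a"
    using assms distinct_items by (metis in_set_conv_nth nth_eq_iff_index_eq)
  from theI'[OF this] show "idx a \<in> {1..m}" "items ! (idx a - 1) = a"
    by (auto simp: idx_def m_def)
qed

lemma idx_eq: "i \<in> {1..m} \<Longrightarrow> idx (items ! (i - 1)) = i"
  using idx[of "items ! (i - 1)"] distinct_items
  by (auto simp: m_def nth_eq_iff_index_eq Suc_le_eq)

lemma valid: "valid_instance m inst"
proof -
  have "(z, True) \<in> set items" using z set_items by simp
  then have "items \<noteq> []" by auto
  then show ?thesis
    unfolding conflict_instance_def m_def
    by (rule valid_two_judgments[where P = "\<lambda>a. \<not> snd a"])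
       (auto simp: vertex_edge_def conflict_edge_def split: if_splits)
qed

definition bad :: "(nat \<Rightarrow> real) \<Rightarrow> 'v \<times> bool \<Rightarrow> 'v \<times> bool \<Rightarrow> bool" where
  "bad \<alpha> a b \<longleftrightarrow> viol \<alpha> (idx a) (idx b)"

text \<open>Every violated edge is charged to the vertex of its source.\<close>

definition cost :: "(nat \<Rightarrow> real) \<Rightarrow> 'v \<Rightarrow> nat" where
  "cost \<alpha> v = of_bool (bad \<alpha> (v, False) (v, True)) * weight v +
     (\<Sum>u\<in>set vs. of_bool (C v u \<and> bad \<alpha> (v, True) (u, False)) * 2)"

lemma risk: "conditional_risk m (judgment_measure m inst) \<alpha> = real (\<Sum>v\<in>set vs. cost \<alpha> v) / 2"
proof -
  have bij: "bij_betw (\<lambda>i. items ! (i - 1)) {1..m} (set vs \<times> UNIV)"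
    unfolding set_items[symmetric]
    by (rule bij_betw_byWitness[where f' = idx]) (use idx idx_eq in \<open>auto simp: m_def\<close>)
  have sum_items: "(\<Sum>i\<in>{1..m}. F i (items ! (i - 1))) =
      (\<Sum>v\<in>set vs. F (idx (v, False)) (v, False) + F (idx (v, True)) (v, True))" for F :: "nat \<Rightarrow> 'v \<times> bool \<Rightarrow> nat"
  proof -
    have "(\<Sum>i\<in>{1..m}. F i (items ! (i - 1))) = (\<Sum>i\<in>{1..m}. F (idx (items ! (i - 1))) (items ! (i - 1)))"
      by (rule sum.cong) (simp_all only: idx_eq)
    also have "\<dots> = (\<Sum>a\<in>set vs \<times> UNIV. F (idx a) a)"
      using sum.reindex_bij_betw[OF bij, of "\<lambda>a. F (idx a) a"] .
    also have "\<dots> = (\<Sum>v\<in>set vs. \<Sum>b\<in>UNIV. F (idx (v, b)) (v, b))"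
      by (simp add: sum.cartesian_product split_def)
    finally show ?thesis by (simp add: UNIV_bool)
  qed
  have "(\<Sum>i\<in>{1..m}. \<Sum>j\<in>{1..m}. of_bool (viol \<alpha> i j) *
      (vertex_edge z (items ! (i - 1)) (items ! (j - 1)) + conflict_edge C (items ! (i - 1)) (items ! (j - 1))))
    = (\<Sum>v\<in>set vs. cost \<alpha> v)"
    unfolding sum_items[of "\<lambda>j b. of_bool (viol \<alpha> i j) * (vertex_edge z (items ! (i - 1)) b +
        conflict_edge C (items ! (i - 1)) b)" for i]
      sum_items[of "\<lambda>i a. \<Sum>v\<in>set vs. of_bool (viol \<alpha> i (idx (v, False))) * (vertex_edge z a (v, False) +
        conflict_edge C a (v, False)) + of_bool (viol \<alpha> i (idx (v, True))) * (vertex_edge z a (v, True) +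
        conflict_edge C a (v, True))"]
  proof (rule sum.cong[OF refl])
    fix v assume v: "v \<in> set vs"
    have "(\<Sum>u\<in>set vs. of_bool (viol \<alpha> (idx (v, False)) (idx (u, True))) * (if v = u then weight v else 0))
        = of_bool (viol \<alpha> (idx (v, False)) (idx (v, True))) * weight v"
      using v by (subst sum.remove[OF _ v]) (auto intro: sum.neutral)
    moreover have "(\<Sum>u\<in>set vs. of_bool (viol \<alpha> (idx (v, True)) (idx (u, False))) * (if C v u then 2 else 0))
        = (\<Sum>u\<in>set vs. of_bool (C v u \<and> viol \<alpha> (idx (v, True)) (idx (u, False))) * (2::nat))"
      by (rule sum.cong) auto
    ultimately show "(\<Sum>u\<in>set vs. of_bool (viol \<alpha> (idx (v, False)) (idx (u, False))) * (vertex_edge z (v, False) (u, False) +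
          conflict_edge C (v, False) (u, False)) + of_bool (viol \<alpha> (idx (v, False)) (idx (u, True))) *
          (vertex_edge z (v, False) (u, True) + conflict_edge C (v, False) (u, True))) +
        (\<Sum>u\<in>set vs. of_bool (viol \<alpha> (idx (v, True)) (idx (u, False))) * (vertex_edge z (v, True) (u, False) +
          conflict_edge C (v, True) (u, False)) + of_bool (viol \<alpha> (idx (v, True)) (idx (u, True))) *
          (vertex_edge z (v, True) (u, True) + conflict_edge C (v, True) (u, True))) = cost \<alpha> v"
      by (simp add: vertex_edge_def conflict_edge_def cost_def bad_def v)
  qed
  then show ?thesis
    unfolding conflict_instance_def m_def risk_two_judgments by simp
qed

definition indep :: "'v set \<Rightarrow> bool" where
  "indep I \<longleftrightarrow> I \<subseteq> set vs \<and> (\<forall>u\<in>I. \<forall>v\<in>I. \<not> C u v)"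

text \<open>All vertices together weigh 2n - 1, because z alone has weight 1. So the weight of a
  cover depends only on the size of its complement and on whether z is in it.\<close>

lemma weight_indep:
  assumes "I \<subseteq> set vs"
  shows "(\<Sum>v\<in>set vs - I. weight v) + (2 * card I - of_bool (z \<in> I)) = 2 * length vs - 1"
proof -
  have w: "(\<Sum>v\<in>A. weight v) = 2 * card A - of_bool (z \<in> A)" if "A \<subseteq> set vs" for A
  proof (cases "z \<in> A")
    case True
    have "finite A" using that by (rule finite_subset) simp
    define B where "B = A - {z}"
    have "(\<Sum>v\<in>A. weight v) = 1 + (\<Sum>v\<in>B. weight v)" "card A = Suc (card B)"
      using \<open>finite A\<close> True card.remove[of A z] by (simp_all add: B_def sum.remove vertex_weight_def)
    moreover have "(\<Sum>v\<in>B. weight v) = (\<Sum>v\<in>B. 2)"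
      by (rule sum.cong) (auto simp: vertex_weight_def B_def)
    ultimately show ?thesis using True by simp
  next
    case False
    then have "(\<Sum>v\<in>A. weight v) = (\<Sum>v\<in>A. 2)"
      by (intro sum.cong) (auto simp: vertex_weight_def)
    with False show ?thesis by simp
  qed
  have "(\<Sum>v\<in>set vs - I. weight v) + (\<Sum>v\<in>I. weight v) = (\<Sum>v\<in>set vs. weight v)"
    using assms by (intro sum.subset_diff[symmetric]) auto
  then show ?thesis
    using w[OF assms] w[OF order.refl] z distinct by (simp add: distinct_card)
qed

lemma cost_of_indep:
  assumes "indep I"
  shows "\<exists>\<alpha>. (\<Sum>v\<in>set vs. cost \<alpha> v) = (\<Sum>v\<in>set vs - I. weight v)"
proof -
  \<comment> \<open>Members get 2 before 1, so their vertex edge holds; the others get 0 before 3,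
    so it is violated. A conflict edge leads from a score in {1, 3} to one in {0, 2} and is violated
    only as 1 < 2, between two members. None of these comparisons is a tie, so the order of the
    indices is irrelevant.\<close>
  define \<beta> where "\<beta> a = (if fst a \<in> I then if snd a then 1 else 2 else if snd a then 3 else 0 :: real)"
    for a :: "'v \<times> bool"
  define \<alpha> where "\<alpha> i = \<beta> (items ! (i - 1))" for i
  have \<alpha>: "\<alpha> (idx a) = \<beta> a" if "fst a \<in> set vs" for a
    using idx(2)[of a] that by (simp add: \<alpha>_def set_items mem_Times_iff)
  have bad: "bad \<alpha> a b \<longleftrightarrow> \<beta> a < \<beta> b" if "fst a \<in> set vs" "fst b \<in> set vs" "\<beta> a \<noteq> \<beta> b" for a b
    using that \<alpha>[of a] \<alpha>[of b] by (cases "idx a" "idx b" rule: linorder_cases) (auto simp: bad_def viol_def)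
  have "cost \<alpha> v = (if v \<in> I then 0 else weight v)" if v: "v \<in> set vs" for v
  proof -
    have "\<not> (C v u \<and> bad \<alpha> (v, True) (u, False))" if u: "u \<in> set vs" for u
    proof
      assume *: "C v u \<and> bad \<alpha> (v, True) (u, False)"
      then have "\<not> (v \<in> I \<and> u \<in> I)" using assms by (auto simp: indep_def)
      then have "\<beta> (v, True) > \<beta> (u, False)" by (auto simp: \<beta>_def)
      with * bad[of "(v, True)" "(u, False)"] u v show False by auto
    qed
    then have "(\<Sum>u\<in>set vs. of_bool (C v u \<and> bad \<alpha> (v, True) (u, False)) * 2) = (0::nat)"
      by (intro sum.neutral) auto
    moreover have "bad \<alpha> (v, False) (v, True) \<longleftrightarrow> v \<notin> I"
      using bad[of "(v, False)" "(v, True)"] v by (auto simp: \<beta>_def)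
    ultimately show ?thesis by (simp add: cost_def)
  qed
  then have "(\<Sum>v\<in>set vs. cost \<alpha> v) = (\<Sum>v\<in>set vs. if v \<in> I then 0 else weight v)"
    by (intro sum.cong) auto
  also have "\<dots> = (\<Sum>v\<in>set vs - I. weight v)"
    by (rule sum.mono_neutral_cong_right) auto
  finally show ?thesis by blast
qed

text \<open>
  A violated conflict edge costs as much as violating the vertex edge of its source, so every score
  vector pays for the complement of an independent set.
\<close>

lemma indep_of_cost:
  "\<exists>I. indep I \<and> (\<Sum>v\<in>set vs - I. weight v) \<le> (\<Sum>v\<in>set vs. cost \<alpha> v) \<and>
     (if bad \<alpha> (z, False) (z, True) then z \<notin> I
      else z \<notin> I \<longrightarrow> (\<Sum>v\<in>set vs - I. weight v) < (\<Sum>v\<in>set vs. cost \<alpha> v))"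
proof -
  \<comment> \<open>The cover: the sources of all violated edges.\<close>
  define S where "S = {v \<in> set vs. bad \<alpha> (v, False) (v, True) \<or> (\<exists>u\<in>set vs. C v u \<and> bad \<alpha> (v, True) (u, False))}"
  have idx_neq: "idx (u, True) \<noteq> idx (v, False)" if "u \<in> set vs" "v \<in> set vs" for u v
    using idx(2)[of "(u, True)"] idx(2)[of "(v, False)"] that by (auto simp: set_items)
  have indep: "indep (set vs - S)"
    unfolding indep_def
  proof (intro conjI ballI notI)
    fix u v assume uv: "u \<in> set vs - S" "v \<in> set vs - S" "C u v"
    then have "\<not> bad \<alpha> (u, False) (u, True)" "\<not> bad \<alpha> (u, True) (v, False)"
      "\<not> bad \<alpha> (v, False) (v, True)" "\<not> bad \<alpha> (v, True) (u, False)"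
      using sym by (auto simp: S_def)
    moreover have "idx (u, False) \<noteq> idx (u, True)" "idx (u, True) \<noteq> idx (v, False)"
      "idx (v, False) \<noteq> idx (v, True)" "idx (v, True) \<noteq> idx (u, False)"
      using idx_neq uv by (metis DiffD1)+
    ultimately show False using viol_4_cycle unfolding bad_def by blast
  qed auto
  have ge2: "2 \<le> cost \<alpha> v" if v: "v \<in> S" "\<not> bad \<alpha> (v, False) (v, True)" for v
  proof -
    obtain u where u: "u \<in> set vs" "C v u \<and> bad \<alpha> (v, True) (u, False)" using v by (auto simp: S_def)
    have "of_bool (C v u \<and> bad \<alpha> (v, True) (u, False)) * 2 \<le>
        (\<Sum>u\<in>set vs. of_bool (C v u \<and> bad \<alpha> (v, True) (u, False)) * (2::nat))"
      using u(1) by (intro member_le_sum) auto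
    with u(2) show ?thesis by (simp add: cost_def)
  qed
  have le: "weight v \<le> cost \<alpha> v" if "v \<in> S" for v
    using ge2[OF that] by (cases "bad \<alpha> (v, False) (v, True)") (auto simp: cost_def vertex_weight_def)
  have S: "set vs - (set vs - S) = S" "S \<subseteq> set vs" "finite S" by (auto simp: S_def)
  have "(\<Sum>v\<in>S. weight v) \<le> (\<Sum>v\<in>S. cost \<alpha> v)" by (rule sum_mono) (rule le)
  moreover have "(\<Sum>v\<in>S. cost \<alpha> v) \<le> (\<Sum>v\<in>set vs. cost \<alpha> v)"
    by (rule sum_mono2) (use S in auto)
  \<comment> \<open>If z is in the cover only because of a conflict edge, it pays at least 2 for its
    weight 1. A minimizer will not do this, so the vertex edge of z alone tells whether z is in the
    cover.\<close>
  moreover have "(\<Sum>v\<in>S. weight v) < (\<Sum>v\<in>S. cost \<alpha> v)" if "\<not> bad \<alpha> (z, False) (z, True)" "z \<in> S"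
  proof (rule sum_strict_mono_ex1[OF S(3)])
    show "\<exists>v\<in>S. weight v < cost \<alpha> v" using ge2[OF that(2,1)] that(2) by (auto simp: vertex_weight_def)
  qed (use le in auto)
  moreover have "z \<in> S" if "bad \<alpha> (z, False) (z, True)" using that z by (auto simp: S_def)
  ultimately show ?thesis
    using indep z by (intro exI[of _ "set vs - S"]) (auto simp: S)
qed

text \<open>Larger independent sets have cheaper complements by 2 per member, so a minimizer yields
  one of size P; among those, avoiding z saves 1. The set Z guarantees that size P is attained in
  any case.\<close>

lemma minimizer_reveals:
  assumes le: "\<And>I. indep I \<Longrightarrow> card I \<le> P" and Z: "indep Z" "card Z = P" "z \<in> Z"
    and min: "\<And>\<beta>. conditional_risk m (judgment_measure m inst) \<alpha> \<le> conditional_risk m (judgment_measure m inst) \<beta>"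
  shows "viol \<alpha> (idx (z, False)) (idx (z, True)) \<longleftrightarrow> (\<exists>I. indep I \<and> card I = P \<and> z \<notin> I)"
proof -
  let ?c = "\<Sum>v\<in>set vs. cost \<alpha> v"
  have min': "?c \<le> (\<Sum>v\<in>set vs - I. weight v)" if I: "indep I" for I
  proof -
    obtain \<beta> where "(\<Sum>v\<in>set vs. cost \<beta> v) = (\<Sum>v\<in>set vs - I. weight v)"
      using cost_of_indep[OF I] by blast
    with min[of \<beta>] show ?thesis unfolding risk by (simp del: of_nat_sum)
  qed
  obtain I where I: "indep I" "(\<Sum>v\<in>set vs - I. weight v) \<le> ?c"
    "if bad \<alpha> (z, False) (z, True) then z \<notin> I else z \<notin> I \<longrightarrow> (\<Sum>v\<in>set vs - I. weight v) < ?c"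
    using indep_of_cost by blast
  have wt: "(\<Sum>v\<in>set vs - J. weight v) + (2 * card J - of_bool (z \<in> J)) = 2 * length vs - 1"
    if "indep J" for J using that weight_indep by (auto simp: indep_def)
  have "finite Z" using Z(1) finite_subset[of Z "set vs"] by (simp add: indep_def)
  with Z have pos: "P > 0" by (auto simp: card_gt_0_iff)
  show ?thesis unfolding bad_def[symmetric]
  proof
    assume "bad \<alpha> (z, False) (z, True)"
    with I(3) have zI: "z \<notin> I" by simp
    \<comment> \<open>Comparison with Z gives 2P - 1 \<le> 2 |I|, and parity does the rest.\<close>
    have "P \<le> card I"
      using wt[OF I(1)] wt[OF Z(1)] min'[OF Z(1)] I(2) Z zI pos by simp
    with le[OF I(1)] I(1) zI show "\<exists>I. indep I \<and> card I = P \<and> z \<notin> I" by (metis order.antisym)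
  next
    assume "\<exists>I. indep I \<and> card I = P \<and> z \<notin> I"
    then obtain J where J: "indep J" "card J = P" "z \<notin> J" by blast
    show "bad \<alpha> (z, False) (z, True)"
    proof (rule ccontr)
      assume "\<not> bad \<alpha> (z, False) (z, True)"
      then have *: "z \<notin> I \<longrightarrow> (\<Sum>v\<in>set vs - I. weight v) < ?c" using I(3) by simp
      \<comment> \<open>If z is in I, its presence costs 1 more than J, so I would need more than P
        members. If z is not in I, the strict inequality says the same.\<close>
      show False
        using * wt[OF I(1)] wt[OF J(1)] min'[OF J(1)] I(2) J le[OF I(1)] pos
        by (cases "z \<in> I") auto
    qed
  qed
qed

text \<open>Injectivity of the encoding ties the answer to this very instance. As z comes first, its
  edge leads from item 1 to item 2, and for increasing indices a tie counts as a violation; this is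
  why the test is \<open>\<le>\<close>.\<close>

lemma solution_reveals:
  assumes le: "\<And>I. indep I \<Longrightarrow> card I \<le> P" and Z: "indep Z" "card Z = P" "z \<in> Z"
    and hd: "vs \<noteq> []" "hd vs = z"
    and sol: "pairwise_risk_minimization (enc_instance inst) y"
  shows "le_rats y \<longleftrightarrow> (\<exists>I. indep I \<and> card I = P \<and> z \<notin> I)"
proof -
  obtain m' I as where s: "valid_instance m' I" "enc_instance inst = enc_instance I" "length as = m'"
    "y = enc_list enc_rat as"
    "is_arg_min (conditional_risk m' (judgment_measure m' I)) (\<lambda>_. True) (vec_of as)"
    using sol unfolding pairwise_risk_minimization_def by blast
  have I: "I = inst" using s(2) by (simp add: enc_instance_inject)
  have m': "m' = m"
    using s(1) unfolding I valid_instance_def by (simp add: conflict_instance_def two_judgments_def m_def)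
  obtain ws where vs: "vs = z # ws" using hd by (cases vs) auto
  have "concat (map (\<lambda>v. [(v, False), (v, True)]) vs)
      = (z, False) # (z, True) # concat (map (\<lambda>v. [(v, False), (v, True)]) ws)"
    by (simp add: vs)
  then have items: "items = (z, False) # (z, True) # concat (map (\<lambda>v. [(v, False), (v, True)]) ws)"
    unfolding vertex_items_def .
  then have m2: "2 \<le> m" by (simp add: m_def)
  have idx: "idx (z, False) = 1" "idx (z, True) = 2"
    using idx_eq[of 1] idx_eq[of 2] m2 by (simp_all add: items)
  obtain a b bs where as: "as = a # b # bs"
    using s(3) m' m2 by (cases as rule: list.exhaust; cases "tl as") auto
  have "le_rats y \<longleftrightarrow> a \<le> b"
    unfolding s(4) as enc_list_def by (simp add: le_rats_enc)
  also have "\<dots> \<longleftrightarrow> viol (vec_of as) (idx (z, False)) (idx (z, True))"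
    by (simp add: viol_def idx vec_of_def as of_rat_less_eq)
  also have "\<dots> \<longleftrightarrow> (\<exists>I. indep I \<and> card I = P \<and> z \<notin> I)"
    using s(5) by (intro minimizer_reveals[OF le Z]) (auto simp: is_arg_min_linorder I m')
  finally show ?thesis .
qed

end

section \<open>Computations as full independent sets\<close>

datatype rule = Rule (src: nat) (reads: "nat list") (tgt: nat) (writes: "nat list") (moves: "int list")

datatype cell = Cell (rule: rule) (syms: "nat list") (heads: "bool list")

definition input_symbol :: "bool list \<Rightarrow> nat \<Rightarrow> nat \<Rightarrow> nat" where
  "input_symbol x T s = fst (tape_of x) (int s - int T)"

locale bounded_ntm =
  fixes N :: tm and x :: "bool list" and T :: nat
  assumes wf: "wf_tm N"
begin

abbreviation "k \<equiv> tapes N"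

text \<open>An accepting configuration is repeated, so that all accepting computations have length \<open>T\<close>.\<close>

definition rules :: "rule set" where
  "rules = {r. src r < states N \<and> length (reads r) = k \<and> set (reads r) \<subseteq> {..<symbols N} \<and>
     (if src r = accept N then tgt r = src r \<and> writes r = reads r \<and> moves r = replicate k 0
      else (tgt r, writes r, moves r) \<in> delta N (src r) (reads r))}"

text \<open>
  The cell at time \<open>t\<close> and place \<open>s\<close> holds the symbols of all tapes at position \<open>s - T\<close>, the
  information which heads are there, and a copy of the rule applied at time \<open>t\<close>.
\<close>

definition cells :: "cell set" where
  "cells = {c. rule c \<in> rules \<and> length (syms c) = k \<and> set (syms c) \<subseteq> {..<symbols N} \<and>
     length (heads c) = k \<and> (\<forall>j<k. heads c ! j \<longrightarrow> syms c ! j = reads (rule c) ! j)}"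

definition init_clash :: "cell \<Rightarrow> nat \<Rightarrow> bool \<Rightarrow> bool" where
  "init_clash c b origin \<longleftrightarrow> src (rule c) \<noteq> start N \<or> syms c \<noteq> b # replicate (k - 1) 0 \<or>
     heads c \<noteq> replicate k origin"

text \<open>Conditions on pairs can forbid a second head in a row but cannot demand a first one. The
  existence of a head is passed on from row to row by \<open>move_clash\<close>, beginning with the
  initial row.\<close>

definition row_clash :: "cell \<Rightarrow> cell \<Rightarrow> bool" where
  "row_clash c c' \<longleftrightarrow> rule c \<noteq> rule c' \<or> (\<exists>j<k. heads c ! j \<and> heads c' ! j)"

definition step_clash :: "cell \<Rightarrow> cell \<Rightarrow> bool" where
  "step_clash c c' \<longleftrightarrow> tgt (rule c) \<noteq> src (rule c') \<or>
     (\<exists>j<k. syms c' ! j \<noteq> (if heads c ! j then writes (rule c) ! j else syms c ! j))"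

definition move_clash :: "int \<Rightarrow> cell \<Rightarrow> cell \<Rightarrow> bool" where
  "move_clash d c c' \<longleftrightarrow> (\<exists>j<k. heads c ! j \<and> moves (rule c) ! j = d \<and> \<not> heads c' ! j)"

text \<open>Conditions on a single cell, namely the initial row and acceptance in the last row, take
  the form of conflicts of a value with itself.\<close>

definition clash :: "nat \<Rightarrow> nat \<Rightarrow> cell \<Rightarrow> nat \<Rightarrow> nat \<Rightarrow> cell \<Rightarrow> bool" where
  "clash t s c t' s' c' \<longleftrightarrow>
     (t = t' \<and> s = s' \<and> (c \<noteq> c' \<or> t = 0 \<and> init_clash c (input_symbol x T s) (s = T) \<or>
        t = T \<and> src (rule c) \<noteq> accept N)) \<or>
     (t = t' \<and> s \<noteq> s' \<and> row_clash c c') \<or>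
     (t' = Suc t \<and> s' = s \<and> (step_clash c c' \<or> move_clash 0 c c')) \<or>
     (t' = Suc t \<and> s' = Suc s \<and> move_clash 1 c c') \<or>
     (t' = Suc t \<and> s = Suc s' \<and> move_clash (-1) c c')"

lemma delta_ok:
  assumes "q < states N" "length rs = k" "set rs \<subseteq> {..<symbols N}" "(q', ws, ds) \<in> delta N q rs"
  shows "q' < states N \<and> length ws = k \<and> set ws \<subseteq> {..<symbols N} \<and> length ds = k \<and> set ds \<subseteq> {-1, 0, 1}"
proof -
  have "\<forall>(q', ws, ds) \<in> delta N q rs. q' < states N \<and> length ws = k \<and> set ws \<subseteq> {..<symbols N} \<and>
      length ds = k \<and> set ds \<subseteq> {-1, 0, 1}"
    using wf assms(1-3) unfolding wf_tm_def by simp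
  from bspec[OF this assms(4)] show ?thesis by simp
qed

lemma rules_ok:
  assumes "r \<in> rules"
  shows "src r < states N" "length (reads r) = k" "set (reads r) \<subseteq> {..<symbols N}"
    "tgt r < states N" "length (writes r) = k" "set (writes r) \<subseteq> {..<symbols N}"
    "length (moves r) = k" "set (moves r) \<subseteq> {-1, 0, 1}"
proof -
  have *: "src r < states N" "length (reads r) = k" "set (reads r) \<subseteq> {..<symbols N}"
    using assms by (simp_all add: rules_def)
  then have "tgt r < states N \<and> length (writes r) = k \<and> set (writes r) \<subseteq> {..<symbols N} \<and>
      length (moves r) = k \<and> set (moves r) \<subseteq> {-1, 0, 1}"
    using assms delta_ok[OF *] by (cases "src r = accept N") (auto simp: rules_def)
  with * show "src r < states N" "length (reads r) = k" "set (reads r) \<subseteq> {..<symbols N}"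
    "tgt r < states N" "length (writes r) = k" "set (writes r) \<subseteq> {..<symbols N}"
    "length (moves r) = k" "set (moves r) \<subseteq> {-1, 0, 1}" by auto
qed

text \<open>Although \<open>delta\<close> is an arbitrary function, well-formedness confines its
  results to finite sets on arguments in range, and \<open>cells\<close> admits only such
  arguments.\<close>

lemma finite_cells: "finite cells"
proof -
  let ?Q = "{..<states N}"
  let ?A = "{xs. set xs \<subseteq> {..<symbols N} \<and> length xs = k}"
  let ?D = "{xs. set xs \<subseteq> {-1, 0, 1 :: int} \<and> length xs = k}"
  let ?B = "{xs. set xs \<subseteq> (UNIV :: bool set) \<and> length xs = k}"
  have "rules \<subseteq> (\<lambda>(q, rs, q', ws, ds). Rule q rs q' ws ds) ` (?Q \<times> ?A \<times> ?Q \<times> ?A \<times> ?D)"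
  proof
    fix r assume "r \<in> rules"
    with rules_ok[OF this] show "r \<in> (\<lambda>(q, rs, q', ws, ds). Rule q rs q' ws ds) ` (?Q \<times> ?A \<times> ?Q \<times> ?A \<times> ?D)"
      by (intro image_eqI[of _ _ "(src r, reads r, tgt r, writes r, moves r)"]) auto
  qed
  moreover have "finite (?Q \<times> ?A \<times> ?Q \<times> ?A \<times> ?D)"
    by (intro finite_cartesian_product finite_lists_length_eq) auto
  ultimately have "finite rules" by (meson finite_imageI finite_subset)
  have "cells \<subseteq> (\<lambda>(r, ss, hs). Cell r ss hs) ` (rules \<times> ?A \<times> ?B)"
  proof
    fix c assume "c \<in> cells"
    then show "c \<in> (\<lambda>(r, ss, hs). Cell r ss hs) ` (rules \<times> ?A \<times> ?B)"
      by (intro image_eqI[of _ _ "(rule c, syms c, heads c)"]) (auto simp: cells_def)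
  qed
  moreover have "finite (rules \<times> ?A \<times> ?B)"
    using \<open>finite rules\<close> by (intro finite_cartesian_product finite_lists_length_eq) auto
  ultimately show ?thesis by (meson finite_imageI finite_subset)
qed

definition moved :: "tape list \<Rightarrow> rule \<Rightarrow> tape list" where
  "moved ts r = map (\<lambda>(t, w, d). write_move t w d) (zip ts (zip (writes r) (moves r)))"

lemma nth_moved:
  assumes "r \<in> rules" "length ts = k" "j < k"
  shows "moved ts r ! j = write_move (ts ! j) (writes r ! j) (moves r ! j)"
  using rules_ok[OF assms(1)] assms by (simp add: moved_def)

lemma length_moved: "r \<in> rules \<Longrightarrow> length ts = k \<Longrightarrow> length (moved ts r) = k"
  using rules_ok by (simp add: moved_def)

lemma moved_stays:
  assumes "r \<in> rules" "src r = accept N" "map read_head ts = reads r" "length ts = k"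
  shows "moved ts r = ts"
proof (rule nth_equalityI)
  fix j assume "j < length (moved ts r)"
  then have j: "j < k" using length_moved[OF assms(1,4)] by simp
  have "writes r = map read_head ts" "moves r = replicate k 0"
    using assms(1,2) unfolding assms(3) by (simp_all add: rules_def)
  then have "writes r ! j = read_head (ts ! j)" "moves r ! j = 0"
    using assms(4) j by simp_all
  with nth_moved[OF assms(1,4) j] show "moved ts r ! j = ts ! j"
    by (simp add: write_move_def read_head_def)
qed (use length_moved assms in simp)

lemma step_of_rule:
  assumes "r \<in> rules" "src r \<noteq> accept N" "map read_head ts = reads r"
  shows "tm_step N (src r, ts) (tgt r, moved ts r)"
proof -
  have "(tgt r, writes r, moves r) \<in> delta N (src r) (map read_head ts)"
    using assms by (simp add: rules_def)
  then show ?thesis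
    unfolding tm_step_def moved_def fst_conv snd_conv
    using assms(2) by (intro conjI exI[of _ "writes r"] exI[of _ "moves r"]) simp_all
qed

definition table :: "(nat \<Rightarrow> nat \<Rightarrow> cell) \<Rightarrow> bool" where
  "table a \<longleftrightarrow> (\<forall>t\<le>T. \<forall>s\<le>2 * T. a t s \<in> cells) \<and>
     (\<forall>t\<le>T. \<forall>s\<le>2 * T. \<forall>t'\<le>T. \<forall>s'\<le>2 * T. \<not> clash t s (a t s) t' s' (a t' s'))"

lemma tables_pos: "1 \<le> k"
  using wf by (simp add: wf_tm_def)

text \<open>Row t is the window of radius T of a reachable configuration; the rules in the rows
  resolve the nondeterminism. Heads start at 0 and have moved at most t \<le> T places, so they stay
  in the window and the symbols they read are checked.\<close>

lemma accepting_of_table: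
  assumes "table a"
  shows "\<exists>c. (tm_step N)\<^sup>*\<^sup>* (init_config N x) c \<and> fst c = accept N"
proof -
  have cell: "a t s \<in> cells" if "t \<le> T" "s \<le> 2 * T" for t s
    using assms that by (simp add: table_def)
  have cl: "\<not> clash t s (a t s) t' s' (a t' s')" if "t \<le> T" "s \<le> 2 * T" "t' \<le> T" "s' \<le> 2 * T" for t s t' s'
    using assms that by (simp add: table_def)
  have "\<exists>ts. (tm_step N)\<^sup>*\<^sup>* (init_config N x) (src (rule (a t 0)), ts) \<and> length ts = k \<and>
      (\<forall>j<k. \<bar>snd (ts ! j)\<bar> \<le> int t \<and> (\<forall>s\<le>2 * T. syms (a t s) ! j = fst (ts ! j) (int s - int T) \<and>
        (heads (a t s) ! j \<longleftrightarrow> snd (ts ! j) = int s - int T)))" if "t \<le> T" for t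
    using that
  proof (induction t)
    case 0
    let ?ts = "tape_of x # replicate (k - 1) (tape_of [])"
    have i: "\<not> init_clash (a 0 s) (input_symbol x T s) (s = T)" if "s \<le> 2 * T" for s
      using cl[of 0 s 0 s] that by (auto simp: clash_def)
    have "init_config N x = (src (rule (a 0 0)), ?ts)"
      using i[of 0] by (simp add: init_config_def init_clash_def)
    then have "(tm_step N)\<^sup>*\<^sup>* (init_config N x) (src (rule (a 0 0)), ?ts)" by simp
    moreover have "length ?ts = k" using tables_pos by simp
    moreover have "\<bar>snd (?ts ! j)\<bar> \<le> int 0 \<and> (\<forall>s\<le>2 * T. syms (a 0 s) ! j = fst (?ts ! j) (int s - int T) \<and>
        (heads (a 0 s) ! j \<longleftrightarrow> snd (?ts ! j) = int s - int T))" if j: "j < k" for j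
    proof (intro conjI allI impI)
      have 0: "snd (?ts ! j) = 0" using j by (cases j) (simp_all add: tape_of_def)
      then show "\<bar>snd (?ts ! j)\<bar> \<le> int 0" by simp
      fix s assume s: "s \<le> 2 * T"
      show "syms (a 0 s) ! j = fst (?ts ! j) (int s - int T)"
        using i[OF s] j by (cases j) (auto simp: init_clash_def input_symbol_def tape_of_def)
      show "heads (a 0 s) ! j \<longleftrightarrow> snd (?ts ! j) = int s - int T"
        unfolding 0 using i[OF s] j by (simp add: init_clash_def)
    qed
    ultimately show ?case by blast
  next
    case (Suc t)
    then obtain ts where ts: "(tm_step N)\<^sup>*\<^sup>* (init_config N x) (src (rule (a t 0)), ts)" "length ts = k"
      and inv: "\<And>j. j < k \<Longrightarrow> \<bar>snd (ts ! j)\<bar> \<le> int t"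
        "\<And>j s. j < k \<Longrightarrow> s \<le> 2 * T \<Longrightarrow> syms (a t s) ! j = fst (ts ! j) (int s - int T)"
        "\<And>j s. j < k \<Longrightarrow> s \<le> 2 * T \<Longrightarrow> heads (a t s) ! j \<longleftrightarrow> snd (ts ! j) = int s - int T"
      by auto
    define r where "r = rule (a t 0)"
    have r: "r \<in> rules" using cell[of t 0] Suc.prems by (simp add: r_def cells_def)
    have rule: "rule (a t s) = r" if "s \<le> 2 * T" for s
      using cl[of t s t 0] Suc.prems that by (cases "s = 0") (auto simp: clash_def row_clash_def r_def)
    \<comment> \<open>The place that represents the tape position h.\<close>
    define pl where "pl h = nat (h + int T)" for h
    have pl: "pl h \<le> 2 * T" "int (pl h) - int T = h" if "\<bar>h\<bar> \<le> int T" for h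
      using that by (auto simp: pl_def)
    have hd: "\<bar>snd (ts ! j)\<bar> \<le> int T" if "j < k" for j
      using inv(1)[OF that] Suc.prems by simp
    \<comment> \<open>By the definition of \<open>cells\<close>, a cell carrying a head agrees with
      what the rule reads on that tape.\<close>
    have reads: "map read_head ts = reads r"
    proof (rule nth_equalityI)
      show "length (map read_head ts) = length (reads r)" using rules_ok(2)[OF r] ts by simp
      fix j assume "j < length (map read_head ts)"
      then have j: "j < k" using ts by simp
      note p = pl[OF hd[OF j]]
      have "heads (a t (pl (snd (ts ! j)))) ! j" using inv(3)[OF j p(1)] p(2) by simp
      then have "syms (a t (pl (snd (ts ! j)))) ! j = reads r ! j"
        using cell[OF _ p(1), of t] rule[OF p(1)] Suc.prems j by (auto simp: cells_def)
      then show "map read_head ts ! j = reads r ! j"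
        using inv(2)[OF j p(1)] p(2) j ts(2) by (simp add: read_head_def)
    qed
    let ?ts = "moved ts r"
    have "(tm_step N)\<^sup>*\<^sup>* (src r, ts) (tgt r, ?ts)"
    proof (cases "src r = accept N")
      case True
      then show ?thesis using moved_stays[OF r True reads ts(2)] r by (simp add: rules_def)
    next
      case False
      then show ?thesis using step_of_rule[OF r _ reads] by auto
    qed
    moreover have "src (rule (a (Suc t) 0)) = tgt r"
      using cl[of t 0 "Suc t" 0] Suc.prems by (auto simp: clash_def step_clash_def r_def)
    ultimately have "(tm_step N)\<^sup>*\<^sup>* (init_config N x) (src (rule (a (Suc t) 0)), ?ts)"
      using ts(1) by (auto simp: r_def)
    moreover have "\<bar>snd (?ts ! j)\<bar> \<le> int (Suc t) \<and>
        (\<forall>s\<le>2 * T. syms (a (Suc t) s) ! j = fst (?ts ! j) (int s - int T) \<and>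
        (heads (a (Suc t) s) ! j \<longleftrightarrow> snd (?ts ! j) = int s - int T))" if j: "j < k" for j
    proof (intro conjI allI impI)
      let ?h = "snd (ts ! j)" and ?d = "moves r ! j"
      have "?d \<in> set (moves r)" using rules_ok(7)[OF r] j by simp
      then have d: "?d \<in> {-1, 0, 1}" using rules_ok(8)[OF r] by blast
      have nth: "?ts ! j = write_move (ts ! j) (writes r ! j) ?d" by (rule nth_moved[OF r ts(2) j])
      have h': "snd (?ts ! j) = ?h + ?d" by (simp add: nth write_move_def)
      show le: "\<bar>snd (?ts ! j)\<bar> \<le> int (Suc t)" using inv(1)[OF j] d unfolding h' by auto
      have le': "\<bar>?h + ?d\<bar> \<le> int T" using le Suc.prems unfolding h' by simp
      note p = pl[OF hd[OF j]] and p' = pl[OF le']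
      have "heads (a t (pl ?h)) ! j" using inv(3)[OF j p(1)] p(2) by simp
      moreover have "\<not> move_clash ?d (a t (pl ?h)) (a (Suc t) (pl (?h + ?d)))"
      proof -
        have "pl (?h + ?d) = Suc (pl ?h) \<and> ?d = 1 \<or> pl (?h + ?d) = pl ?h \<and> ?d = 0 \<or>
            pl ?h = Suc (pl (?h + ?d)) \<and> ?d = -1"
          using d p(2) p'(2) by auto
        then show ?thesis
          using cl[of t "pl ?h" "Suc t" "pl (?h + ?d)"] p(1) p'(1) Suc.prems by (auto simp: clash_def)
      qed
      ultimately have head': "heads (a (Suc t) (pl (?h + ?d))) ! j"
        using rule[OF p(1)] j by (auto simp: move_clash_def)
      fix s assume s: "s \<le> 2 * T"
      have "\<not> step_clash (a t s) (a (Suc t) s)"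
        using cl[of t s "Suc t" s] s Suc.prems by (auto simp: clash_def)
      then have "syms (a (Suc t) s) ! j = (if heads (a t s) ! j then writes r ! j else syms (a t s) ! j)"
        using rule[OF s] j by (auto simp: step_clash_def)
      then show "syms (a (Suc t) s) ! j = fst (?ts ! j) (int s - int T)"
        using inv(2,3)[OF j s] by (simp add: nth write_move_def)
      \<comment> \<open>The head is present at the new place because there is no
        \<open>move_clash\<close>, and nowhere else because there is no
        \<open>row_clash\<close>.\<close>
      show "heads (a (Suc t) s) ! j \<longleftrightarrow> snd (?ts ! j) = int s - int T"
      proof
        assume h: "heads (a (Suc t) s) ! j"
        have "\<not> row_clash (a (Suc t) s) (a (Suc t) (pl (?h + ?d)))" if "s \<noteq> pl (?h + ?d)"
          using cl[of "Suc t" s "Suc t" "pl (?h + ?d)"] s p'(1) Suc.prems that by (auto simp: clash_def)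
        with h head' j have "s = pl (?h + ?d)" by (auto simp: row_clash_def)
        then show "snd (?ts ! j) = int s - int T" using p'(2) h' by simp
      next
        assume "snd (?ts ! j) = int s - int T"
        then have "s = pl (?h + ?d)" using h' p'(2) by (simp add: pl_def)
        with head' show "heads (a (Suc t) s) ! j" by simp
      qed
    qed
    ultimately show ?case using length_moved[OF r ts(2)] by blast
  qed
  from this[of T] obtain ts where "(tm_step N)\<^sup>*\<^sup>* (init_config N x) (src (rule (a T 0)), ts)" by auto
  moreover have "src (rule (a T 0)) = accept N"
    using cl[of T 0 T 0] by (auto simp: clash_def)
  ultimately show ?thesis by (metis fst_conv)
qed

text \<open>Keeps states and symbols in range; otherwise an applied transition would not be a member
  of \<open>rules\<close>.\<close>

definition good_config :: "config \<Rightarrow> bool" where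
  "good_config c \<longleftrightarrow> fst c < states N \<and> length (snd c) = k \<and> (\<forall>t \<in> set (snd c). \<forall>i. fst t i < symbols N)"

lemma good_init: "good_config (init_config N x)"
  using wf by (auto simp: good_config_def init_config_def wf_tm_def tape_of_def)

lemma rule_of_step:
  assumes "good_config c" "tm_step N c c'"
  shows "good_config c' \<and> (\<exists>r\<in>rules. src r = fst c \<and> reads r = map read_head (snd c) \<and>
    tgt r = fst c' \<and> snd c' = moved (snd c) r)"
proof -
  let ?rs = "map read_head (snd c)"
  obtain ws ds where 1: "fst c \<noteq> accept N" "(fst c', ws, ds) \<in> delta N (fst c) ?rs"
    "snd c' = map (\<lambda>(t, w, d). write_move t w d) (zip (snd c) (zip ws ds))"
    using assms(2) by (auto simp: tm_step_def)
  define r where "r = Rule (fst c) ?rs (fst c') ws ds"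
  have r: "r \<in> rules"
    using 1 assms(1) by (auto simp: rules_def r_def good_config_def read_head_def)
  have c': "snd c' = moved (snd c) r" by (simp add: 1 moved_def r_def)
  have len: "length (snd c) = k" using assms(1) by (simp add: good_config_def)
  have "fst t i < symbols N" if "t \<in> set (snd c')" for t i
  proof -
    have "t \<in> set (moved (snd c) r)" using that c' by simp
    then obtain j where j: "j < k" "t = moved (snd c) r ! j"
      unfolding in_set_conv_nth length_moved[OF r len] by blast
    have "writes r ! j < symbols N"
      using rules_ok(5,6)[OF r] j(1) nth_mem[of j "writes r"] by (metis lessThan_iff subsetD)
    moreover have "fst (snd c ! j) i < symbols N"
      using assms(1) j(1) len by (auto simp: good_config_def)
    ultimately show ?thesis by (simp add: j nth_moved[OF r len] write_move_def)
  qed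
  then have "good_config c'"
    using rules_ok(4)[OF r] length_moved[OF r len] by (auto simp: good_config_def c' r_def)
  with r c' show ?thesis by (intro conjI bexI[of _ r]) (simp_all add: r_def)
qed

lemma table_of_accepting:
  assumes "(tm_step N ^^ n) (init_config N x) c" "fst c = accept N" "n \<le> T"
  shows "\<exists>a. table a"
proof -
  obtain f where f: "f 0 = init_config N x" "f n = c" "\<And>i. i < n \<Longrightarrow> tm_step N (f i) (f (Suc i))"
    using assms(1) unfolding relpowp_fun_conv by blast
  have good: "good_config (f i)" if "i \<le> n" for i
    using that by (induction i) (use f good_init rule_of_step in auto)
  \<comment> \<open>From time n on the accepting configuration c is kept.\<close>
  define g where "g t = f (min t n)" for t
  have goodg: "good_config (g t)" for t using good by (simp add: g_def)
  have "\<exists>r\<in>rules. src r = fst (g t) \<and> reads r = map read_head (snd (g t)) \<and>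
      tgt r = fst (g (Suc t)) \<and> snd (g (Suc t)) = moved (snd (g t)) r" for t
  proof (cases "t < n")
    case True
    with rule_of_step[OF good f(3)[OF True]] show ?thesis by (simp add: g_def min_def Suc_le_eq)
  next
    case False
    then have gt: "g t = c" "g (Suc t) = c" by (simp_all add: g_def f(2) min_def)
    have c: "good_config c" using goodg[of t] gt by simp
    let ?rs = "map read_head (snd c)"
    define r where "r = Rule (accept N) ?rs (accept N) ?rs (replicate k 0)"
    have r: "r \<in> rules"
      using c assms(2) by (auto simp: rules_def r_def good_config_def read_head_def)
    have "moved (snd c) r = snd c"
      by (rule moved_stays[OF r]) (use c in \<open>auto simp: r_def good_config_def\<close>)
    with r show ?thesis unfolding gt by (intro bexI[of _ r]) (simp_all add: r_def assms(2))
  qed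
  then obtain R where R: "\<And>t. R t \<in> rules" "\<And>t. src (R t) = fst (g t)"
    "\<And>t. reads (R t) = map read_head (snd (g t))" "\<And>t. tgt (R t) = fst (g (Suc t))"
    "\<And>t. snd (g (Suc t)) = moved (snd (g t)) (R t)"
    by metis
  have len: "length (snd (g t)) = k" for t using goodg[of t] by (simp add: good_config_def)
  define a where "a t s = Cell (R t) (map (\<lambda>u. fst u (int s - int T)) (snd (g t)))
    (map (\<lambda>u. snd u = int s - int T) (snd (g t)))" for t s :: nat
  have a: "rule (a t s) = R t" "length (syms (a t s)) = k" "length (heads (a t s)) = k"
    "j < k \<Longrightarrow> syms (a t s) ! j = fst (snd (g t) ! j) (int s - int T)"
    "j < k \<Longrightarrow> heads (a t s) ! j \<longleftrightarrow> snd (snd (g t) ! j) = int s - int T" for t s j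
    using len[of t] by (simp_all add: a_def)
  have "a t s \<in> cells" for t s
  proof -
    have "set (syms (a t s)) \<subseteq> {..<symbols N}"
      using goodg[of t] by (auto simp: a_def good_config_def)
    moreover have "syms (a t s) ! j = reads (R t) ! j" if "j < k" "heads (a t s) ! j" for j
      using that len[of t] by (simp add: a R(3) read_head_def)
    ultimately show ?thesis using R(1) a by (auto simp: cells_def)
  qed
  moreover have "\<not> clash t s (a t s) t' s' (a t' s')" if "t \<le> T" "t' \<le> T" for t s t' s'
  proof -
    have nth: "snd (g (Suc t)) ! j = write_move (snd (g t) ! j) (writes (R t) ! j) (moves (R t) ! j)"
      if "j < k" for j
      using nth_moved[OF R(1) len that] by (simp add: R(5))
    have "g T = c" using assms(3) f(2) by (simp add: g_def)
    then have "src (rule (a T s)) = accept N" by (simp add: a R(2) assms(2))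
    moreover have "\<not> init_clash (a 0 s) (input_symbol x T s) (s = T)"
    proof -
      have g0: "g 0 = init_config N x" by (simp add: g_def f)
      have "src (rule (a 0 s)) = start N" by (simp add: a R(2) g0 init_config_def)
      moreover have "syms (a 0 s) = input_symbol x T s # replicate (k - 1) 0"
        using tables_pos by (simp add: a_def g0 init_config_def input_symbol_def map_replicate_const)
          (simp add: tape_of_def)
      moreover have "heads (a 0 s) = replicate k (s = T)"
      proof (rule nth_equalityI)
        fix j assume "j < length (heads (a 0 s))"
        then have j: "j < k" by (simp add: a)
        have "snd (snd (g 0) ! j) = 0"
          using j by (cases j) (simp_all add: g0 init_config_def tape_of_def)
        then show "heads (a 0 s) ! j = replicate k (s = T) ! j" using j by (auto simp: a)
      qed (simp add: a)
      ultimately show ?thesis by (simp add: init_clash_def)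
    qed
    moreover have "\<not> row_clash (a t s) (a t s')" if "s \<noteq> s'"
      using that by (auto simp: row_clash_def a)
    moreover have "\<not> step_clash (a t s) (a (Suc t) s)"
      by (auto simp: step_clash_def a R(2,4) nth write_move_def)
    moreover have "\<not> move_clash d (a t s) (a (Suc t) s')" if "int s' - int s = d" for d
      using that by (auto simp: move_clash_def a nth write_move_def)
    ultimately show ?thesis unfolding clash_def by auto
  qed
  ultimately show ?thesis unfolding table_def by blast
qed

end

section \<open>The conflict graph of the table\<close>

context bounded_ntm
begin

text \<open>The list depends on the machine alone and not on the input or T, so it can be built into
  a program. \<open>None\<close> stands in front to make \<open>(0, 0, None)\<close> the first
  vertex.\<close>

definition vals :: "cell option list" where
  "vals = None # map Some (SOME cs. set cs = cells \<and> distinct cs)"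

lemma vals: "set vals = insert None (Some ` cells)" "distinct vals"
proof -
  have "\<exists>cs. set cs = cells \<and> distinct cs"
    using finite_distinct_list[OF finite_cells] .
  from someI_ex[OF this] show "set vals = insert None (Some ` cells)" "distinct vals"
    by (auto simp: vals_def distinct_map)
qed

definition conflict :: "nat \<times> nat \<times> cell option \<Rightarrow> nat \<times> nat \<times> cell option \<Rightarrow> bool" where
  "conflict = (\<lambda>(t, s, d) (t', s', d').
     case (d, d') of (None, None) \<Rightarrow> False | (Some c, Some c') \<Rightarrow> clash t s c t' s' c' | _ \<Rightarrow> True)"

definition vertices :: "(nat \<times> nat \<times> cell option) list" where
  "vertices = concat (map (\<lambda>t. concat (map (\<lambda>s. map (\<lambda>d. (t, s, d)) vals) [0..<Suc (2 * T)])) [0..<Suc T])"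

lemma set_vertices: "(t, s, d) \<in> set vertices \<longleftrightarrow> t \<le> T \<and> s \<le> 2 * T \<and> d \<in> set vals"
proof -
  have "(t, s, d) \<in> set vertices \<longleftrightarrow> (\<exists>t'\<in>set [0..<Suc T]. \<exists>s'\<in>set [0..<Suc (2 * T)].
      (t, s, d) \<in> (\<lambda>d. (t', s', d)) ` set vals)"
    by (simp add: vertices_def del: upt_Suc)
  also have "\<dots> \<longleftrightarrow> t \<le> T \<and> s \<le> 2 * T \<and> d \<in> set vals"
    by (auto simp: less_Suc_eq_le image_iff simp del: upt_Suc)
  finally show ?thesis .
qed

lemma distinct_vertices: "distinct vertices"
proof -
  have "distinct (concat (map (\<lambda>s. map (\<lambda>d. (t, s, d)) vals) [0..<n]))" for t n :: nat
    using vals(2) by (induction n) (auto simp: distinct_map inj_on_def)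
  then have "distinct (concat (map (\<lambda>t. concat (map (\<lambda>s. map (\<lambda>d. (t, s, d)) vals) [0..<n])) [0..<n']))"
    for n n' :: nat
    by (induction n') auto
  then show ?thesis unfolding vertices_def .
qed

lemma hd_vertices: "vertices \<noteq> []" "hd vertices = (0, 0, None)"
  by (simp_all add: vertices_def vals_def upt_conv_Cons del: upt_Suc)

sublocale conflict_graph vertices "\<lambda>u v. conflict u v \<or> conflict v u" "(0, 0, None)"
  by unfold_locales (use distinct_vertices set_vertices vals in auto)

definition grid :: "(nat \<times> nat) set" where
  "grid = {..T} \<times> {..2 * T}"

lemma indep_unique:
  assumes "indep I" "(t, s, d) \<in> I" "(t, s, d') \<in> I"
  shows "d = d'"
proof -
  have "\<not> conflict (t, s, d) (t, s, d')" using assms by (auto simp: indep_def)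
  then show ?thesis by (auto simp: conflict_def clash_def split: option.splits)
qed

text \<open>Different values of one cell are in conflict, so an independent set is a partial
  assignment of values to cells. This bounds its size by that of the grid.\<close>

lemma indep_places:
  assumes "indep I"
  shows "inj_on (\<lambda>(t, s, d). (t, s)) I" "(\<lambda>(t, s, d). (t, s)) ` I \<subseteq> grid"
proof -
  show "inj_on (\<lambda>(t, s, d). (t, s)) I"
    by (rule inj_onI) (use indep_unique[OF assms] in auto)
  have "I \<subseteq> set vertices" using assms by (simp add: indep_def)
  then show "(\<lambda>(t, s, d). (t, s)) ` I \<subseteq> grid"
    by (auto simp: grid_def dest!: subsetD simp: set_vertices)
qed

lemma card_indep: "indep I \<Longrightarrow> card I \<le> card grid"
  using card_mono[OF _ indep_places(2), of I] card_image[OF indep_places(1), of I]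
  by (simp add: grid_def)

lemma full_indep_iff: "(\<exists>I. indep I \<and> card I = card grid \<and> (0, 0, None) \<notin> I) \<longleftrightarrow> (\<exists>a. table a)"
proof
  assume "\<exists>I. indep I \<and> card I = card grid \<and> (0, 0, None) \<notin> I"
  then obtain I where I: "indep I" "card I = card grid" "(0, 0, None) \<notin> I" by blast
  have "card ((\<lambda>(t, s, d). (t, s)) ` I) = card grid"
    using card_image[OF indep_places(1)[OF I(1)]] I(2) by simp
  then have full: "(\<lambda>(t, s, d). (t, s)) ` I = grid"
    by (intro card_subset_eq indep_places(2)[OF I(1)]) (simp_all add: grid_def)
  have ex: "\<exists>d. (t, s, d) \<in> I" if "t \<le> T" "s \<le> 2 * T" for t s
  proof -
    have "(t, s) \<in> (\<lambda>(t, s, d). (t, s)) ` I" using that unfolding full by (simp add: grid_def)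
    then show ?thesis by auto
  qed
  \<comment> \<open>One proper value suffices: it is in conflict with \<open>None\<close> at every
    cell, so no cell of a full independent set holds \<open>None\<close>.\<close>
  obtain c0 where c0: "(0, 0, Some c0) \<in> I" using ex[of 0 0] I(3) by (metis le0 option.exhaust)
  have "\<exists>c. (t, s, Some c) \<in> I" if ts: "t \<le> T" "s \<le> 2 * T" for t s
  proof -
    obtain d where d: "(t, s, d) \<in> I" using ex[OF ts] by blast
    have "\<not> conflict (t, s, d) (0, 0, Some c0)" using I(1) c0 d by (auto simp: indep_def)
    with d show ?thesis by (cases d) (auto simp: conflict_def)
  qed
  then obtain a where a: "\<And>t s. t \<le> T \<Longrightarrow> s \<le> 2 * T \<Longrightarrow> (t, s, Some (a t s)) \<in> I" by metis
  have "a t s \<in> cells" if "t \<le> T" "s \<le> 2 * T" for t s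
    using a[OF that] I(1) vals(1) by (auto simp: indep_def set_vertices dest!: subsetD)
  moreover have "\<not> clash t s (a t s) t' s' (a t' s')"
    if "t \<le> T" "s \<le> 2 * T" "t' \<le> T" "s' \<le> 2 * T" for t s t' s'
  proof -
    have "\<not> conflict (t, s, Some (a t s)) (t', s', Some (a t' s'))"
      using I(1) a[OF that(1,2)] a[OF that(3,4)] unfolding indep_def by blast
    then show ?thesis by (simp add: conflict_def)
  qed
  ultimately show "\<exists>a. table a" unfolding table_def by blast
next
  assume "\<exists>a. table a"
  then obtain a where a: "table a" by blast
  let ?f = "\<lambda>(t, s). (t, s, Some (a t s))"
  have "indep (?f ` grid)"
    using a vals(1) unfolding indep_def by (auto simp: grid_def table_def conflict_def set_vertices)
  moreover have "card (?f ` grid) = card grid"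
    by (rule card_image) (auto simp: inj_on_def)
  ultimately show "\<exists>I. indep I \<and> card I = card grid \<and> (0, 0, None) \<notin> I"
    by (intro exI[of _ "?f ` grid"]) auto
qed

lemma solution_iff_table:
  assumes "pairwise_risk_minimization (enc_instance inst) y"
  shows "le_rats y \<longleftrightarrow> (\<exists>a. table a)"
proof -
  \<comment> \<open>The assignment of \<open>None\<close> to all cells is the full independent set
    that exists for every input and contains z.\<close>
  let ?f = "\<lambda>(t, s). (t, s, None :: cell option)"
  have "indep (?f ` grid)"
    using vals(1) unfolding indep_def by (auto simp: grid_def conflict_def set_vertices)
  moreover have "card (?f ` grid) = card grid"
    by (rule card_image) (auto simp: inj_on_def)
  moreover have "(0, 0, None) \<in> ?f ` grid" by (force simp: grid_def)
  ultimately show ?thesis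
    using solution_reveals[OF card_indep _ _ _ hd_vertices assms] full_indep_iff by blast
qed

lemma solution_iff_mem:
  assumes L: "x \<in> L \<longleftrightarrow> (\<exists>c. (tm_step N)\<^sup>*\<^sup>* (init_config N x) c \<and> fst c = accept N)"
    and le: "\<And>n c. (tm_step N ^^ n) (init_config N x) c \<Longrightarrow> n \<le> T"
    and sol: "pairwise_risk_minimization (enc_instance inst) y"
  shows "le_rats y \<longleftrightarrow> x \<in> L"
proof -
  show ?thesis
    unfolding solution_iff_table[OF sol] L
  proof
    assume "\<exists>a. table a"
    then show "\<exists>c. (tm_step N)\<^sup>*\<^sup>* (init_config N x) c \<and> fst c = accept N"
      using accepting_of_table by blast
  next
    assume "\<exists>c. (tm_step N)\<^sup>*\<^sup>* (init_config N x) c \<and> fst c = accept N"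
    then obtain c n where "(tm_step N ^^ n) (init_config N x) c" "fst c = accept N"
      using rtranclp_imp_relpowp by metis
    then show "\<exists>a. table a" using table_of_accepting le by blast
  qed
qed

end


section \<open>The reduction runs in polynomial time\<close>

lemma PB_input_symbol:
  assumes "PF k x" "PF k u" "PF k s"
  shows "PB k (\<lambda>a. input_symbol (x a) (length (u a)) (length (s a)) = 2)"
    "PB k (\<lambda>a. input_symbol (x a) (length (u a)) (length (s a)) = 0)"
proof -
  let ?w = "\<lambda>a. drop (length (drop (length (u a)) (s a))) (x a)"
  have w: "PF k ?w" by (intro PF_drop assms)
  \<comment> \<open>Dropping computes s' - T truncated at 0, hence the guard: places left of the
    origin are blank.\<close>
  have *: "input_symbol x' T s' =
      (if T \<le> s' \<and> drop (s' - T) x' \<noteq> [] then if hd (drop (s' - T) x') then 2 else 1 else 0)" for x' T s'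
    by (auto simp: input_symbol_def tape_of_def hd_drop_conv_nth nat_diff_distrib)
  have "PB k (\<lambda>a. length (u a) \<le> length (s a) \<and> (?w a \<noteq> [] \<and> hd (?w a)))"
    by (intro PB_conj PB_hd PB_length_le w assms)
  then show "PB k (\<lambda>a. input_symbol (x a) (length (u a)) (length (s a)) = 2)"
    by (rule PB_cong) (auto simp: *)
  have "PB k (\<lambda>a. \<not> (length (u a) \<le> length (s a) \<and> \<not> ?w a = []))"
    by (intro PB_conj PB_not PB_Nil PB_length_le w assms)
  then show "PB k (\<lambda>a. input_symbol (x a) (length (u a)) (length (s a)) = 0)"
    by (rule PB_cong) (auto simp: *)
qed

text \<open>The symbol is 0, 1 or 2, so P enters only through three constants and may be any
  predicate.\<close>

lemma PB_apply_input_symbol: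
  assumes "PF k x" "PF k u" "PF k s"
  shows "PB k (\<lambda>a. P (input_symbol (x a) (length (u a)) (length (s a))))"
proof -
  have "PB k (\<lambda>a. if input_symbol (x a) (length (u a)) (length (s a)) = 2 then P 2
      else if input_symbol (x a) (length (u a)) (length (s a)) = 0 then P 0 else P 1)"
    by (intro PB_If PB_input_symbol assms PB_const)
  moreover have "(if input_symbol x' T s' = 2 then P 2 else if input_symbol x' T s' = 0 then P 0 else P 1)
      = P (input_symbol x' T s')" for x' T s'
  proof -
    have "input_symbol x' T s' \<in> {0, 1, 2}" by (auto simp: input_symbol_def tape_of_def)
    then show ?thesis by (elim insertE) simp_all
  qed
  ultimately show ?thesis by simp
qed

text \<open>The cell values c and c' are fixed, so all conditions on them are constants of the
  program. What remains to be computed is the comparison of times and places and the input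
  symbol.\<close>

lemma PB_clash:
  assumes N: "wf_tm N" and PF: "PF k x" "PF k u" "PF k t" "PF k s" "PF k t'" "PF k s'"
  shows "PB k (\<lambda>a. bounded_ntm.clash N (x a) (length (u a))
    (length (t a)) (length (s a)) c (length (t' a)) (length (s' a)) c')"
proof -
  have init: "PB k (\<lambda>a. bounded_ntm.init_clash N c
      (input_symbol (x a) (length (u a)) (length (s a))) (length (s a) = length (u a)))"
  proof -
    have "PB k (\<lambda>a. if length (s a) = length (u a)
        then bounded_ntm.init_clash N c (input_symbol (x a) (length (u a)) (length (s a))) True
        else bounded_ntm.init_clash N c (input_symbol (x a) (length (u a)) (length (s a))) False)"
      by (intro PB_If PB_length_eq PB_apply_input_symbol PF)
    then show ?thesis by (rule PB_cong) auto
  qed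
  have eq: "PB k (\<lambda>a. length (f a) = length (g a))" if "PF k f" "PF k g" for f g
    using that by (rule PB_length_eq)
  have suc: "PB k (\<lambda>a. length (f a) = Suc (length (g a)))" if "PF k f" "PF k g" for f g
    using PB_length_eq[OF that(1) PF_Cons[OF that(2)]] by simp
  have zero: "PB k (\<lambda>a. length (t a) = 0)" using PB_Nil[OF PF(3)] by simp
  have N': "bounded_ntm N" using N by unfold_locales
  show ?thesis
    unfolding bounded_ntm.clash_def[OF N']
    by (intro PB_disj PB_conj PB_not PB_const init zero eq suc PF)
qed

lemma PB_conflict:
  assumes "wf_tm N" "PF k x" "PF k u" "PF k t" "PF k s" "PF k t'" "PF k s'"
  shows "PB k (\<lambda>a. bounded_ntm.conflict N (x a) (length (u a))
    (length (t a), length (s a), d) (length (t' a), length (s' a), d'))"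
proof -
  have N': "bounded_ntm N" using assms(1) by unfold_locales
  show ?thesis
    by (cases d; cases d')
      (simp_all add: bounded_ntm.conflict_def[OF N'] PB_const PB_clash[OF assms])
qed

lemma enc_instance_two_judgments:
  "enc_instance (two_judgments f g xs) =
     (True # enc_rat (1 / 2)) @ concat (map (\<lambda>u. True # concat (map (\<lambda>v. True # enc_rat (of_nat (f u v))) xs) @ [False]) xs) @ False #
     (True # enc_rat (1 / 2)) @ concat (map (\<lambda>u. True # concat (map (\<lambda>v. True # enc_rat (of_nat (g u v))) xs) @ [False]) xs) @ [False, False]"
  by (simp add: enc_instance_def two_judgments_def enc_list_def o_def)

text \<open>The loops over times and places run on unary counters, while cell values and sides are
  unrolled in the program. This is why G may depend arbitrarily on d and b.\<close>

lemma PF_items: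
  assumes N: "wf_tm N" and G: "\<And>d b. PF (Suc (Suc k)) (G d b)" and "PF k u"
  shows "PF k (\<lambda>a. concat (map (\<lambda>((t, s, d), b). G d b (a @ [unary t, unary s]))
    (vertex_items (bounded_ntm.vertices N (length (u a))))))"
proof -
  have N': "bounded_ntm N" using N by unfold_locales
  let ?vals = "bounded_ntm.vals N"
  let ?G3 = "\<lambda>a. concat (map (\<lambda>d. G d False a @ G d True a) ?vals)"
  \<comment> \<open>The length of \<open>True # u @ u\<close> is 2T + 1, the number of
    places.\<close>
  let ?G2 = "\<lambda>a. concat (map (\<lambda>s. ?G3 (a @ [unary s])) [0..<length (True # u (take k a) @ u (take k a))])"
  have "PF (Suc k) ?G2"
    by (intro PF_concat_upt PF_concat_list PF_append PF_Cons G PF_weaken[OF assms(3)]) simp_all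
  then have "PF k (\<lambda>a. concat (map (\<lambda>t. ?G2 (a @ [unary t])) [0..<length (True # u a)]))"
    by (rule PF_concat_upt[OF PF_Cons[OF assms(3)]])
  then show ?thesis
  proof (rule PF_cong)
    have *: "concat (map F (concat (map (\<lambda>v. [(v, False), (v, True)]) vs))) =
        concat (map (\<lambda>v. F (v, False) @ F (v, True)) vs)"
      for F :: "'v \<times> bool \<Rightarrow> bool list" and vs by (induction vs) auto
    have **: "concat (map F (concat (map H ys))) = concat (map (\<lambda>y. concat (map F (H y))) ys)"
      for F :: "'v \<Rightarrow> bool list" and H :: "'w \<Rightarrow> 'v list" and ys by (induction ys) auto
    fix a :: "bool list list" assume a: "length a = k"
    show "concat (map (\<lambda>t. ?G2 (a @ [unary t])) [0..<length (True # u a)]) =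
        concat (map (\<lambda>((t, s, d), b). G d b (a @ [unary t, unary s]))
        (vertex_items (bounded_ntm.vertices N (length (u a)))))"
      unfolding vertex_items_def * bounded_ntm.vertices_def[OF N'] **
      by (simp add: a mult_2 o_def del: upt_Suc)
  qed
qed

text \<open>Pulls a case distinction out of the encoding, so that the branches become constant
  strings and no encoder of numbers has to be programmed.\<close>

lemma PF_If_arg:
  "PB k P \<Longrightarrow> PF k (\<lambda>a. h (f a)) \<Longrightarrow> PF k (\<lambda>a. h (g a)) \<Longrightarrow> PF k (\<lambda>a. h (if P a then f a else g a))"
  unfolding if_distrib[of h] by (rule PF_If)

text \<open>The six arguments of an entry are the input, T in unary, and time and place of the two
  vertices, in this order.\<close>

lemma PF_edges:
  assumes N: "wf_tm N"
    and E: "\<And>d b d' b'. PF 6 (\<lambda>a. enc_rat (of_nat (E (a ! 0) (length (a ! 1))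
      ((length (a ! 2), length (a ! 3), d), b) ((length (a ! 4), length (a ! 5), d'), b'))))"
  shows "PF 2 (\<lambda>a. concat (map (\<lambda>v. True # concat (map (\<lambda>w. True # enc_rat (of_nat (E (a ! 0) (length (a ! 1)) v w)))
      (vertex_items (bounded_ntm.vertices N (length (a ! 1))))) @ [False])
    (vertex_items (bounded_ntm.vertices N (length (a ! 1))))))"
proof -
  let ?items = "\<lambda>a. vertex_items (bounded_ntm.vertices N (length (a ! 1)))"
  let ?row = "\<lambda>d b a. concat (map (\<lambda>w. True # enc_rat (of_nat (E (a ! 0) (length (a ! 1))
      ((length (a ! 2), length (a ! 3), d), b) w))) (?items a))"
  have "PF 4 (?row d b)" for d b
  proof -
    let ?G = "\<lambda>d' b' a. True # enc_rat (of_nat (E (a ! 0) (length (a ! 1))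
      ((length (a ! 2), length (a ! 3), d), b) ((length (a ! 4), length (a ! 5), d'), b')))"
    have "PF (Suc (Suc 4)) (?G d' b')" for d' b'
      using PF_Cons[OF E] by simp
    moreover have "PF 4 (\<lambda>a. a ! 1)" by (intro PF_nth) simp
    ultimately have "PF 4 (\<lambda>a. concat (map (\<lambda>((t, s, d), b). ?G d b (a @ [unary t, unary s])) (?items a)))"
      by (rule PF_items[where G = ?G, OF N])
    then show ?thesis
      by (rule PF_cong) (auto simp: nth_append intro!: arg_cong[of _ _ concat])
  qed
  then have "PF (Suc (Suc 2)) (\<lambda>a. True # ?row d b a @ [False])" for d b
    by (intro PF_Cons PF_append PF_const) simp
  moreover have "PF 2 (\<lambda>a. a ! 1)" by (intro PF_nth) simp
  ultimately have "PF 2 (\<lambda>a. concat (map (\<lambda>((t, s, d), b).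
      (\<lambda>a. True # ?row d b a @ [False]) (a @ [unary t, unary s])) (?items a)))"
    by (rule PF_items[where G = "\<lambda>d b a. True # ?row d b a @ [False]", OF N])
  then show ?thesis
    by (rule PF_cong) (auto simp: nth_append intro!: arg_cong[of _ _ concat])
qed

lemma PF_instance:
  assumes N: "wf_tm N"
  shows "PF 2 (\<lambda>a. enc_instance (conflict_instance (bounded_ntm.vertices N (length (a ! 1)))
    (\<lambda>v w. bounded_ntm.conflict N (a ! 0) (length (a ! 1)) v w \<or>
      bounded_ntm.conflict N (a ! 0) (length (a ! 1)) w v) (0, 0, None)))"
proof -
  have edge: "vertex_edge (0, 0, None) ((t, s, d), b) ((t', s', d'), b') =
      (if (t = t' \<and> s = s') \<and> d = d' \<and> \<not> b \<and> b' then if (t = 0 \<and> s = 0) \<and> d = None then 1 else 2 else 0)"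
    for t s t' s' :: nat and d d' :: "cell option" and b b'
    by (simp add: vertex_edge_def vertex_weight_def)
  have zero: "PB 6 (\<lambda>a. length (f a) = 0)" if "PF 6 f" for f
    using PB_Nil[OF that] by simp
  have 1: "PF 6 (\<lambda>a. enc_rat (of_nat (vertex_edge (0, 0, None)
      ((length (a ! 2), length (a ! 3), d), b) ((length (a ! 4), length (a ! 5), d'), b'))))"
    for d d' :: "cell option" and b b'
    unfolding edge
    by (intro PF_If_arg[where h = "\<lambda>n. enc_rat (of_nat n)"] PB_conj zero PB_length_eq PB_const PF_const PF_nth)
      simp_all
  let ?C = "\<lambda>x T v w. bounded_ntm.conflict N x T v w \<or> bounded_ntm.conflict N x T w v"
  have 2: "PF 6 (\<lambda>a. enc_rat (of_nat (conflict_edge (?C (a ! 0) (length (a ! 1)))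
      ((length (a ! 2), length (a ! 3), d), b) ((length (a ! 4), length (a ! 5), d'), b'))))"
    for d d' b b'
    unfolding conflict_edge_def fst_conv snd_conv
    by (intro PF_If_arg[where h = "\<lambda>n. enc_rat (of_nat n)"] PB_conj PB_disj PB_conflict N PB_const PF_const PF_nth)
      simp_all
  show ?thesis
    unfolding conflict_instance_def enc_instance_two_judgments
    by (intro PF_append PF_Cons PF_const
        PF_edges[where E = "\<lambda>x T. vertex_edge (0, 0, None)", OF N 1]
        PF_edges[where E = "\<lambda>x T. conflict_edge (?C x T)", OF N 2])
qed

theorem proposition3:
  shows "NP_hard pairwise_risk_minimization"
  unfolding NP_hard_def
proof
  fix L assume "L \<in> NP"
  then obtain N :: tm and p where N: "wf_tm N"
    and L: "decides_in (tm_step N) (init_config N) (accept N) (poly p) L"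
    unfolding NP_def by blast
  let ?inst = "\<lambda>x T. conflict_instance (bounded_ntm.vertices N T)
    (\<lambda>v w. bounded_ntm.conflict N x T v w \<or> bounded_ntm.conflict N x T w v) (0, 0, None)"
  show "poly_turing_reducible L pairwise_risk_minimization"
  proof (rule poly_turing_reducibleI)
    have "PF 1 (\<lambda>a. unary (poly p (length (a ! 0))))"
      by (intro PF_unary_poly PF_nth) simp
    from PF_app2[where h = "\<lambda>x u. enc_instance (?inst x (length u))", OF PF_instance[OF N] PF_nth this]
    show "PF 1 (\<lambda>a. enc_instance (?inst (a ! 0) (poly p (length (a ! 0)))))" by simp
    show "PB 1 (\<lambda>a. le_rats (a ! 0))"
      by (intro PB_le_rats PF_nth) simp
    fix g x assume g: "solves g pairwise_risk_minimization"
    interpret bounded_ntm N x "poly p (length x)"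
      using N by unfold_locales
    \<comment> \<open>A solver is correct only where a solution exists; validity of the instance
      provides one.\<close>
    have "pairwise_risk_minimization (enc_instance inst) (g (enc_instance inst))"
      using g exists_short_solution[OF valid] unfolding solves_def by blast
    moreover have "x \<in> L \<longleftrightarrow> (\<exists>c. (tm_step N)\<^sup>*\<^sup>* (init_config N x) c \<and> fst c = accept N)"
      and "\<And>n c. (tm_step N ^^ n) (init_config N x) c \<Longrightarrow> n \<le> poly p (length x)"
      using L unfolding decides_in_def by blast+
    ultimately show "le_rats (g (enc_instance (?inst x (poly p (length x))))) \<longleftrightarrow> x \<in> L"
      using solution_iff_mem by blast
  qed
qed

end
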